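(* Let $G$ be a locally compact group, $H$ a compact subgroup of $G$, and $\xi:H\to\mathbb{T}$ a character of $H$. Then $L^1_\xi(G,H)^*$ is isometrically isomorphic to $L^\infty_\xi(G,H)$.
   Context: $\lambda_G$ is a fixed left Haar measure on $G$, and $L^1(G)=L^1(G,\lambda_G)$ (complex valued). $\mathbb{T}=\{z\in\mathbb{C}:|z|=1\}$; a character of $H$ is a continuous group homomorphism $H\to\mathbb{T}$. $\mathrm{q}:G\to G/H$, $\mathrm{q}(x)=xH$, is the canonical map, $\mathcal{C}(G)$ is the space of continuous complex functions on $G$, and $R_hf(y):=f(yh)$. $\mathcal{C}_c(G|H):=\{\psi\in\mathcal{C}(G): \mathrm{q}(\mathrm{supp}(\psi))\text{ is compact in }G/H\}$, and $M_\xi(G,H):=\{\psi\in\mathcal{C}_c(G|H): \psi(xh)=\xi(h)\psi(x)\text{ for all }x\in G,\ h\in H\}$. (Since $H$ is compact, $M_\xi(G,H)\subseteq\mathcal{C}_c(G)$.) $L^1_\xi(G,H)$ is the Banach completion of $M_\xi(G,H)$ with respect to $\|\cdot\|_{L^1(G)}$, viewed as a closed subspace of $L^1(G)$ (the closure of $M_\xi(G,H)$ in $L^1(G)$). $L^\infty(G)$ is the Banach space of all locally $\lambda_G$-measurable functions $f:G\to\mathbb{C}$ that are bounded except on a locally $\lambda_G$-null set, modulo functions that are zero locally almost everywhere, with norm $\|f\|_\infty:=\inf\{t: |f(x)|\le t\text{ for locally almost every }x\in G\}$. $L^\infty_\xi(G,H)$ is its closed subspace $\{\psi\in L^\infty(G):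 R_h\psi=\xi(h)\psi\text{ for all }h\in H\}$. Convention: the paper identifies $L^\infty(G)$ isometrically with $L^1(G)^*$ through $g\mapsto\Lambda_g$, $\Lambda_g(f)=\int_G f\overline{g}\,\mathrm{d}\lambda_G$, which is conjugate-linear in $g$; "isometrically isomorphic" between such a function space and a dual space is understood with respect to identifications of this kind. *)

theory Defs
  imports "HOL-Analysis.Analysis"
begin

text \<open>
  The group \<open>G\<close> is a type of class \<^class>\<open>topological_group_add\<close>. That class does not assume
  commutativity: \<open>G\<close> is an arbitrary topological group whose operation is written \<open>+\<close>. So
  \<open>x + h\<close> stands for \<open>xh\<close>, \<open>0\<close> for the identity and \<open>- x\<close> for the inverse.
\<close>

section \<open>Groups, cosets and Haar measure\<close>

definition compact_subgroup :: "'a::topological_group_add set \<Rightarrow> bool" where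
  "compact_subgroup H \<longleftrightarrow>
     0 \<in> H \<and> (\<forall>h\<in>H. \<forall>k\<in>H. h + k \<in> H) \<and> (\<forall>h\<in>H. - h \<in> H) \<and> compact H"

text \<open>The values of a character of \<open>H\<close> outside \<open>H\<close> are irrelevant.\<close>

definition is_character :: "'a::topological_group_add set \<Rightarrow> ('a \<Rightarrow> complex) \<Rightarrow> bool" where
  "is_character H \<xi> \<longleftrightarrow>
     continuous_on H \<xi> \<and> (\<forall>h\<in>H. cmod (\<xi> h) = 1) \<and> (\<forall>h\<in>H. \<forall>k\<in>H. \<xi> (h + k) = \<xi> h * \<xi> k)"

definition left_coset :: "'a::group_add set \<Rightarrow> 'a \<Rightarrow> 'a set" where
  "left_coset H x = (\<lambda>h. x + h) ` H"

text \<open>The quotient topology on \<open>G/H\<close>; the canonical map \<open>q\<close> is \<open>left_coset H\<close>.\<close>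

definition coset_topology :: "'a::topological_group_add set \<Rightarrow> 'a set topology" where
  "coset_topology H = topology (\<lambda>U. U \<subseteq> range (left_coset H) \<and> open (left_coset H -` U))"

lemma openin_coset_topology:
  "openin (coset_topology H) U \<longleftrightarrow> U \<subseteq> range (left_coset H) \<and> open (left_coset H -` U)"
proof -
  have "istopology (\<lambda>U. U \<subseteq> range (left_coset H) \<and> open (left_coset H -` U))"
    unfolding istopology_def by (auto simp: vimage_Union intro!: open_Int)
  then show ?thesis
    unfolding coset_topology_def by (simp add: topology_inverse')
qed

lemma topspace_coset_topology: "topspace (coset_topology H) = range (left_coset H)"
proof -
  have "left_coset H -` range (left_coset H) = UNIV"
    by auto
  then have "openin (coset_topology H) (range (left_coset H))"
    by (simp add: openin_coset_topology)
  then show ?thesis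
    by (meson openin_coset_topology openin_subset openin_topspace subset_antisym)
qed

lemma quotient_map_left_coset: "quotient_map euclidean (coset_topology H) (left_coset H)"
  unfolding quotient_map_def
  by (auto simp: topspace_coset_topology openin_coset_topology vimage_def)

definition radon_measure :: "'a::t2_space measure \<Rightarrow> bool" where
  "radon_measure M \<longleftrightarrow>
     sets M = sets borel \<and>
     (\<forall>K. compact K \<longrightarrow> emeasure M K < \<infinity>) \<and>
     (\<forall>E\<in>sets borel. emeasure M E = (INF U\<in>{U. open U \<and> E \<subseteq> U}. emeasure M U)) \<and>
     (\<forall>U. open U \<longrightarrow> emeasure M U = (SUP K\<in>{K. compact K \<and> K \<subseteq> U}. emeasure M K))"

definition left_haar_measure :: "'a::{topological_group_add, t2_space} measure \<Rightarrow> bool" where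
  "left_haar_measure M \<longleftrightarrow>
     radon_measure M \<and> emeasure M UNIV \<noteq> 0 \<and>
     (\<forall>x. \<forall>E\<in>sets borel. emeasure M ((\<lambda>y. x + y) ` E) = emeasure M E)"

section \<open>Complex normed spaces with explicit carriers\<close>

record 'v cnormed =
  vcarrier :: "'v set"
  vadd :: "'v \<Rightarrow> 'v \<Rightarrow> 'v"
  vscale :: "complex \<Rightarrow> 'v \<Rightarrow> 'v"
  vnorm :: "'v \<Rightarrow> real"

definition norm_closure :: "'v cnormed \<Rightarrow> 'v set \<Rightarrow> 'v set" where
  "norm_closure X S =
     {x \<in> vcarrier X. \<forall>e>0. \<exists>s\<in>S. vnorm X (vadd X x (vscale X (-1) s)) < e}"

text \<open>Functionals are made extensional (\<open>undefined\<close> off the carrier), so that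
  distinct elements of the dual are distinct as functionals on the carrier.\<close>

definition dual_space :: "'v cnormed \<Rightarrow> ('v \<Rightarrow> complex) cnormed" where
  "dual_space X = \<lparr>
     vcarrier = {\<phi> \<in> extensional (vcarrier X).
       (\<forall>x\<in>vcarrier X. \<forall>y\<in>vcarrier X. \<phi> (vadd X x y) = \<phi> x + \<phi> y) \<and>
       (\<forall>c. \<forall>x\<in>vcarrier X. \<phi> (vscale X c x) = c * \<phi> x) \<and>
       (\<exists>B. \<forall>x\<in>vcarrier X. cmod (\<phi> x) \<le> B * vnorm X x)},
     vadd = (\<lambda>\<phi> \<psi>. restrict (\<lambda>x. \<phi> x + \<psi> x) (vcarrier X)),
     vscale = (\<lambda>c \<phi>. restrict (\<lambda>x. c * \<phi> x) (vcarrier X)),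
     vnorm = (\<lambda>\<phi>. Sup {cmod (\<phi> x) |x. x \<in> vcarrier X \<and> vnorm X x \<le> 1}) \<rparr>"

definition conj_isometric_iso :: "'v cnormed \<Rightarrow> 'w cnormed \<Rightarrow> ('v \<Rightarrow> 'w) \<Rightarrow> bool" where
  "conj_isometric_iso X Y T \<longleftrightarrow>
     bij_betw T (vcarrier X) (vcarrier Y) \<and>
     (\<forall>x\<in>vcarrier X. \<forall>y\<in>vcarrier X. T (vadd X x y) = vadd Y (T x) (T y)) \<and>
     (\<forall>c. \<forall>x\<in>vcarrier X. T (vscale X c x) = vscale Y (cnj c) (T x)) \<and>
     (\<forall>x\<in>vcarrier X. vnorm Y (T x) = vnorm X x)"

text \<open>Quotient of a space \<open>V\<close> of functions, with seminorm \<open>p\<close>, by an equivalence relation \<open>E\<close>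
  compatible with the vector operations and \<open>p\<close>. The elements are the equivalence classes; then
  \<open>p ` C\<close> is a singleton for every class \<open>C\<close>.\<close>

definition quotient_space ::
  "('a \<Rightarrow> complex) set \<Rightarrow> (('a \<Rightarrow> complex) \<times> ('a \<Rightarrow> complex)) set \<Rightarrow>
   (('a \<Rightarrow> complex) \<Rightarrow> real) \<Rightarrow> ('a \<Rightarrow> complex) set cnormed" where
  "quotient_space V E p = \<lparr>
     vcarrier = V // E,
     vadd = (\<lambda>C D. \<Union>f\<in>C. \<Union>g\<in>D. E `` {\<lambda>x. f x + g x}),
     vscale = (\<lambda>c C. \<Union>f\<in>C. E `` {\<lambda>x. c * f x}),
     vnorm = (\<lambda>C. the_elem (p ` C)) \<rparr>"

section \<open>The spaces \<open>L1\<close> and \<open>L1_xi\<close>\<close>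

definition L1_rel :: "'a measure \<Rightarrow> (('a \<Rightarrow> complex) \<times> ('a \<Rightarrow> complex)) set" where
  "L1_rel M = {(f, g). integrable M f \<and> integrable M g \<and> (AE x in M. f x = g x)}"

definition L1_space :: "'a measure \<Rightarrow> ('a \<Rightarrow> complex) set cnormed" where
  "L1_space M = quotient_space {f. integrable M f} (L1_rel M) (\<lambda>f. \<integral>x. cmod (f x) \<partial>M)"

definition Cc_rel :: "'a::topological_group_add set \<Rightarrow> ('a \<Rightarrow> complex) set" where
  "Cc_rel H = {\<psi>. continuous_on UNIV \<psi> \<and>
     compactin (coset_topology H) (left_coset H ` closure {x. \<psi> x \<noteq> 0})}"

definition M_xi :: "'a::topological_group_add set \<Rightarrow> ('a \<Rightarrow> complex) \<Rightarrow> ('a \<Rightarrow> complex) set" where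
  "M_xi H \<xi> = {\<psi> \<in> Cc_rel H. \<forall>x. \<forall>h\<in>H. \<psi> (x + h) = \<xi> h * \<psi> x}"

definition L1_xi_space :: "'a::topological_group_add measure \<Rightarrow> 'a set \<Rightarrow> ('a \<Rightarrow> complex) \<Rightarrow>
    ('a \<Rightarrow> complex) set cnormed" where
  "L1_xi_space M H \<xi> = (L1_space M)
     \<lparr> vcarrier := norm_closure (L1_space M) ((\<lambda>\<psi>. L1_rel M `` {\<psi>}) ` M_xi H \<xi>) \<rparr>"

section \<open>The spaces \<open>Linf\<close> and \<open>Linf_xi\<close>\<close>

text \<open>\<open>M\<close> need not be sigma-finite, so \<open>Linf\<close> is formed with the local notions, which test
  against the measurable sets of finite measure.\<close>

definition loc_sets :: "'a measure \<Rightarrow> 'a set set" where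
  "loc_sets M = {E. E \<subseteq> space M \<and> (\<forall>F\<in>sets M. emeasure M F < \<infinity> \<longrightarrow> E \<inter> F \<in> sets M)}"

definition loc_null_sets :: "'a measure \<Rightarrow> 'a set set" where
  "loc_null_sets M =
     {E \<in> loc_sets M. \<forall>F\<in>sets M. emeasure M F < \<infinity> \<longrightarrow> emeasure M (E \<inter> F) = 0}"

definition loc_AE :: "'a measure \<Rightarrow> ('a \<Rightarrow> bool) \<Rightarrow> bool" where
  "loc_AE M P \<longleftrightarrow> (\<exists>N\<in>loc_null_sets M. {x \<in> space M. \<not> P x} \<subseteq> N)"

definition loc_measurable :: "'a measure \<Rightarrow> ('a \<Rightarrow> complex) \<Rightarrow> bool" where
  "loc_measurable M f \<longleftrightarrow> (\<forall>A\<in>sets borel. f -` A \<inter> space M \<in> loc_sets M)"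

definition Linf_funs :: "'a measure \<Rightarrow> ('a \<Rightarrow> complex) set" where
  "Linf_funs M = {f. loc_measurable M f \<and> (\<exists>t. loc_AE M (\<lambda>x. cmod (f x) \<le> t))}"

definition Linf_rel :: "'a measure \<Rightarrow> (('a \<Rightarrow> complex) \<times> ('a \<Rightarrow> complex)) set" where
  "Linf_rel M = {(f, g). f \<in> Linf_funs M \<and> g \<in> Linf_funs M \<and> loc_AE M (\<lambda>x. f x = g x)}"

definition Linf_space :: "'a measure \<Rightarrow> ('a \<Rightarrow> complex) set cnormed" where
  "Linf_space M = quotient_space (Linf_funs M) (Linf_rel M)
     (\<lambda>f. Inf {t. loc_AE M (\<lambda>x. cmod (f x) \<le> t)})"

text \<open>The condition \<open>R_h \<psi> = \<xi>(h) \<psi>\<close> is an equality of classes in \<open>Linf\<close>; the exceptional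
  locally null set may depend on \<open>h\<close>.\<close>

definition Linf_xi_space :: "'a::topological_group_add measure \<Rightarrow> 'a set \<Rightarrow> ('a \<Rightarrow> complex) \<Rightarrow>
    ('a \<Rightarrow> complex) set cnormed" where
  "Linf_xi_space M H \<xi> = (Linf_space M)
     \<lparr> vcarrier := {Linf_rel M `` {\<psi>} |\<psi>. \<psi> \<in> Linf_funs M \<and>
         (\<forall>h\<in>H. Linf_rel M `` {\<lambda>y. \<psi> (y + h)} = Linf_rel M `` {\<lambda>y. \<xi> h * \<psi> y})} \<rparr>"

section \<open>The pairing\<close>

text \<open>The functional sending the class of \<open>f\<close> to the integral of \<open>f\<close> times the conjugate of \<open>g\<close>,
  restricted to the carrier of the subspace \<open>X\<close> of \<open>L1\<close>; the integral depends only on the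
  classes \<open>D\<close> of \<open>f\<close> and \<open>C\<close> of \<open>g\<close>.\<close>

definition pairing_functional :: "'a measure \<Rightarrow> ('a \<Rightarrow> complex) set cnormed \<Rightarrow>
    ('a \<Rightarrow> complex) set \<Rightarrow> (('a \<Rightarrow> complex) set \<Rightarrow> complex)" where
  "pairing_functional M X C =
     restrict (\<lambda>D. the_elem {(\<integral>x. f x * cnj (g x) \<partial>M) |f g. f \<in> D \<and> g \<in> C}) (vcarrier X)"

end

theory Submission
  imports Defs
begin

text \<open>
  The functions \<open>f\<close> in \<open>Cc(G)\<close> carry the twisted action \<open>(T_h f)(x) = cnj (\<xi> h) f(x h)\<close> of \<open>H\<close>,
  which preserves the \<open>L1\<close> and \<open>L2\<close> norms because Haar measure is right invariant under the compact
  group \<open>H\<close>. No Haar measure on \<open>H\<close> is needed to average: a sequence in the convex hull of the orbit of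
  \<open>f\<close> that minimises the \<open>L2\<close> norm is Cauchy by the parallelogram law, hence uniformly Cauchy by
  equicontinuity, and its limit \<open>P f\<close> is fixed by all \<open>T_h\<close>, so that \<open>P f\<close> lies in \<open>M_\<xi>\<close>. The map \<open>P\<close> is linear,
  contracts the \<open>L1\<close> norm, and satisfies \<open>\<Lambda>_g (P f) = \<Lambda>_g f\<close> for \<open>g\<close> in \<open>L^\<infinity>_\<xi>\<close>, which makes \<open>g \<mapsto> \<Lambda>_g\<close>
  isometric on \<open>L^\<infinity>_\<xi>\<close>. For a functional \<open>\<phi>\<close> on \<open>L1_\<xi>\<close>, the functional \<open>\<phi> \<circ> P\<close> extends to \<open>L1\<close> and is
  represented by some \<open>g\<close>; since \<open>P T_h = P\<close>, this \<open>g\<close> lies in \<open>L^\<infinity>_\<xi>\<close>.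
\<close>

section \<open>Compactly supported functions on a locally compact group\<close>

text \<open>\<open>G\<close> may be neither sigma-compact nor second countable. Haar measure then
  need not be sigma-finite, and Borel sets of the square of \<open>G\<close> may leave the product
  sigma-algebra, which rules out Fubini. Integrals are therefore exchanged only for continuous
  functions over compact sets, where Stone-Weierstrass reduces everything to products a(x) b(y). For
  the same reason the dual of \<open>L1\<close> is built from Radon-Nikodym densities on pieces of
  finite measure, glued along the cosets of an open sigma-compact subgroup. Invariance under right
  translation by \<open>H\<close> means that the modular function is 1 on \<open>H\<close>. That
  function is never constructed: translation by s multiplies the integrals of all \<open>Cc\<close>
  functions by a common factor, and one \<open>H\<close>-invariant function of positive integral
  forces this factor to be 1. The average arises from an arbitrary minimising sequence, so its
  linearity is not visible. It comes from uniqueness: a covariant function whose pairings with all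
  covariant functions vanish is orthogonal to itself, hence 0.\<close>

lemma locally_compactE:
  fixes x :: "'a::t2_space"
  assumes "locally_compact_space (euclidean :: 'a topology)"
  obtains U K where "open U" "compact K" "x \<in> U" "U \<subseteq> K"
proof -
  have "x \<in> topspace euclidean" by simp
  then obtain U K where "openin euclidean U" "compactin euclidean K" "x \<in> U" "U \<subseteq> K"
    using assms unfolding locally_compact_space_def by blast
  then show ?thesis using that by auto
qed

lemma compact_open_nbhd:
  fixes K :: "'a::t2_space set"
  assumes lc: "locally_compact_space (euclidean :: 'a topology)" and K: "compact K"
  obtains V L where "open V" "compact L" "K \<subseteq> V" "V \<subseteq> L"
proof -
  have that_UC: "\<forall>x::'a. \<exists>U C. open U \<and> compact C \<and> x \<in> U \<and> U \<subseteq> C"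
    by (meson locally_compactE[OF lc])
  obtain U C where UC: "\<And>x. open (U x) \<and> compact (C x) \<and> x \<in> U x \<and> U x \<subseteq> (C x :: 'a set)"
    using that_UC by metis
  obtain S where S: "S \<subseteq> K" "finite S" "K \<subseteq> (\<Union>x\<in>S. U x)"
    using compactE_image[OF K, of K U] UC by blast
  show ?thesis
  proof (rule that[of "\<Union>x\<in>S. U x" "\<Union>x\<in>S. C x"])
    show "open (\<Union>x\<in>S. U x)" "compact (\<Union>x\<in>S. C x)" "(\<Union>x\<in>S. U x) \<subseteq> (\<Union>x\<in>S. C x)"
      using UC S by (auto intro!: compact_UN)
  qed fact
qed

text \<open>A locally compact Hausdorff space need not be normal, so separation is taken pointwise
  from complete regularity and patched together by compactness of \<open>K\<close>. The conclusion
  keeps both sets: vanishing outside \<open>L\<close> puts \<open>f\<close> into \<open>Cc\<close>,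
  vanishing outside \<open>U\<close> bounds it by the indicator of \<open>U\<close>.\<close>

lemma urysohn_locally_compact:
  fixes K :: "'a::t2_space set"
  assumes lc: "locally_compact_space (euclidean :: 'a topology)"
    and K: "compact K" and U: "open U" "K \<subseteq> U"
  obtains f :: "'a \<Rightarrow> real" and L where "continuous_on UNIV f" "\<And>x. 0 \<le> f x" "\<And>x. f x \<le> 1"
    "\<And>x. x \<in> K \<Longrightarrow> f x = 1" "compact L" "L \<subseteq> closure U" "\<And>x. x \<notin> L \<inter> U \<Longrightarrow> f x = 0"
proof -
  obtain V L where VL: "open V" "compact L" "K \<subseteq> V" "V \<subseteq> L"
    using compact_open_nbhd[OF lc K] by blast
  define W where "W = U \<inter> V"
  have W: "open W" "K \<subseteq> W" using VL U by (auto simp: W_def)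
  have "completely_regular_space (euclidean :: 'a topology)"
  proof (intro locally_compact_regular_imp_completely_regular_space lc disjI1)
    show "Hausdorff_space (euclidean :: 'a topology)"
      unfolding Hausdorff_space_def disjnt_def using hausdorff by simp blast
  qed
  then have "\<exists>f::'a\<Rightarrow>real. continuous_on UNIV f \<and> f x = 0 \<and> (\<forall>y. y \<notin> W \<longrightarrow> f y = 1) \<and> (\<forall>y. 0 \<le> f y \<and> f y \<le> 1)"
    if "x \<in> K" for x
  proof -
    assume cr: "completely_regular_space (euclidean :: 'a topology)"
    have "closedin euclidean (- W)" "x \<in> topspace euclidean - (- W)"
      using W that by auto
    then obtain f::"'a\<Rightarrow>real" where "continuous_map euclidean (top_of_set {0..1}) f" "f x = 0" "f ` (- W) \<subseteq> {1}"
      using cr unfolding completely_regular_space_def by meson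
    then show ?thesis
      by (intro exI[of _ f]) (auto simp: continuous_map_in_subtopology)
  qed
  then obtain f :: "'a \<Rightarrow> 'a \<Rightarrow> real" where f: "\<And>x. x \<in> K \<Longrightarrow> continuous_on UNIV (f x)" "\<And>x. x \<in> K \<Longrightarrow> f x x = 0"
    "\<And>x y. x \<in> K \<Longrightarrow> y \<notin> W \<Longrightarrow> f x y = 1" "\<And>x y. x \<in> K \<Longrightarrow> 0 \<le> f x y \<and> f x y \<le> 1" by metis
  have op: "open {y. f x y < 1/2}" if "x \<in> K" for x
    using f(1)[OF that] by (intro open_Collect_less) auto
  obtain S where S: "S \<subseteq> K" "finite S" "K \<subseteq> (\<Union>x\<in>S. {y. f x y < 1/2})"
    using compactE_image[OF K, of K "\<lambda>x. {y. f x y < 1/2}"] op f(2) by force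
  \<comment> \<open>Each point of \<open>K\<close> has a summand above 1/2, hence the factor 2; off
    \<open>W\<close> every summand is 0.\<close>
  define g where "g y = min 1 (2 * (\<Sum>x\<in>S. 1 - f x y))" for y
  have g0: "g y \<ge> 0" for y
    unfolding g_def using f(4) S by (auto intro!: sum_nonneg simp: subset_iff)
  have gK: "g y = 1" if "y \<in> K" for y
  proof -
    obtain x where x: "x \<in> S" "f x y < 1/2" using S \<open>y \<in> K\<close> by blast
    have "1 - f x y \<le> (\<Sum>x\<in>S. 1 - f x y)"
      using f(4) S x by (intro member_le_sum) (auto simp: subset_iff)
    then show ?thesis using x unfolding g_def by auto
  qed
  show ?thesis
  proof (rule that[of g "L \<inter> closure U"])
    show "continuous_on UNIV g"
      unfolding g_def using f(1) S by (auto intro!: continuous_intros simp: subset_iff)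
    show "compact (L \<inter> closure U)" using VL by (simp add: compact_Int_closed)
    show "g x = 0" if "x \<notin> (L \<inter> closure U) \<inter> U" for x
    proof -
      have "x \<notin> W" using that VL closure_subset unfolding W_def by blast
      then have "(\<Sum>y\<in>S. 1 - f y x) = 0" using f(3) S by (intro sum.neutral) auto
      then show ?thesis by (simp add: g_def)
    qed
  qed (use g0 gK in \<open>auto simp: g_def\<close>)
qed

text \<open>For Hausdorff domains this is compactness of the support; a witness \<open>K\<close>
  that merely contains the support is easier to transport under translations and sums. The range
  stays general so that real and complex functions share the lemmas.\<close>

definition Cc :: "('a::topological_space \<Rightarrow> 'b::real_normed_vector) set" where
  "Cc = {f. continuous_on UNIV f \<and> (\<exists>K. compact K \<and> (\<forall>x. x \<notin> K \<longrightarrow> f x = 0))}"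

lemma CcI: "continuous_on UNIV f \<Longrightarrow> compact K \<Longrightarrow> (\<And>x. x \<notin> K \<Longrightarrow> f x = 0) \<Longrightarrow> f \<in> Cc"
  unfolding Cc_def by blast

lemma CcE:
  assumes "f \<in> Cc"
  obtains K where "continuous_on UNIV f" "compact K" "\<And>x. x \<notin> K \<Longrightarrow> f x = 0"
  using assms unfolding Cc_def by blast

lemma Cc_continuous: "f \<in> Cc \<Longrightarrow> continuous_on UNIV f"
  by (simp add: Cc_def)

lemma Cc_add: "f \<in> Cc \<Longrightarrow> g \<in> Cc \<Longrightarrow> (\<lambda>x. f x + g x) \<in> Cc"
  by (elim CcE, rule_tac K="K \<union> Ka" in CcI) (auto intro!: continuous_intros)

lemma Cc_compose:
  assumes "f \<in> Cc" "continuous_on UNIV F" "F 0 = 0"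
  shows "(\<lambda>x. F (f x)) \<in> Cc"
  using assms by (elim CcE) (rule CcI, auto intro: continuous_on_compose2[OF assms(2)])

lemma Cc_mult_right:
  fixes f g :: "_ \<Rightarrow> 'b::real_normed_algebra"
  assumes "f \<in> Cc" "continuous_on UNIV g"
  shows "(\<lambda>x. f x * g x) \<in> Cc"
  using assms by (elim CcE) (rule CcI, auto intro!: continuous_intros)

lemma Cc_cmult:
  fixes f :: "_ \<Rightarrow> 'b::real_normed_algebra"
  shows "f \<in> Cc \<Longrightarrow> (\<lambda>x. c * f x) \<in> Cc"
  by (rule Cc_compose[where F="\<lambda>y. c * y"]) (auto intro!: continuous_intros)

lemma Cc_diff: "f \<in> Cc \<Longrightarrow> g \<in> Cc \<Longrightarrow> (\<lambda>x. f x - g x) \<in> Cc"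
  by (elim CcE, rule_tac K="K \<union> Ka" in CcI) (auto intro!: continuous_intros)

lemma Cc_translate_right:
  fixes f :: "'a::topological_group_add \<Rightarrow> _"
  assumes "f \<in> Cc" shows "(\<lambda>x. f (x + a)) \<in> Cc"
proof -
  obtain K where K: "continuous_on UNIV f" "compact K" "\<And>x. x \<notin> K \<Longrightarrow> f x = 0"
    using CcE[OF assms] by metis
  show ?thesis
  proof (rule CcI)
    show "continuous_on UNIV (\<lambda>x. f (x + a))"
      by (rule continuous_on_compose2[OF K(1)]) (auto intro!: continuous_intros)
    show "compact ((\<lambda>x. x - a) ` K)"
      using K(2) by (intro compact_continuous_image continuous_intros)
    show "f (x + a) = 0" if "x \<notin> (\<lambda>x. x - a) ` K" for x
      using that K(3)[of "x + a"] by (metis add_diff_cancel image_eqI)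
  qed
qed

lemma Cc_bounded:
  assumes "f \<in> Cc" obtains B where "B > 0" "\<And>x. norm (f x) \<le> B"
proof -
  obtain K where K: "continuous_on UNIV f" "compact K" "\<And>x. x \<notin> K \<Longrightarrow> f x = 0"
    using CcE[OF assms] by metis
  have "bounded (f ` K)"
    using K by (intro compact_imp_bounded compact_continuous_image) (auto intro: continuous_on_subset)
  then obtain B where "B > 0" "\<And>x. x \<in> K \<Longrightarrow> norm (f x) \<le> B"
    unfolding bounded_pos by auto
  with K(3) show ?thesis by (intro that[of B]) (metis less_imp_le norm_zero)+
qed

lemma compact_plus:
  fixes K L :: "'a::topological_group_add set"
  assumes "compact K" "compact L"
  shows "compact ((\<lambda>(x, y). x + y) ` (K \<times> L))"
  using assms by (intro compact_continuous_image compact_Times)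
    (auto intro!: continuous_intros simp: split_beta)

text \<open>If a function vanishes off \<open>K\<close>, then all its translates by elements of
  \<open>L\<close> vanish off the single compact set \<open>A\<close>, which is \<open>K\<close>
  plus the negatives of \<open>L\<close>.\<close>

lemma compact_translates:
  fixes K L :: "'a::topological_group_add set"
  assumes "compact K" "compact L"
  obtains A where "compact A" "\<And>x s. x + s \<in> K \<Longrightarrow> s \<in> L \<Longrightarrow> x \<in> A"
proof (rule that)
  show "compact ((\<lambda>(x, y). x + y) ` (K \<times> uminus ` L))"
    by (intro compact_plus compact_continuous_image continuous_intros assms)
  show "x \<in> (\<lambda>(x, y). x + y) ` (K \<times> uminus ` L)" if "x + s \<in> K" "s \<in> L" for x s
    by (rule image_eqI[of _ _ "(x + s, - s)"]) (use that in \<open>auto simp: add.assoc\<close>)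
qed

text \<open>The shift \<open>u\<close> stands between \<open>x\<close> and \<open>h\<close>, so it
  acts on the translate of \<open>f\<close> by \<open>h\<close>; one neighbourhood has to serve all
  of \<open>H\<close>, and compactness of \<open>H\<close> provides it. Points \<open>x\<close>
  outside the compact set \<open>C\<close> give 0 for all \<open>u\<close> in \<open>N\<close>, and
  over \<open>C\<close> times \<open>H\<close> the continuity in \<open>u\<close> is
  uniform.\<close>

lemma right_translates_equicontinuous:
  fixes f :: "'a::{topological_group_add, t2_space} \<Rightarrow> 'b::real_normed_vector"
  assumes lc: "locally_compact_space (euclidean :: 'a topology)"
    and f: "f \<in> Cc" and H: "compact H" and e: "e > 0"
  obtains U where "open U" "0 \<in> U" "\<And>u h x. u \<in> U \<Longrightarrow> h \<in> H \<Longrightarrow> norm (f (x + u + h) - f (x + h)) \<le> e"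
proof -
  obtain K where K: "continuous_on UNIV f" "compact K" "\<And>x. x \<notin> K \<Longrightarrow> f x = 0"
    using CcE[OF f] by metis
  obtain V N :: "'a set" where N: "open V" "compact N" "0 \<in> V" "V \<subseteq> N"
    by (rule locally_compactE[OF lc, of 0]) (rule that)
  obtain A where A: "compact A" and inA: "\<And>x h. x + h \<in> K \<Longrightarrow> h \<in> H \<Longrightarrow> x \<in> A"
    using compact_translates[OF K(2) H] by metis
  obtain A' where A': "compact A'" and inA': "\<And>x u. x + u \<in> A \<Longrightarrow> u \<in> N \<Longrightarrow> x \<in> A'"
    using compact_translates[OF A N(2)] by metis
  define C where "C = A \<union> A'"
  have C: "compact C" using A A' by (simp add: C_def compact_Un)
  have inC: "x \<in> C" if "x + u + h \<in> K \<or> x + h \<in> K" "h \<in> H" "u \<in> N" for x h u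
    using that inA[of x h] inA[of "x + u" h] inA'[of x u] by (auto simp: C_def)
  define F where "F = (\<lambda>(u, x, h). f (x + u + h) - f (x + h))"
  have F: "continuous_on (UNIV \<times> (C \<times> H)) F"
    unfolding F_def split_beta
    by (intro continuous_intros continuous_on_compose2[OF K(1)]) auto
  obtain X0 where X0: "0 \<in> X0" "open X0" "\<forall>u\<in>X0 \<inter> UNIV. \<forall>t\<in>C \<times> H. dist (F (u, t)) (F (0, t)) \<le> e"
    by (rule continuous_on_prod_compactE[OF F compact_Times[OF C H] UNIV_I e])
  show ?thesis
  proof (rule that[of "X0 \<inter> V"])
    fix u h x assume u: "u \<in> X0 \<inter> V" "h \<in> H"
    show "norm (f (x + u + h) - f (x + h)) \<le> e"
    proof (cases "x \<in> C")
      case True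
      then have "dist (F (u, x, h)) (F (0, x, h)) \<le> e" using X0 u by auto
      then show ?thesis by (simp add: F_def dist_norm)
    next
      case False
      then have "x + u + h \<notin> K" "x + h \<notin> K" using inC u N by auto
      then show ?thesis using K(3) e by simp
    qed
  qed (use X0 N in auto)
qed

text \<open>Supplies the continuity of the supremum that replaces an integral over \<open>H\<close>
  in \<open>ex_right_invariant_Cc\<close>.\<close>

lemma continuous_on_SUP_compact:
  fixes F :: "'a::t2_space \<times> 'b::topological_space \<Rightarrow> real"
  assumes F: "continuous_on UNIV F" and C: "compact C" "C \<noteq> {}"
  shows "continuous_on UNIV (\<lambda>x. SUP t\<in>C. F (x, t))"
  unfolding continuous_on_eq_continuous_within
proof
  fix x0
  have bdd: "bdd_above ((\<lambda>t. F (x, t)) ` C)" for x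
    using C(1) by (intro bounded_imp_bdd_above compact_imp_bounded compact_continuous_image
        continuous_on_compose2[OF F]) (auto intro!: continuous_intros)
  show "isCont (\<lambda>x. SUP t\<in>C. F (x, t)) x0"
    unfolding continuous_at tendsto_iff
  proof (intro allI impI)
    fix e :: real assume e: "e > 0"
    obtain X0 where X0: "x0 \<in> X0" "open X0" "\<forall>x\<in>X0 \<inter> UNIV. \<forall>t\<in>C. dist (F (x, t)) (F (x0, t)) \<le> e/2"
      by (rule continuous_on_prod_compactE[of UNIV C F x0 "e/2"])
        (use e C F in \<open>auto intro: continuous_on_subset\<close>)
    have "dist (SUP t\<in>C. F (x, t)) (SUP t\<in>C. F (x0, t)) < e" if "x \<in> X0" for x
    proof -
      have 1: "\<bar>F (x, t) - F (x0, t)\<bar> \<le> e/2" if "t \<in> C" for t using X0 that \<open>x \<in> X0\<close> by (auto simp: dist_real_def)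
      have "(SUP t\<in>C. F (x, t)) \<le> (SUP t\<in>C. F (x0, t)) + e/2"
      proof (rule cSUP_least[OF C(2)])
        fix t assume t: "t \<in> C"
        show "F (x, t) \<le> (SUP t\<in>C. F (x0, t)) + e/2"
          using cSUP_upper[OF t bdd[of x0]] 1[OF t] by linarith
      qed
      moreover have "(SUP t\<in>C. F (x0, t)) \<le> (SUP t\<in>C. F (x, t)) + e/2"
      proof (rule cSUP_least[OF C(2)])
        fix t assume t: "t \<in> C"
        show "F (x0, t) \<le> (SUP t\<in>C. F (x, t)) + e/2"
          using cSUP_upper[OF t bdd[of x]] 1[OF t] by linarith
      qed
      ultimately show ?thesis using e by (simp add: dist_real_def)
    qed
    then show "\<forall>\<^sub>F x in at x0. dist (SUP t\<in>C. F (x, t)) (SUP t\<in>C. F (x0, t)) < e"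
      using X0 by (auto simp: eventually_at_topological)
  qed
qed

section \<open>Invariance of Haar measure\<close>

inductive_set product_sums :: "('a::topological_space \<times> 'b::topological_space \<Rightarrow> real) set" where
  base: "continuous_on UNIV a \<Longrightarrow> continuous_on UNIV b \<Longrightarrow> (\<lambda>p. a (fst p) * b (snd p)) \<in> product_sums"
| add: "f \<in> product_sums \<Longrightarrow> g \<in> product_sums \<Longrightarrow> (\<lambda>p. f p + g p) \<in> product_sums"

lemma product_sums_continuous: "f \<in> product_sums \<Longrightarrow> continuous_on UNIV f"
  by (induction rule: product_sums.induct)
    (auto intro!: continuous_intros elim: continuous_on_compose2)

lemma product_sums_mult:
  assumes "f \<in> product_sums" "g \<in> product_sums"
  shows "(\<lambda>p. f p * g p) \<in> product_sums"
  using assms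
proof (induction rule: product_sums.induct)
  case (base a b)
  from \<open>g \<in> product_sums\<close> show ?case
  proof (induction rule: product_sums.induct)
    case (base a' b')
    have "(\<lambda>p. (a (fst p) * a' (fst p)) * (b (snd p) * b' (snd p))) \<in> product_sums"
      using base \<open>continuous_on UNIV a\<close> \<open>continuous_on UNIV b\<close>
      by (intro product_sums.base continuous_intros)
    then show ?case by (simp add: mult_ac)
  next
    case (add f g)
    then show ?case by (simp add: distrib_left product_sums.add)
  qed
next
  case (add f1 f2)
  then show ?case by (simp add: distrib_right product_sums.add)
qed

text \<open>Stone-Weierstrass: the sums of products form an algebra, and it separates points because
  Urysohn functions of either coordinate belong to it.\<close>

lemma product_sums_dense:
  fixes F :: "'a::t2_space \<times> 'a \<Rightarrow> real"
  assumes lc: "locally_compact_space (euclidean :: 'a topology)"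
    and F: "continuous_on UNIV F" and K: "compact K" "compact L" and e: "e > 0"
  shows "\<exists>g\<in>product_sums. \<forall>p\<in>K \<times> L. \<bar>F p - g p\<bar> < e"
proof -
  have sep: "\<exists>a::'a \<Rightarrow> real. continuous_on UNIV a \<and> a x \<noteq> a y" if "x \<noteq> y" for x y
  proof -
    obtain f :: "'a \<Rightarrow> real" and L where "continuous_on UNIV f"
      "\<And>z. z \<in> {x} \<Longrightarrow> f z = 1" "\<And>z. z \<notin> L \<inter> - {y} \<Longrightarrow> f z = 0"
      by (rule urysohn_locally_compact[OF lc, of "{x}" "- {y}"]) (use \<open>x \<noteq> y\<close> in auto)
    then show ?thesis by (intro exI[of _ f]) auto
  qed
  interpret function_ring_on product_sums "K \<times> L"
  proof
    show "compact (K \<times> L)" using K by (rule compact_Times)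
    show "continuous_on (K \<times> L) f" if "f \<in> product_sums" for f
      using product_sums_continuous[OF that] by (rule continuous_on_subset) simp
    show "(\<lambda>_. c) \<in> product_sums" for c
      using product_sums.base[of "\<lambda>_. c" "\<lambda>_. 1"] by simp
    fix p q :: "'a \<times> 'a" assume "p \<noteq> q"
    then consider "fst p \<noteq> fst q" | "snd p \<noteq> snd q" by (metis prod.collapse)
    then show "\<exists>f\<in>product_sums. f p \<noteq> f q"
    proof cases
      case 1
      then obtain a :: "'a \<Rightarrow> real" where "continuous_on UNIV a" "a (fst p) \<noteq> a (fst q)" using sep by metis
      then show ?thesis using product_sums.base[of a "\<lambda>_. 1"] by (intro bexI) auto
    next
      case 2
      then obtain a :: "'a \<Rightarrow> real" where "continuous_on UNIV a" "a (snd p) \<noteq> a (snd q)" using sep by metis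
      then show ?thesis using product_sums.base[of "\<lambda>_. 1" a] by (intro bexI) auto
    qed
  qed (auto intro: product_sums.add product_sums_mult)
  show ?thesis
    using F e by (intro Stone_Weierstrass_basic) (auto intro: continuous_on_subset)
qed

lemma image_plus_left: "(\<lambda>y. a + y) ` U = (\<lambda>y. - a + y) -` U" for a :: "'a::group_add"
proof (intro set_eqI iffI)
  show "x \<in> (\<lambda>y. a + y) ` U" if "x \<in> (\<lambda>y. - a + y) -` U" for x
    using that by (intro image_eqI[of _ _ "- a + x"]) (auto simp: add.assoc[symmetric])
qed (auto simp: add.assoc[symmetric])

lemma image_plus_right: "(\<lambda>y. y + a) ` U = (\<lambda>y. y + - a) -` U" for a :: "'a::group_add"
proof (intro set_eqI iffI)
  show "x \<in> (\<lambda>y. y + a) ` U" if "x \<in> (\<lambda>y. y + - a) -` U" for x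
    using that by (intro image_eqI[of _ _ "x + - a"]) (auto simp: add.assoc)
qed (auto simp: add.assoc)

section \<open>Positivity and integrability from regularity and left invariance\<close>

locale haar_measure =
  fixes lam :: "'a::{topological_group_add, t2_space} measure"
  assumes lc: "locally_compact_space (euclidean :: 'a topology)"
    and haar: "left_haar_measure lam"
begin

lemma radon: "radon_measure lam"
  using haar by (simp add: left_haar_measure_def)

lemma sets_lam [simp, measurable_cong]: "sets lam = sets borel"
  using radon by (simp add: radon_measure_def)

lemma space_lam [simp]: "space lam = UNIV"
  using sets_eq_imp_space_eq[OF sets_lam] by simp

lemma emeasure_compact: "compact K \<Longrightarrow> emeasure lam K < top"
  using radon by (simp add: radon_measure_def)

lemma outer_regular:
  assumes "E \<in> sets borel" "emeasure lam E < c"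
  obtains U where "open U" "E \<subseteq> U" "emeasure lam U < c"
proof -
  have "emeasure lam E = (INF U\<in>{U. open U \<and> E \<subseteq> U}. emeasure lam U)"
    using radon assms(1) unfolding radon_measure_def by blast
  with assms(2) show ?thesis using that by (auto simp: INF_less_iff)
qed

lemma inner_regular:
  assumes "open U" "c < emeasure lam U"
  obtains K where "compact K" "K \<subseteq> U" "c < emeasure lam K"
proof -
  have "emeasure lam U = (SUP K\<in>{K. compact K \<and> K \<subseteq> U}. emeasure lam K)"
    using radon assms(1) unfolding radon_measure_def by blast
  with assms(2) show ?thesis using that by (auto simp: less_SUP_iff)
qed

lemma borel_plus_left [measurable]: "(\<lambda>x. a + x) \<in> borel_measurable (borel :: 'a measure)"
  by (intro borel_measurable_continuous_onI continuous_intros)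

lemma borel_plus_right [measurable]: "(\<lambda>x. x + a) \<in> borel_measurable (borel :: 'a measure)"
  by (intro borel_measurable_continuous_onI continuous_intros)

lemma emeasure_left: "E \<in> sets borel \<Longrightarrow> emeasure lam ((\<lambda>y. a + y) ` E) = emeasure lam E"
  using haar by (simp add: left_haar_measure_def)

lemma distr_left: "distr lam lam (\<lambda>x. a + x) = lam"
proof (rule measure_eqI)
  fix E assume "E \<in> sets (distr lam lam (\<lambda>x. a + x))"
  then have E: "E \<in> sets borel" by simp
  have "(\<lambda>x. a + x) -` E = (\<lambda>x. - a + x) ` E"
    by (simp add: image_plus_left)
  then show "emeasure (distr lam lam (\<lambda>x. a + x)) E = emeasure lam E"
    using E emeasure_left[OF E, of "- a"] by (simp add: emeasure_distr)
qed simp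

lemma integral_left:
  fixes f :: "'a \<Rightarrow> 'b::{banach, second_countable_topology}"
  assumes "f \<in> borel_measurable borel"
  shows "(\<integral>x. f (a + x) \<partial>lam) = (\<integral>x. f x \<partial>lam)"
  using integral_distr[of "\<lambda>x. a + x" lam lam f] assms by (simp add: distr_left)

text \<open>If a nonempty open set were null, so would be its left translates; finitely many of them
  cover any compact set, so every compact set and, by inner regularity, the whole group would be
  null.\<close>

lemma emeasure_open_pos:
  assumes U: "open U" "x \<in> U"
  shows "emeasure lam U > 0"
proof (rule ccontr)
  assume "\<not> emeasure lam U > 0"
  then have 0: "emeasure lam U = 0" by simp
  have "emeasure lam UNIV > 0" using haar by (simp add: left_haar_measure_def zero_less_iff_neq_zero)
  then obtain K where K: "compact K" "emeasure lam K > 0"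
    using inner_regular[of UNIV 0] by auto
  \<comment> \<open>The translate of \<open>U\<close> that carries \<open>x\<close> to
    \<open>a\<close>.\<close>
  define V where "V a = (\<lambda>y. (a - x) + y) ` U" for a
  have V: "V a = (\<lambda>y. - (a - x) + y) -` U" for a
    unfolding V_def by (rule image_plus_left)
  have V_open: "open (V a)" for a
    unfolding V by (intro open_vimage U continuous_intros)
  have "a \<in> V a" for a using U unfolding V by (simp only: vimage_eq minus_diff_eq diff_add_cancel)
  then have "K \<subseteq> (\<Union>a\<in>K. V a)" by blast
  then obtain S where S: "finite S" "K \<subseteq> (\<Union>a\<in>S. V a)"
    by (rule compactE_image[OF K(1) V_open]) (rule that)
  have "emeasure lam K \<le> emeasure lam (\<Union>a\<in>S. V a)"
    using S V_open by (intro emeasure_mono) auto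
  also have "\<dots> \<le> (\<Sum>a\<in>S. emeasure lam (V a))"
    using S V_open by (intro emeasure_subadditive_finite) auto
  also have "\<dots> = 0"
    unfolding V_def using 0 emeasure_left[of U] U by (intro sum.neutral) simp
  finally show False using K by simp
qed

lemma borel_measurable_lam: "borel_measurable lam = borel_measurable borel"
  by (rule measurable_cong_sets) auto

lemma integrable_on_compact:
  fixes f :: "'a \<Rightarrow> real"
  assumes f: "continuous_on UNIV f" and K: "compact K"
  shows "integrable lam (\<lambda>x. indicator K x * f x)"
proof -
  have [measurable]: "f \<in> borel_measurable borel" "K \<in> sets borel"
    using f K by (auto intro: borel_measurable_continuous_onI borel_compact)
  have "bounded (f ` K)"
    using f K by (intro compact_imp_bounded compact_continuous_image) (auto intro: continuous_on_subset)
  then obtain B where B: "\<And>x. x \<in> K \<Longrightarrow> norm (f x) \<le> B"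
    unfolding bounded_pos by auto
  show ?thesis
    by (rule integrableI_bounded_set[where A=K and B=B])
      (use B K emeasure_compact in \<open>auto intro!: AE_I2\<close>)
qed

lemma integrable_Cc:
  fixes f :: "'a \<Rightarrow> 'b::{banach, second_countable_topology}"
  assumes f: "f \<in> Cc"
  shows "integrable lam f"
proof -
  obtain K where K: "continuous_on UNIV f" "compact K" "\<And>x. x \<notin> K \<Longrightarrow> f x = 0"
    using CcE[OF f] by metis
  obtain B where "\<And>x. norm (f x) \<le> B" using Cc_bounded[OF f] by metis
  with K show ?thesis
    by (intro integrableI_bounded_set[where A=K and B=B])
      (auto intro!: AE_I2 borel_measurable_continuous_onI borel_compact emeasure_compact
        simp: borel_measurable_lam)
qed

lemma Cc_borel:
  assumes "f \<in> Cc"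
  shows "f \<in> borel_measurable borel"
  using assms by (auto simp: Cc_def intro: borel_measurable_continuous_onI)

text \<open>Continuity makes the set where \<open>f\<close> is positive open, and nonempty open sets
  have positive measure.\<close>

lemma integral_Cc_pos:
  fixes f :: "'a \<Rightarrow> real"
  assumes f: "f \<in> Cc" "\<And>x. 0 \<le> f x" "f x0 > 0"
  shows "(\<integral>x. f x \<partial>lam) > 0"
proof -
  have op: "open {x. f x > 0}"
    using Cc_continuous[OF f(1)] by (intro open_Collect_less) auto
  have "(\<integral>x. f x \<partial>lam) \<noteq> 0"
  proof
    assume "(\<integral>x. f x \<partial>lam) = 0"
    then have "AE x in lam. f x = 0"
      using integral_nonneg_eq_0_iff_AE[OF integrable_Cc[OF f(1)]] f by auto
    then have "AE x in lam. x \<notin> {x. f x > 0}" by eventually_elim auto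
    then have "emeasure lam {x. f x > 0} = 0"
      using op by (subst (asm) AE_iff_measurable[of "{x. f x > 0}"]) auto
    with emeasure_open_pos[OF op, of x0] f show False by simp
  qed
  moreover have "(\<integral>x. f x \<partial>lam) \<ge> 0" using f by simp
  ultimately show ?thesis by simp
qed

section \<open>Iterated integrals of continuous functions over compact sets\<close>

lemma integral_compact_bound:
  fixes f :: "'a \<Rightarrow> real"
  assumes f: "continuous_on UNIV f" and K: "compact K" and e: "\<And>x. x \<in> K \<Longrightarrow> \<bar>f x\<bar> \<le> e"
  shows "\<bar>\<integral>x. indicator K x * f x \<partial>lam\<bar> \<le> e * measure lam K"
proof -
  have K_sets: "K \<in> sets lam" using K by (simp add: borel_compact)
  then have int: "integrable lam (\<lambda>x. e * indicator K x)"
    using emeasure_compact[OF K] by (intro integrable_mult_right integrable_real_indicator) auto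
  have "\<bar>\<integral>x. indicator K x * f x \<partial>lam\<bar> \<le> (\<integral>x. \<bar>indicator K x * f x\<bar> \<partial>lam)"
    by (rule integral_abs_bound)
  also have "\<dots> \<le> (\<integral>x. e * indicator K x \<partial>lam)"
    using integrable_on_compact[OF f K] e int
    by (intro integral_mono integrable_abs) (auto split: split_indicator)
  also have "\<dots> = e * measure lam K" using K_sets by simp
  finally show ?thesis .
qed

lemma continuous_on_integral_compact:
  fixes F :: "'a \<times> 'a \<Rightarrow> real"
  assumes F: "continuous_on UNIV F" and C: "compact C"
  shows "continuous_on UNIV (\<lambda>x. \<integral>y. indicator C y * F (x, y) \<partial>lam)"
  unfolding continuous_on_eq_continuous_within
proof
  fix x0
  have cont: "continuous_on UNIV (\<lambda>y. F (x, y))" for x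
    by (intro continuous_on_compose2[OF F] continuous_intros) auto
  show "isCont (\<lambda>x. \<integral>y. indicator C y * F (x, y) \<partial>lam) x0"
    unfolding continuous_at tendsto_iff
  proof (intro allI impI)
    fix e :: real assume e: "e > 0"
    \<comment> \<open>Adding 1 keeps the quotient meaningful when \<open>C\<close> is null.\<close>
    define d where "d = e / (2 * (1 + measure lam C))"
    have d: "d > 0" "d * measure lam C < e" using e
      by (auto simp: d_def field_simps add_pos_nonneg add_nonneg_pos)
    obtain X0 where X0: "x0 \<in> X0" "open X0" "\<forall>x\<in>X0 \<inter> UNIV. \<forall>t\<in>C. dist (F (x, t)) (F (x0, t)) \<le> d"
      by (rule continuous_on_prod_compactE[of UNIV C F x0 d])
        (use d C F in \<open>auto intro: continuous_on_subset\<close>)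
    have "dist (\<integral>y. indicator C y * F (x, y) \<partial>lam) (\<integral>y. indicator C y * F (x0, y) \<partial>lam) < e"
      if "x \<in> X0" for x
    proof -
      have "(\<integral>y. indicator C y * F (x, y) \<partial>lam) - (\<integral>y. indicator C y * F (x0, y) \<partial>lam)
          = (\<integral>y. indicator C y * (F (x, y) - F (x0, y)) \<partial>lam)"
        by (simp add: right_diff_distrib integrable_on_compact[OF cont C])
      also have "\<bar>\<dots>\<bar> \<le> d * measure lam C"
        using X0 that by (intro integral_compact_bound C continuous_on_diff cont) (auto simp: dist_real_def)
      finally show ?thesis using d by (simp add: dist_real_def)
    qed
    then show "\<forall>\<^sub>F x in at x0. dist (\<integral>y. indicator C y * F (x, y) \<partial>lam) (\<integral>y. indicator C y * F (x0, y) \<partial>lam) < e"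
      using X0 by (auto simp: eventually_at_topological)
  qed
qed

definition iterated_integral :: "'a set \<Rightarrow> 'a set \<Rightarrow> ('a \<times> 'a \<Rightarrow> real) \<Rightarrow> real" where
  "iterated_integral K L F = (\<integral>x. indicator K x * (\<integral>y. indicator L y * F (x, y) \<partial>lam) \<partial>lam)"

lemma iterated_integral_add:
  assumes "continuous_on UNIV F" "continuous_on UNIV G" "compact K" "compact L"
  shows "iterated_integral K L (\<lambda>p. c * F p + G p) = c * iterated_integral K L F + iterated_integral K L G"
proof -
  have *: "continuous_on UNIV (\<lambda>y. F (x, y))" "continuous_on UNIV (\<lambda>y. G (x, y))" for x
    by (intro continuous_on_compose2[OF assms(1)] continuous_on_compose2[OF assms(2)] continuous_intros; simp)+
  have "(\<integral>y. indicator L y * (c * F (x, y) + G (x, y)) \<partial>lam) =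
      c * (\<integral>y. indicator L y * F (x, y) \<partial>lam) + (\<integral>y. indicator L y * G (x, y) \<partial>lam)" for x
    by (simp add: distrib_left integrable_on_compact[OF *(1) assms(4)] integrable_on_compact[OF *(2) assms(4)]
        mult.left_commute[of _ c])
  moreover have "integrable lam (\<lambda>x. indicator K x * (\<integral>y. indicator L y * F (x, y) \<partial>lam))"
    "integrable lam (\<lambda>x. indicator K x * (\<integral>y. indicator L y * G (x, y) \<partial>lam))"
    using assms by (auto intro: integrable_on_compact continuous_on_integral_compact)
  ultimately show ?thesis
    by (simp add: iterated_integral_def distrib_left mult.left_commute[of _ c])
qed

lemma iterated_integral_bound:
  assumes "continuous_on UNIV F" "compact K" "compact L"
    and "\<And>x y. x \<in> K \<Longrightarrow> y \<in> L \<Longrightarrow> \<bar>F (x, y)\<bar> \<le> e"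
  shows "\<bar>iterated_integral K L F\<bar> \<le> e * measure lam L * measure lam K"
  unfolding iterated_integral_def
  by (intro integral_compact_bound continuous_on_integral_compact assms
      continuous_on_compose2[OF assms(1)] continuous_intros) auto

lemma iterated_integral_diff_bound:
  assumes "continuous_on UNIV F" "continuous_on UNIV G" "compact K" "compact L"
    and "\<And>x y. x \<in> K \<Longrightarrow> y \<in> L \<Longrightarrow> \<bar>F (x, y) - G (x, y)\<bar> \<le> e"
  shows "\<bar>iterated_integral K L F - iterated_integral K L G\<bar> \<le> e * measure lam L * measure lam K"
proof -
  have "\<bar>iterated_integral K L (\<lambda>p. (-1) * G p + F p)\<bar> \<le> e * measure lam L * measure lam K"
    using assms by (intro iterated_integral_bound) (auto intro!: continuous_intros)
  then show ?thesis
    using iterated_integral_add[OF assms(2,1,3,4), of "-1"] by simp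
qed

text \<open>Both sides factor into a product of two integrals for a(x) b(y), and both depend
  continuously on the integrand in the supremum norm over \<open>K\<close> times \<open>L\<close>;
  density of \<open>product_sums\<close> does the rest.\<close>

lemma iterated_integral_swap:
  assumes F: "continuous_on UNIV F" and K: "compact K" "compact L"
  shows "iterated_integral K L F = iterated_integral L K (\<lambda>p. F (snd p, fst p))"
proof -
  have base: "iterated_integral K L G = iterated_integral L K (\<lambda>p. G (snd p, fst p))"
    if "G \<in> product_sums" for G
    using that
  proof induction
    case (base a b)
    define A where "A = (\<integral>x. indicator K x * a x \<partial>lam)"
    define B where "B = (\<integral>y. indicator L y * b y \<partial>lam)"
    have "(\<integral>y. indicator L y * (a x * b y) \<partial>lam) = a x * B" for x
      unfolding B_def by (simp add: mult.left_commute[of _ "a x"])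
    moreover have "(\<integral>x. indicator K x * (a x * b y) \<partial>lam) = A * b y" for y
      unfolding A_def by (simp flip: mult.assoc)
    moreover have "(\<integral>x. indicator K x * (a x * B) \<partial>lam) = A * B"
      unfolding A_def by (simp flip: mult.assoc)
    moreover have "(\<integral>y. indicator L y * (A * b y) \<partial>lam) = A * B"
      unfolding B_def by (simp add: mult.left_commute[of _ A])
    ultimately show ?case
      by (simp add: iterated_integral_def)
  next
    case (add f g)
    have "continuous_on UNIV (\<lambda>p. f (snd p, fst p))" "continuous_on UNIV (\<lambda>p. g (snd p, fst p))"
      using product_sums_continuous[OF add(1)] product_sums_continuous[OF add(2)]
      by (auto simp: split_beta intro!: continuous_intros elim!: continuous_on_compose2)
    then show ?case
      using iterated_integral_add[of f g K L 1] iterated_integral_add[of "\<lambda>p. f (snd p, fst p)" "\<lambda>p. g (snd p, fst p)" L K 1]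
        add K product_sums_continuous[OF add(1)] product_sums_continuous[OF add(2)] by (simp add: split_beta)
  qed
  have "\<bar>iterated_integral K L F - iterated_integral L K (\<lambda>p. F (snd p, fst p))\<bar> \<le> e" if e: "e > 0" for e
  proof -
    define m where "m = measure lam L * measure lam K"
    have m: "m \<ge> 0" by (simp add: m_def)
    \<comment> \<open>Each of the two iterated integrals moves by at most \<open>d * m\<close> when
      \<open>F\<close> is replaced by \<open>G\<close>; 1 is added in case \<open>m\<close> is
      0.\<close>
    define d where "d = e / (2 * (1 + m))"
    have d: "d > 0" "2 * d * m \<le> e" using e m by (auto simp: d_def field_simps)
    obtain G where G: "G \<in> product_sums" "\<forall>p\<in>K \<times> L. \<bar>F p - G p\<bar> < d"
      using product_sums_dense[OF lc F K d(1)] by metis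
    have contG: "continuous_on UNIV G" by (rule product_sums_continuous[OF G(1)])
    have cs: "continuous_on UNIV (\<lambda>p. G (snd p, fst p))" "continuous_on UNIV (\<lambda>p. F (snd p, fst p))"
      using contG F by (auto simp: split_beta intro!: continuous_intros elim!: continuous_on_compose2)
    have 1: "\<bar>iterated_integral K L F - iterated_integral K L G\<bar> \<le> d * measure lam L * measure lam K"
      using G(2) by (intro iterated_integral_diff_bound F contG K less_imp_le) auto
    have 2: "\<bar>iterated_integral L K (\<lambda>p. F (snd p, fst p)) - iterated_integral L K (\<lambda>p. G (snd p, fst p))\<bar>
        \<le> d * measure lam K * measure lam L"
      using G(2) by (intro iterated_integral_diff_bound cs K less_imp_le) auto
    have "\<bar>a - b\<bar> \<le> r + r'" if "\<bar>a - c\<bar> \<le> r" "\<bar>b - c'\<bar> \<le> r'" "c = c'" for a b c c' r r' :: real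
      using that by linarith
    from this[OF 1 2 base[OF G(1)]] have "\<bar>iterated_integral K L F - iterated_integral L K (\<lambda>p. F (snd p, fst p))\<bar>
        \<le> d * measure lam L * measure lam K + d * measure lam K * measure lam L" .
    also have "\<dots> = 2 * d * m" by (simp add: m_def)
    also note d(2)
    finally show ?thesis .
  qed
  then have "\<bar>iterated_integral K L F - iterated_integral L K (\<lambda>p. F (snd p, fst p))\<bar> \<le> 0"
    by (rule field_le_epsilon[where y=0, simplified])
  then show ?thesis by simp
qed

end

section \<open>The factor by which right translation changes integrals\<close>

context haar_measure
begin

text \<open>Exchange the integrals, substitute s by -x + s using left invariance, exchange back, and
  substitute x by s + x. The point is the right-hand side: \<open>f\<close> enters only through its
  integral, which makes the weighted translates of any two functions proportional.\<close>

lemma integral_translates_eq: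
  fixes f \<phi> :: "'a \<Rightarrow> real"
  assumes f: "f \<in> Cc" and \<phi>: "\<phi> \<in> Cc"
  shows "(\<integral>s. \<phi> s * (\<integral>x. f (x + s) \<partial>lam) \<partial>lam) = (\<integral>x. f x \<partial>lam) * (\<integral>x. \<phi> (- x) \<partial>lam)"
proof -
  obtain K where K: "continuous_on UNIV f" "compact K" "\<And>x. x \<notin> K \<Longrightarrow> f x = 0"
    using CcE[OF f] by metis
  obtain L where L: "continuous_on UNIV \<phi>" "compact L" "\<And>x. x \<notin> L \<Longrightarrow> \<phi> x = 0"
    using CcE[OF \<phi>] by metis
  obtain A where A: "compact A" and inA: "\<And>x s. x + s \<in> K \<Longrightarrow> s \<in> L \<Longrightarrow> x \<in> A"
    using compact_translates[OF K(2) L(2)] by metis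
  define F where "F = (\<lambda>p. f (fst p + snd p) * \<phi> (snd p))"
  define G where "G = (\<lambda>p. f (snd p) * \<phi> (- fst p + snd p))"
  have F: "continuous_on UNIV F" and G: "continuous_on UNIV G"
    unfolding F_def G_def
    by (intro continuous_intros continuous_on_compose2[OF K(1)] continuous_on_compose2[OF L(1)]; simp)+
  have F': "continuous_on UNIV (\<lambda>p. F (snd p, fst p))"
    by (intro continuous_on_compose2[OF F] continuous_intros) auto
  have F0: "F (x, s) = indicator A x * indicator L s * F (x, s)" for x s
    using inA K(3) L(3) by (cases "x + s \<in> K"; cases "s \<in> L") (auto simp: F_def)
  \<comment> \<open>\<open>x + (- x + s) = s\<close> lies in \<open>K\<close> with
    \<open>- x + s\<close> in \<open>L\<close>, so the set \<open>A\<close> chosen for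
    \<open>F\<close> also contains every \<open>x\<close> at which \<open>G\<close> is
    nonzero.\<close>
  have G0: "G (x, s) = indicator A x * indicator K s * G (x, s)" for x s
    using inA[of x "- x + s"] K(3) L(3)
    by (cases "s \<in> K"; cases "- x + s \<in> L") (auto simp: G_def add.assoc[symmetric])
  have *: "(\<integral>s. F (x, s) \<partial>lam) = (\<integral>s. G (x, s) \<partial>lam)" for x
  proof -
    have "(\<lambda>s. G (x, s)) \<in> borel_measurable borel"
      by (intro borel_measurable_continuous_onI continuous_on_compose2[OF G] continuous_intros) auto
    from integral_left[OF this, of x] show ?thesis
      by (simp add: F_def G_def add.assoc[symmetric])
  qed
  have "(\<integral>s. \<phi> s * (\<integral>x. f (x + s) \<partial>lam) \<partial>lam) = (\<integral>s. \<integral>x. F (x, s) \<partial>lam \<partial>lam)"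
    by (simp add: F_def mult.commute[of "\<phi> _"])
  also have "\<dots> = iterated_integral L A (\<lambda>p. F (snd p, fst p))"
    unfolding iterated_integral_def
    by (subst F0) (simp add: mult.commute[of "indicator A _"] mult.assoc)
  also have "\<dots> = iterated_integral A L F"
    using iterated_integral_swap[OF F A L(2)] by simp
  also have "\<dots> = (\<integral>x. \<integral>s. F (x, s) \<partial>lam \<partial>lam)"
    unfolding iterated_integral_def
    by (subst (2) F0) (simp add: mult.assoc)
  also have "\<dots> = (\<integral>x. \<integral>s. G (x, s) \<partial>lam \<partial>lam)"
    by (simp add: *)
  also have "\<dots> = iterated_integral A K G"
    unfolding iterated_integral_def
    by (subst G0) (simp add: mult.assoc)
  also have "\<dots> = iterated_integral K A (\<lambda>p. G (snd p, fst p))"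
    by (rule iterated_integral_swap[OF G A K(2)])
  also have "\<dots> = (\<integral>s. \<integral>x. G (x, s) \<partial>lam \<partial>lam)"
    unfolding iterated_integral_def
    by (subst (2) G0) (simp add: mult.commute[of "indicator A _"] mult.assoc)
  also have "\<dots> = (\<integral>s. f s * (\<integral>x. \<phi> (- x) \<partial>lam) \<partial>lam)"
  proof (intro Bochner_Integration.integral_cong refl)
    fix s
    have "(\<lambda>x. \<phi> (- x + s)) \<in> borel_measurable borel"
      by (intro borel_measurable_continuous_onI continuous_on_compose2[OF L(1)] continuous_intros) auto
    from integral_left[OF this, of s] show "(\<integral>x. G (x, s) \<partial>lam) = f s * (\<integral>x. \<phi> (- x) \<partial>lam)"
      by (simp add: G_def minus_add add.assoc)
  qed
  finally show ?thesis by simp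
qed

text \<open>Continuity is local in \<open>s\<close>; for \<open>s\<close> in a compact neighbourhood
  of \<open>s0\<close> all translates of \<open>f\<close> live on one compact set.\<close>

lemma continuous_on_integral_translate:
  fixes f :: "'a \<Rightarrow> real"
  assumes f: "f \<in> Cc"
  shows "continuous_on UNIV (\<lambda>s. \<integral>x. f (x + s) \<partial>lam)"
  unfolding continuous_on_eq_continuous_within
proof
  fix s0 :: 'a
  obtain K where K: "continuous_on UNIV f" "compact K" "\<And>x. x \<notin> K \<Longrightarrow> f x = 0"
    using CcE[OF f] by metis
  obtain V N :: "'a set" where N: "open V" "compact N" "s0 \<in> V" "V \<subseteq> N"
    by (rule locally_compactE[OF lc, of s0]) (rule that)
  obtain A where A: "compact A" and inA: "\<And>x s. x + s \<in> K \<Longrightarrow> s \<in> N \<Longrightarrow> x \<in> A"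
    using compact_translates[OF K(2) N(2)] by metis
  have "continuous_on UNIV (\<lambda>s. \<integral>x. indicator A x * (\<lambda>p. f (snd p + fst p)) (s, x) \<partial>lam)"
    by (intro continuous_on_integral_compact A continuous_on_compose2[OF K(1)] continuous_intros) auto
  then have "isCont (\<lambda>s. \<integral>x. indicator A x * f (x + s) \<partial>lam) s0"
    by (simp add: continuous_on_eq_continuous_within)
  moreover have "(\<integral>x. indicator A x * f (x + s) \<partial>lam) = (\<integral>x. f (x + s) \<partial>lam)" if "s \<in> V" for s
    using inA[of _ s] that N K(3) by (intro Bochner_Integration.integral_cong) (auto simp: indicator_def)
  then have "\<forall>\<^sub>F s in nhds s0. (\<integral>x. indicator A x * f (x + s) \<partial>lam) = (\<integral>x. f (x + s) \<partial>lam)"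
    using N by (auto simp: eventually_nhds)
  ultimately show "isCont (\<lambda>s. \<integral>x. f (x + s) \<partial>lam) s0"
    using isCont_cong by fast
qed

text \<open>The difference \<open>D\<close> of the two sides integrates to 0 against every function
  in \<open>Cc\<close>, by \<open>integral_translates_eq\<close>; testing with \<open>u * D\<close>,
  where \<open>u\<close> is a bump at \<open>s\<close>, gives \<open>D s = 0\<close>.
  Cross-multiplication avoids dividing by an integral that may vanish; the common factor is the
  modular function up to inversion.\<close>

lemma integral_translate_proportional:
  fixes f g :: "'a \<Rightarrow> real"
  assumes f: "f \<in> Cc" and g: "g \<in> Cc"
  shows "(\<integral>x. g x \<partial>lam) * (\<integral>x. f (x + s) \<partial>lam) = (\<integral>x. f x \<partial>lam) * (\<integral>x. g (x + s) \<partial>lam)"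
proof (rule ccontr)
  define D where "D s = (\<integral>x. g x \<partial>lam) * (\<integral>x. f (x + s) \<partial>lam) - (\<integral>x. f x \<partial>lam) * (\<integral>x. g (x + s) \<partial>lam)" for s
  assume "\<not> ?thesis"
  then have s: "D s \<noteq> 0" by (simp add: D_def)
  have D: "continuous_on UNIV D"
    unfolding D_def by (intro continuous_intros continuous_on_integral_translate f g)
  obtain u :: "'a \<Rightarrow> real" and L where u: "continuous_on UNIV u" "\<And>x. 0 \<le> u x" "u s = 1"
    "compact L" "\<And>x. x \<notin> L \<Longrightarrow> u x = 0"
    by (rule urysohn_locally_compact[OF lc, of "{s}" UNIV]) (use that in auto)
  have u_Cc: "u \<in> Cc" using u by (intro CcI) auto
  define \<phi> where "\<phi> x = u x * D x" for x
  have \<phi>: "\<phi> \<in> Cc" unfolding \<phi>_def by (intro Cc_mult_right u_Cc D)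
  have int: "integrable lam (\<lambda>s. \<phi> s * (\<integral>x. f (x + s) \<partial>lam))" "integrable lam (\<lambda>s. \<phi> s * (\<integral>x. g (x + s) \<partial>lam))"
    by (intro integrable_Cc Cc_mult_right \<phi> continuous_on_integral_translate f g)+
  have "(\<integral>x. \<phi> x * D x \<partial>lam) = (\<integral>x. (\<integral>x. g x \<partial>lam) * (\<phi> x * (\<integral>y. f (y + x) \<partial>lam)) - (\<integral>x. f x \<partial>lam) * (\<phi> x * (\<integral>y. g (y + x) \<partial>lam)) \<partial>lam)"
    by (simp add: D_def algebra_simps)
  also have "\<dots> = (\<integral>x. g x \<partial>lam) * (\<integral>s. \<phi> s * (\<integral>x. f (x + s) \<partial>lam) \<partial>lam) - (\<integral>x. f x \<partial>lam) * (\<integral>s. \<phi> s * (\<integral>x. g (x + s) \<partial>lam) \<partial>lam)"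
    using int by simp
  also have "\<dots> = 0"
    by (simp add: integral_translates_eq f g \<phi>)
  finally have "(\<integral>x. \<phi> x * D x \<partial>lam) = 0" .
  moreover have "(\<integral>x. \<phi> x * D x \<partial>lam) > 0"
    using s u(2,3) by (intro integral_Cc_pos[of _ s] Cc_mult_right \<phi> D)
      (auto simp: \<phi>_def mult.assoc zero_less_mult_iff)
  ultimately show False by simp
qed

end

section \<open>Right invariance under the compact subgroup\<close>

locale haar_compact_subgroup = haar_measure +
  fixes H :: "'a set"
  assumes compact_subgroup: "compact_subgroup H"
begin

lemma zero_in_H: "0 \<in> H" and plus_in_H: "h \<in> H \<Longrightarrow> k \<in> H \<Longrightarrow> h + k \<in> H"
  and minus_in_H: "h \<in> H \<Longrightarrow> - h \<in> H" and compact_H: "compact H"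
  using compact_subgroup by (auto simp: compact_subgroup_def)

text \<open>A supremum over \<open>H\<close> plays the part of averaging: it preserves continuity
  and compact support, it dominates the bump \<open>f\<close>, so its integral is positive, and it
  is invariant because h + H = H.\<close>

lemma ex_right_invariant_Cc:
  obtains g :: "'a \<Rightarrow> real" where "g \<in> Cc" "(\<integral>x. g x \<partial>lam) > 0" "\<And>x h. h \<in> H \<Longrightarrow> g (x + h) = g x"
proof -
  obtain f :: "'a \<Rightarrow> real" and K where f: "continuous_on UNIV f" "\<And>x. 0 \<le> f x" "f 0 = 1"
    "compact K" "\<And>x. x \<notin> K \<Longrightarrow> f x = 0" "\<And>x. f x \<le> 1"
    by (rule urysohn_locally_compact[OF lc, of "{0}" UNIV]) (use that in auto)
  define g where "g x = (SUP h\<in>H. f (x + h))" for x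
  have bdd: "bdd_above ((\<lambda>h. f (x + h)) ` H)" for x
    using f(6) by (intro bdd_aboveI[of _ 1]) auto
  have g: "continuous_on UNIV g"
  proof -
    have "continuous_on UNIV (\<lambda>p. f (fst p + snd p))"
      by (intro continuous_on_compose2[OF f(1)] continuous_intros) auto
    from continuous_on_SUP_compact[OF this compact_H] show ?thesis
      using zero_in_H by (auto simp: g_def[abs_def])
  qed
  obtain A where A: "compact A" and inA: "\<And>x s. x + s \<in> K \<Longrightarrow> s \<in> H \<Longrightarrow> x \<in> A"
    using compact_translates[OF f(4) compact_H] by metis
  have g0: "f x \<le> g x" for x
    unfolding g_def using cSUP_upper[OF zero_in_H bdd, of x] by simp
  have Cc: "g \<in> Cc"
  proof (rule CcI[OF g A])
    fix x assume "x \<notin> A"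
    then have "f (x + h) = 0" if "h \<in> H" for h using inA that f(5) by blast
    then have "(\<lambda>h. f (x + h)) ` H = {0}" using zero_in_H by force
    then show "g x = 0" by (simp add: g_def)
  qed
  have inv: "g (x + h) = g x" if h: "h \<in> H" for x h
  proof -
    have "(\<lambda>k. h + k) ` H = H"
      using h by (force simp: image_iff plus_in_H minus_in_H add.assoc[symmetric] intro: bexI[of _ "- h + _"])
    then have "(\<lambda>k. f (x + k)) ` H = (\<lambda>k. f (x + k)) ` (\<lambda>k. h + k) ` H" by simp
    then show ?thesis by (simp add: g_def image_image add.assoc)
  qed
  have pos: "(\<integral>x. g x \<partial>lam) > 0"
    using f(2,3) g0 by (intro integral_Cc_pos[OF Cc, of 0]) (auto intro: order_trans less_le_trans[of _ 1] simp: g0[of 0, unfolded f(3)])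
  show ?thesis using that Cc pos inv by blast
qed

text \<open>The invariant \<open>g\<close> and its translate have the same positive integral, so the
  proportionality cancels to the claim: the modular function is 1 on \<open>H\<close>.\<close>

lemma integral_Cc_right:
  fixes f :: "'a \<Rightarrow> real"
  assumes f: "f \<in> Cc" and h: "h \<in> H"
  shows "(\<integral>x. f (x + h) \<partial>lam) = (\<integral>x. f x \<partial>lam)"
proof -
  obtain g :: "'a \<Rightarrow> real" where g: "g \<in> Cc" "(\<integral>x. g x \<partial>lam) > 0" "\<And>x h. h \<in> H \<Longrightarrow> g (x + h) = g x"
    by (rule ex_right_invariant_Cc) (rule that)
  show ?thesis
    using integral_translate_proportional[OF f g(1), of h] g h by (simp add: mult.commute)
qed

lemma sets_right: "E \<in> sets borel \<Longrightarrow> (\<lambda>x. x + h) ` E \<in> sets borel" for E :: "'a set"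
  unfolding image_plus_right using measurable_sets[OF borel_plus_right, of E "- h"] by simp

text \<open>The integral identity passes to sets in three steps: a Urysohn function between a
  compact \<open>K\<close> and an open \<open>U\<close>, inner regularity for open sets, outer
  regularity for Borel sets. The converse inequality is the same statement for
  \<open>- h\<close>.\<close>

lemma emeasure_right_le:
  assumes h: "h \<in> H" and E: "E \<in> sets borel"
  shows "emeasure lam ((\<lambda>x. x + h) ` E) \<le> emeasure lam E"
proof -
  have open_right: "open ((\<lambda>x. x + h) ` U)" if "open U" for U
    unfolding image_plus_right by (intro open_vimage that continuous_intros)
  have cpt: "emeasure lam ((\<lambda>x. x + h) ` K) \<le> emeasure lam U" if K: "compact K" and U: "open U" "K \<subseteq> U" for K U
  proof -
    obtain f :: "'a \<Rightarrow> real" and L where f: "continuous_on UNIV f" "\<And>x. 0 \<le> f x" "\<And>x. x \<in> K \<Longrightarrow> f x = 1"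
      "compact L" "\<And>x. x \<notin> L \<inter> U \<Longrightarrow> f x = 0" "\<And>x. f x \<le> 1"
      by (rule urysohn_locally_compact[OF lc K U]) (use that in auto)
    have Cc: "f \<in> Cc" using f by (intro CcI[of f L]) auto
    then have Cc': "(\<lambda>x. f (x + - h)) \<in> Cc" by (rule Cc_translate_right)
    have Ks: "(\<lambda>x. x + h) ` K \<in> sets lam" using sets_right K by (auto simp: borel_compact)
    have "emeasure lam ((\<lambda>x. x + h) ` K) = (\<integral>\<^sup>+x. indicator ((\<lambda>x. x + h) ` K) x \<partial>lam)"
      using Ks by simp
    also have "\<dots> \<le> (\<integral>\<^sup>+x. ennreal (f (x + - h)) \<partial>lam)"
      using f(3) by (intro nn_integral_mono) (auto simp: indicator_def add.assoc)
    also have "\<dots> = ennreal (\<integral>x. f (x + - h) \<partial>lam)"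
      using f(2) Cc' by (intro nn_integral_eq_integral integrable_Cc) auto
    also have "\<dots> = ennreal (\<integral>x. f x \<partial>lam)"
      using integral_Cc_right[OF Cc minus_in_H[OF h]] by simp
    also have "\<dots> = (\<integral>\<^sup>+x. ennreal (f x) \<partial>lam)"
      using f(2) Cc by (intro nn_integral_eq_integral[symmetric] integrable_Cc) auto
    also have "\<dots> \<le> (\<integral>\<^sup>+x. indicator U x \<partial>lam)"
      using f(5,6) by (intro nn_integral_mono) (auto simp: indicator_def ennreal_leI[of _ 1, simplified])
    also have "\<dots> = emeasure lam U" using U by simp
    finally show ?thesis .
  qed
  have op: "emeasure lam ((\<lambda>x. x + h) ` U) \<le> emeasure lam U" if U: "open U" for U
  proof (rule ccontr)
    assume "\<not> ?thesis"
    then obtain C where C: "compact C" "C \<subseteq> (\<lambda>x. x + h) ` U" "emeasure lam U < emeasure lam C"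
      using inner_regular[OF open_right[OF U]] by (metis not_le)
    have eq: "(\<lambda>x. x + h) ` (\<lambda>x. x + - h) ` C = C"
      by (simp add: image_image add.assoc)
    have "compact ((\<lambda>x. x + - h) ` C)"
      by (intro compact_continuous_image C continuous_intros)
    moreover have "(\<lambda>x. x + - h) ` C \<subseteq> U" using C(2) by (auto simp: add.assoc)
    ultimately have "emeasure lam C \<le> emeasure lam U" using cpt[OF _ U] eq by metis
    then show False using C(3) by simp
  qed
  show ?thesis
  proof (rule ccontr)
    assume "\<not> ?thesis"
    then obtain U where U: "open U" "E \<subseteq> U" "emeasure lam U < emeasure lam ((\<lambda>x. x + h) ` E)"
      using outer_regular[OF E] by (metis not_le)
    have "emeasure lam ((\<lambda>x. x + h) ` E) \<le> emeasure lam ((\<lambda>x. x + h) ` U)"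
      using U open_right by (intro emeasure_mono) auto
    with op[OF U(1)] U(3) show False by simp
  qed
qed

lemma distr_right: "h \<in> H \<Longrightarrow> distr lam lam (\<lambda>x. x + h) = lam"
proof (rule measure_eqI)
  fix E assume h: "h \<in> H" and "E \<in> sets (distr lam lam (\<lambda>x. x + h))"
  then have E: "E \<in> sets borel" by simp
  have eq: "(\<lambda>x. x + h) ` (\<lambda>x. x + - h) ` E = E"
    by (simp add: image_image add.assoc)
  have "emeasure lam ((\<lambda>x. x + - h) ` E) = emeasure lam E"
    using emeasure_right_le[OF minus_in_H[OF h] E] emeasure_right_le[OF h sets_right[OF E, of "- h"]] eq
    by simp
  moreover have "(\<lambda>x. x + h) -` E = (\<lambda>x. x + - h) ` E"
    using image_plus_right[of "- h" E] by simp
  ultimately show "emeasure (distr lam lam (\<lambda>x. x + h)) E = emeasure lam E"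
    using E by (simp add: emeasure_distr)
qed simp

lemma integral_right:
  fixes f :: "'a \<Rightarrow> 'b::{banach, second_countable_topology}"
  assumes "f \<in> borel_measurable borel" "h \<in> H"
  shows "(\<integral>x. f (x + h) \<partial>lam) = (\<integral>x. f x \<partial>lam)"
  using integral_distr[of "\<lambda>x. x + h" lam lam f] assms by (simp add: distr_right)

end

section \<open>Local measurability and the dual of L1\<close>

abbreviation pairing :: "'a measure \<Rightarrow> ('a \<Rightarrow> complex) \<Rightarrow> ('a \<Rightarrow> complex) \<Rightarrow> complex" where
  "pairing M f g \<equiv> \<integral>x. f x * cnj (g x) \<partial>M"

abbreviation L1_norm :: "'a measure \<Rightarrow> ('a \<Rightarrow> complex) \<Rightarrow> real" where
  "L1_norm M f \<equiv> \<integral>x. cmod (f x) \<partial>M"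

abbreviation L1_dist :: "'a measure \<Rightarrow> ('a \<Rightarrow> complex) \<Rightarrow> ('a \<Rightarrow> complex) \<Rightarrow> real" where
  "L1_dist M f g \<equiv> \<integral>x. cmod (f x - g x) \<partial>M"

lemma loc_setsD: "E \<in> loc_sets M \<Longrightarrow> F \<in> sets M \<Longrightarrow> emeasure M F < top \<Longrightarrow> E \<inter> F \<in> sets M"
  by (simp add: loc_sets_def)

lemma loc_null_setsD:
  "N \<in> loc_null_sets M \<Longrightarrow> F \<in> sets M \<Longrightarrow> emeasure M F < top \<Longrightarrow> N \<inter> F \<in> null_sets M"
  by (auto simp: loc_null_sets_def loc_sets_def)

lemma empty_loc_null [simp]: "{} \<in> loc_null_sets M"
  by (auto simp: loc_null_sets_def loc_sets_def)

lemma Un_loc_null: "N \<in> loc_null_sets M \<Longrightarrow> N' \<in> loc_null_sets M \<Longrightarrow> N \<union> N' \<in> loc_null_sets M"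
  by (auto simp: loc_null_sets_def loc_sets_def Int_Un_distrib2 emeasure_Un_null_set)
    (metis (no_types, lifting) emeasure_Un_null_set null_setsI)

lemma loc_AE_I: "(\<And>x. x \<in> space M \<Longrightarrow> P x) \<Longrightarrow> loc_AE M P"
  unfolding loc_AE_def by (rule bexI[of _ "{}"]) auto

lemma loc_AE_mono: "loc_AE M P \<Longrightarrow> (\<And>x. x \<in> space M \<Longrightarrow> P x \<Longrightarrow> Q x) \<Longrightarrow> loc_AE M Q"
  unfolding loc_AE_def by blast

lemma loc_AE_conj: "loc_AE M P \<Longrightarrow> loc_AE M Q \<Longrightarrow> loc_AE M (\<lambda>x. P x \<and> Q x)"
proof -
  assume "loc_AE M P" "loc_AE M Q"
  then obtain N N' where "N \<in> loc_null_sets M" "N' \<in> loc_null_sets M"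
    "{x \<in> space M. \<not> P x} \<subseteq> N" "{x \<in> space M. \<not> Q x} \<subseteq> N'"
    unfolding loc_AE_def by blast
  then show ?thesis
    unfolding loc_AE_def by (intro bexI[of _ "N \<union> N'"] Un_loc_null) auto
qed

lemma loc_measurable_restrict:
  assumes g: "loc_measurable M g" and E: "E \<in> sets M" "emeasure M E < top"
  shows "(\<lambda>x. indicator E x * g x) \<in> borel_measurable M"
proof (rule measurableI)
  fix A :: "complex set" assume "A \<in> sets borel"
  then have "g -` A \<inter> space M \<inter> E \<in> sets M"
    using g E by (intro loc_setsD) (auto simp: loc_measurable_def)
  moreover have "(\<lambda>x. indicator E x * g x) -` A \<inter> space M =
      (g -` A \<inter> space M \<inter> E) \<union> (if 0 \<in> A then space M - E else {})"
    using sets.sets_into_space[OF E(1)] by (auto split: split_indicator_asm split_indicator if_splits)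
  ultimately show "(\<lambda>x. indicator E x * g x) -` A \<inter> space M \<in> sets M"
    using E by auto
qed simp

text \<open>Markov's inequality bounds the measure of the set where \<open>norm (f x)\<close> is at
  least 1/(n+1). Integrable functions thus have sigma-finite support, which is how local notions and
  integrals meet although \<open>M\<close> itself need not be sigma-finite.\<close>

lemma integrable_support:
  fixes f :: "'a \<Rightarrow> 'b::{banach, second_countable_topology}"
  assumes f: "integrable M f"
  obtains S :: "nat \<Rightarrow> 'a set" where "\<And>n. S n \<in> sets M" "\<And>n. emeasure M (S n) < top" "incseq S"
    "\<And>x. x \<in> space M \<Longrightarrow> f x \<noteq> 0 \<Longrightarrow> \<exists>n. x \<in> S n"
proof -
  define S where "S n = {x \<in> space M. 1 \<le> real (Suc n) * norm (f x)}" for n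
  have [measurable]: "f \<in> borel_measurable M" using f by auto
  show ?thesis
  proof (rule that[of S])
    show "S n \<in> sets M" for n unfolding S_def by measurable
    have "(\<integral>\<^sup>+ x. ennreal (norm (f x)) \<partial>M) < top"
      using f by (simp add: integrable_iff_bounded)
    moreover have "emeasure M (S n) \<le> ennreal (real (Suc n)) * (\<integral>\<^sup>+ x. ennreal (norm (f x)) * indicator (space M) x \<partial>M)" for n
      using nn_integral_Markov_inequality[of "\<lambda>x. ennreal (norm (f x))" "space M" M "ennreal (real (Suc n))"]
      by (simp add: S_def ennreal_mult'[symmetric] del: of_nat_Suc)
    moreover have "(\<integral>\<^sup>+ x. ennreal (norm (f x)) * indicator (space M) x \<partial>M) = (\<integral>\<^sup>+ x. ennreal (norm (f x)) \<partial>M)"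
      by (intro nn_integral_cong) auto
    ultimately show "emeasure M (S n) < top" for n
      by (metis ennreal_mult_less_top ennreal_less_top le_less_trans)
    show "incseq S"
      unfolding S_def incseq_def by (auto elim!: order_trans intro!: mult_right_mono)
    show "\<exists>n. x \<in> S n" if x: "x \<in> space M" "f x \<noteq> 0" for x
    proof -
      obtain n where "inverse (real (Suc n)) < norm (f x)"
        using reals_Archimedean[of "norm (f x)"] x by auto
      then have "1 \<le> real (Suc n) * norm (f x)" by (simp add: field_simps)
      then show ?thesis using x by (auto simp: S_def)
    qed
  qed
qed

text \<open>A locally measurable \<open>g\<close> need not be measurable, but its truncations to the
  sets \<open>S n\<close> are, and they converge after multiplication by \<open>f\<close>, which
  vanishes off the union of these sets.\<close>

lemma borel_measurable_pairing:
  assumes f: "integrable M f" and g: "loc_measurable M g"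
  shows "(\<lambda>x. f x * cnj (g x)) \<in> borel_measurable M"
proof -
  obtain S :: "nat \<Rightarrow> 'a set" where S: "\<And>n. S n \<in> sets M" "\<And>n. emeasure M (S n) < top" "incseq S"
    "\<And>x. x \<in> space M \<Longrightarrow> f x \<noteq> 0 \<Longrightarrow> \<exists>n. x \<in> S n"
    using integrable_support[OF f] by metis
  have [measurable]: "f \<in> borel_measurable M" using f by auto
  note [measurable] = loc_measurable_restrict[OF g S(1,2)]
  show ?thesis
  proof (rule borel_measurable_LIMSEQ_metric)
    have [measurable]: "cnj \<in> borel_measurable borel"
      by (intro borel_measurable_continuous_onI continuous_intros)
    show "(\<lambda>x. f x * cnj (indicator (S n) x * g x)) \<in> borel_measurable M" for n
      by measurable
    fix x assume x: "x \<in> space M"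
    show "(\<lambda>n. f x * cnj (indicator (S n) x * g x)) \<longlonglongrightarrow> f x * cnj (g x)"
    proof (cases "f x = 0")
      case False
      then obtain n where "x \<in> S n" using S(4) x by blast
      then have "x \<in> S k" if "k \<ge> n" for k using S(3) that by (auto simp: incseq_def)
      then show ?thesis
        by (intro tendsto_eventually eventually_sequentiallyI[of n]) (auto simp: indicator_def)
    qed simp
  qed
qed

text \<open>A locally null set meets each of the countably many \<open>S n\<close> in a null set,
  hence it meets the support of \<open>f\<close> in one.\<close>

lemma AE_loc_null:
  fixes f :: "'a \<Rightarrow> 'b::{banach, second_countable_topology}"
  assumes f: "integrable M f" and P: "loc_AE M P"
  shows "AE x in M. f x = 0 \<or> P x"
proof -
  obtain S :: "nat \<Rightarrow> 'a set" where S: "\<And>n. S n \<in> sets M" "\<And>n. emeasure M (S n) < top" "incseq S"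
    "\<And>x. x \<in> space M \<Longrightarrow> f x \<noteq> 0 \<Longrightarrow> \<exists>n. x \<in> S n"
    using integrable_support[OF f] by metis
  obtain N where N: "N \<in> loc_null_sets M" "{x \<in> space M. \<not> P x} \<subseteq> N"
    using P by (auto simp: loc_AE_def)
  have "(\<Union>n. N \<inter> S n) \<in> null_sets M"
    using N S by (intro null_sets_UN loc_null_setsD)
  moreover have "{x \<in> space M. \<not> (f x = 0 \<or> P x)} \<subseteq> (\<Union>n. N \<inter> S n)"
    using N S(4) by blast
  ultimately show ?thesis by (rule AE_I')
qed

lemma pairing_bound:
  assumes f: "integrable M f" and g: "loc_measurable M g" "loc_AE M (\<lambda>x. cmod (g x) \<le> t)"
  shows "integrable M (\<lambda>x. f x * cnj (g x))"
    and "cmod (pairing M f g) \<le> t * L1_norm M f"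
proof -
  have AE: "AE x in M. cmod (f x * cnj (g x)) \<le> t * cmod (f x)"
    using AE_loc_null[OF f g(2)]
    by eventually_elim (auto simp: norm_mult mult.commute[of t] mult_left_mono)
  have int: "integrable M (\<lambda>x. t * cmod (f x))" using f by simp
  show i: "integrable M (\<lambda>x. f x * cnj (g x))"
    using AE by (intro Bochner_Integration.integrable_bound[OF int] borel_measurable_pairing f g)
      (auto elim!: eventually_mono)
  have "cmod (pairing M f g) \<le> (\<integral>x. cmod (f x * cnj (g x)) \<partial>M)"
    by (rule integral_norm_bound)
  also have "\<dots> \<le> (\<integral>x. t * cmod (f x) \<partial>M)"
    using AE i int by (intro integral_mono_AE) auto
  finally show "cmod (pairing M f g) \<le> t * L1_norm M f" by simp
qed

lemma pairing_cong:
  assumes f: "integrable M f" and g: "loc_measurable M g" "loc_measurable M g'"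
    and eq: "loc_AE M (\<lambda>x. g x = g' x)"
  shows "pairing M f g = pairing M f g'"
  using AE_loc_null[OF f eq]
  by (intro integral_cong_AE borel_measurable_pairing f g) (auto elim!: eventually_mono)

text \<open>Serves twice to turn integral bounds into pointwise ones: for the essential bound of a
  function in \<open>Linf_funs\<close> and for the bound on a density.\<close>

lemma null_of_integral_le:
  fixes q :: "'a \<Rightarrow> real"
  assumes E: "E \<in> sets M" "emeasure M E < top" and q: "integrable M (\<lambda>x. indicator E x * q x)"
    and gt: "\<And>x. x \<in> E \<Longrightarrow> B < q x" and le: "(\<integral>x. indicator E x * q x \<partial>M) \<le> B * measure M E"
  shows "E \<in> null_sets M"
proof -
  have intE: "integrable M (\<lambda>x. B * indicator E x)"
    using E by (intro integrable_mult_right integrable_real_indicator) auto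
  have pos: "indicator E x * q x - B * indicator E x \<ge> 0" for x
    using gt[of x] by (auto simp: indicator_def)
  have "(\<integral>x. indicator E x * q x - B * indicator E x \<partial>M) \<le> 0"
    using q intE le E by simp
  then have "(\<integral>x. indicator E x * q x - B * indicator E x \<partial>M) = 0"
    using pos by (intro antisym Bochner_Integration.integral_nonneg) auto
  then have "AE x in M. indicator E x * q x - B * indicator E x = 0"
    using integral_nonneg_eq_0_iff_AE[of M "\<lambda>x. indicator E x * q x - B * indicator E x"] q intE pos by auto
  then have "AE x in M. x \<notin> E"
    by eventually_elim (use gt in \<open>auto simp: indicator_def split: if_splits\<close>)
  then show ?thesis using AE_iff_null_sets[OF E(1)] by simp
qed

lemma loc_sets_norm_greater:
  assumes "loc_measurable M g"
  shows "{x \<in> space M. cmod (g x) > t} \<in> loc_sets M"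
proof -
  have "{z. cmod z > t} \<in> sets borel"
    by (intro borel_open open_Collect_less continuous_intros)
  then have "g -` {z. cmod z > t} \<inter> space M \<in> loc_sets M"
    using assms unfolding loc_measurable_def by blast
  moreover have "g -` {z. cmod z > t} \<inter> space M = {x \<in> space M. cmod (g x) > t}" by auto
  ultimately show ?thesis by simp
qed

text \<open>The test functions are \<open>sgn g\<close> on sets of finite measure where \<open>g\<close> is large.\<close>

lemma loc_AE_le_of_pairing:
  assumes g: "g \<in> Linf_funs M" and B: "0 \<le> B"
    and le: "\<And>f. integrable M f \<Longrightarrow> cmod (pairing M f g) \<le> B * L1_norm M f"
  shows "loc_AE M (\<lambda>x. cmod (g x) \<le> B)"
proof -
  have g': "loc_measurable M g" using g by (simp add: Linf_funs_def)
  obtain t where t: "loc_AE M (\<lambda>x. cmod (g x) \<le> t)" using g by (auto simp: Linf_funs_def)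
  define N where "N = {x \<in> space M. cmod (g x) > B}"
  have N: "N \<in> loc_sets M" unfolding N_def by (rule loc_sets_norm_greater[OF g'])
  have "emeasure M (N \<inter> F) = 0" if F: "F \<in> sets M" "emeasure M F < top" for F
  proof -
    define E where "E = N \<inter> F"
    have E: "E \<in> sets M" "emeasure M E < top"
      using N F loc_setsD[OF N F] emeasure_mono[of E F M] by (auto simp: E_def)
    note [measurable] = loc_measurable_restrict[OF g' E] E(1)
    define f where "f x = sgn (indicator E x * g x)" for x
    have f: "integrable M f"
      unfolding f_def
      by (rule integrableI_bounded_set[where A=E and B=1]) (use E in \<open>auto intro!: AE_I2 simp: norm_sgn\<close>)
    have norm_f: "cmod (f x) \<le> indicator E x" for x
      by (auto simp: f_def norm_sgn indicator_def)
    have fg: "f x * cnj (g x) = complex_of_real (indicator E x * cmod (g x))" for x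
      by (auto simp: f_def indicator_def sgn_eq complex_norm_square[symmetric] power2_eq_square)
    have int: "integrable M (\<lambda>x. indicator E x * cmod (g x))"
      using integrable_norm[OF pairing_bound(1)[OF f g' t]] unfolding fg
      by (simp del: of_real_mult add: abs_mult)
    have intE: "integrable M (indicator E :: 'a \<Rightarrow> real)"
      using E by (intro integrable_real_indicator) auto
    have "(\<integral>x. indicator E x * cmod (g x) \<partial>M) \<le> cmod (pairing M f g)"
      unfolding fg by (simp only: integral_complex_of_real norm_of_real abs_ge_self)
    also have "\<dots> \<le> B * L1_norm M f" by (rule le[OF f])
    also have "\<dots> \<le> B * (\<integral>x. indicator E x \<partial>M)"
      using f intE norm_f B by (intro mult_left_mono integral_mono) auto
    finally have "E \<in> null_sets M"
      using int E by (intro null_of_integral_le[of E M "\<lambda>x. cmod (g x)" B]) (auto simp: E_def N_def)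
    then show ?thesis by (auto simp: E_def)
  qed
  then have "N \<in> loc_null_sets M" using N by (simp add: loc_null_sets_def)
  then show ?thesis unfolding loc_AE_def N_def by (rule bexI[rotated]) auto
qed

section \<open>Representing bounded functionals on \<open>L1\<close>\<close>

lemma integrable_complex_indicator:
  assumes "E \<in> sets M" "emeasure M E < top"
  shows "integrable M (indicator E :: 'a \<Rightarrow> complex)"
  using assms by (intro integrableI_bounded_set[where A=E and B=1]) auto

text \<open>Stated for functions rather than classes; \<open>bound\<close> applied to a difference
  shows that functions equal almost everywhere get equal values.\<close>

locale L1_functional =
  fixes M :: "'a measure" and \<Phi> :: "('a \<Rightarrow> complex) \<Rightarrow> complex" and B :: real
  assumes add: "integrable M f \<Longrightarrow> integrable M g \<Longrightarrow> \<Phi> (\<lambda>x. f x + g x) = \<Phi> f + \<Phi> g"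
    and scale: "integrable M f \<Longrightarrow> \<Phi> (\<lambda>x. c * f x) = c * \<Phi> f"
    and bound: "integrable M f \<Longrightarrow> cmod (\<Phi> f) \<le> B * L1_norm M f"
    and B_nonneg: "0 \<le> B"
begin

lemma diff:
  assumes "integrable M f" "integrable M g"
  shows "\<Phi> (\<lambda>x. f x - g x) = \<Phi> f - \<Phi> g"
  using add[of f "\<lambda>x. (-1) * g x"] scale[of g "-1"] assms by simp

text \<open>Dominated convergence gives convergence in the \<open>L1\<close> norm, for which the
  functional is continuous. This yields countable additivity of \<open>\<Phi>\<close> on indicators
  and later the passage from finite to countable unions.\<close>

lemma tendsto:
  assumes [measurable]: "\<And>n. s n \<in> borel_measurable M" "f \<in> borel_measurable M"
    and w: "integrable M w"
    and lim: "\<And>x. x \<in> space M \<Longrightarrow> (\<lambda>n. s n x) \<longlonglongrightarrow> f x"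
    and le: "\<And>n x. x \<in> space M \<Longrightarrow> cmod (s n x) \<le> w x"
  shows "(\<lambda>n. \<Phi> (s n)) \<longlonglongrightarrow> \<Phi> f"
proof -
  have s: "integrable M (s n)" for n
    by (rule integrable_dominated_convergence2[OF _ _ w, of f s]) (use lim le in auto)
  have f: "integrable M f"
    by (rule integrable_dominated_convergence[OF _ _ w, of f s]) (use lim le in auto)
  have le': "cmod (f x) \<le> w x" if "x \<in> space M" for x
    by (rule LIMSEQ_le_const2[OF tendsto_norm[OF lim[OF that]]]) (use le that in auto)
  have "(\<lambda>n. \<integral>x. cmod (s n x - f x) \<partial>M) \<longlonglongrightarrow> (\<integral>x. 0 \<partial>M)"
  proof (rule integral_dominated_convergence[where w="\<lambda>x. w x + w x"])
    show "AE x in M. (\<lambda>n. cmod (s n x - f x)) \<longlonglongrightarrow> 0"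
      using lim by (intro AE_I2 tendsto_norm_zero LIM_zero lim)
    have "cmod (s n x - f x) \<le> w x + w x" if "x \<in> space M" for n x
      using norm_triangle_ineq4[of "s n x" "f x"] le[OF that, of n] le'[OF that] by linarith
    then show "AE x in M. norm (cmod (s n x - f x)) \<le> w x + w x" for n
      by (intro AE_I2) simp
  qed (use w in auto)
  then have "(\<lambda>n. B * (\<integral>x. cmod (s n x - f x) \<partial>M)) \<longlonglongrightarrow> 0"
    by (intro tendsto_mult_right_zero) simp
  moreover have "cmod (\<Phi> (s n) - \<Phi> f) \<le> B * (\<integral>x. cmod (s n x - f x) \<partial>M)" for n
    using bound[of "\<lambda>x. s n x - f x"] diff[OF s f] s f by simp
  ultimately have "(\<lambda>n. \<Phi> (s n) - \<Phi> f) \<longlonglongrightarrow> 0"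
    by (intro Lim_null_comparison[of "\<lambda>n. \<Phi> (s n) - \<Phi> f"]) auto
  then show ?thesis by (simp add: LIM_zero_iff)
qed

end

text \<open>The set function \<open>r\<close> is signed, so \<open>B\<close> times the measure is
  added to obtain a finite nonnegative measure, absolutely continuous with respect to
  \<open>M\<close> restricted to \<open>D\<close>; Radon-Nikodym applies, and \<open>B\<close> is
  subtracted from the density.\<close>

lemma real_density_exists:
  fixes r :: "'a set \<Rightarrow> real"
  assumes D: "D \<in> sets M" "emeasure M D < top" and B: "0 \<le> B"
    and bound: "\<And>E. E \<in> sets M \<Longrightarrow> E \<subseteq> D \<Longrightarrow> \<bar>r E\<bar> \<le> B * measure M E"
    and sums: "\<And>A :: nat \<Rightarrow> 'a set. range A \<subseteq> sets M \<Longrightarrow> disjoint_family A \<Longrightarrow> (\<Union>i. A i) \<subseteq> D \<Longrightarrow>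
      (\<lambda>i. r (A i)) sums r (\<Union>i. A i)"
  shows "\<exists>q\<in>borel_measurable M. (\<forall>x. \<bar>q x\<bar> \<le> B) \<and>
    (\<forall>E\<in>sets M. E \<subseteq> D \<longrightarrow> r E = (\<integral>x. indicator E x * q x \<partial>M))"
proof -
  define M' where "M' = density M (indicator D)"
  \<comment> \<open>Intersecting with \<open>D\<close> defines the set function on all of
    \<open>sets M\<close>, as a measure requires.\<close>
  define n where "n E = r (E \<inter> D) + B * measure M (E \<inter> D)" for E
  define N where "N = measure_of (space M) (sets M) (\<lambda>E. ennreal (n E))"
  have fin: "emeasure M (E \<inter> D) < top" if "E \<in> sets M" for E
    using emeasure_mono[of "E \<inter> D" D M] D by (auto intro: le_less_trans)
  have n_nonneg: "0 \<le> n E" if "E \<in> sets M" for E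
    using bound[of "E \<inter> D"] that D by (auto simp: n_def)
  have n_sums: "(\<lambda>i. n (A i)) sums n (\<Union>i. A i)" if A: "range A \<subseteq> sets M" "disjoint_family A" for A
  proof -
    have A': "range (\<lambda>i. A i \<inter> D) \<subseteq> sets M" "disjoint_family (\<lambda>i. A i \<inter> D)" "(\<Union>i. A i \<inter> D) = (\<Union>i. A i) \<inter> D"
      using A D by (auto simp: disjoint_family_on_def)
    have "(\<Union>i. A i) \<in> sets M" using A(1) by blast
    then have "(\<lambda>i. measure M (A i \<inter> D)) sums measure M (\<Union>i. A i \<inter> D)"
      using fin[of "\<Union>i. A i"] by (intro measure_UNION A') (auto simp: A'(3))
    with sums[OF A'(1,2)] show ?thesis
      unfolding n_def A'(3) by (intro sums_add sums_mult) auto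
  qed
  have N: "emeasure N E = ennreal (n E)" if "E \<in> sets M" for E
  proof (rule emeasure_measure_of[OF N_def])
    show "positive (sets N) (\<lambda>E. ennreal (n E))"
      using bound[of "{}"] by (simp add: positive_def n_def)
    show "countably_additive (sets N) (\<lambda>E. ennreal (n E))"
    proof (rule countably_additiveI)
      fix A :: "nat \<Rightarrow> 'a set" assume A: "range A \<subseteq> sets N" "disjoint_family A"
      then have A': "range A \<subseteq> sets M" by (simp add: N_def sets.sigma_sets_eq sets.space_closed)
      then have "\<And>i. 0 \<le> n (A i)" using n_nonneg by blast
      then show "(\<Sum>i. ennreal (n (A i))) = ennreal (n (\<Union>i. A i))"
        using n_sums[OF A' A(2)] by (simp add: suminf_ennreal_eq flip: sums_unique)
    qed
  qed (use that in \<open>auto simp: N_def sets.sigma_sets_eq sets.space_closed dest: sets.sets_into_space\<close>)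
  have sets_N: "sets N = sets M'" by (simp add: N_def M'_def sets.sigma_sets_eq sets.space_closed)
  have M': "emeasure M' E = emeasure M (D \<inter> E)" if "E \<in> sets M" for E
    using that D by (simp add: M'_def emeasure_restricted)
  have "space N = space M" "space M' = space M" by (simp_all add: N_def M'_def sets.space_closed)
  interpret M': finite_measure M'
    using M'[of "space M"] fin[of "space M"] D \<open>space M' = space M\<close>
    by (intro finite_measureI) (auto simp: Int_commute)
  have "finite_measure N"
    using N[of "space M"] \<open>space N = space M\<close> by (intro finite_measureI) auto
  moreover have "absolutely_continuous M' N"
    unfolding absolutely_continuous_def
  proof
    fix E assume E: "E \<in> null_sets M'"
    then have "E \<in> sets M" by (auto simp: M'_def)
    moreover have "emeasure M (E \<inter> D) = 0" using E M'[of E] \<open>E \<in> sets M\<close> by (auto simp: Int_commute)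
    then have "n E = 0"
      using bound[of "E \<inter> D"] \<open>E \<in> sets M\<close> D by (auto simp: n_def measure_def)
    ultimately show "E \<in> null_sets N" using N[of E] sets_N by (auto simp: null_sets_def M'_def)
  qed
  ultimately obtain p where p: "p \<in> borel_measurable M'" "density M' p = N"
    using M'.Radon_Nikodym_finite_measure[of N] sets_N by auto
  have [measurable]: "p \<in> borel_measurable M" using p by (simp add: M'_def)
  note [measurable] = D(1)
  have p_int: "(\<integral>\<^sup>+x. indicator E x * p x \<partial>M) = ennreal (n E)" if E[measurable]: "E \<in> sets M" "E \<subseteq> D" for E
  proof -
    have "ennreal (n E) = emeasure (density M' p) E" using N E p by simp
    also have "\<dots> = (\<integral>\<^sup>+x. p x * indicator E x \<partial>M')"
      using E p by (subst emeasure_density) (auto simp: M'_def)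
    also have "\<dots> = (\<integral>\<^sup>+x. indicator D x * (p x * indicator E x) \<partial>M)"
      unfolding M'_def by (subst nn_integral_density) auto
    also have "\<dots> = (\<integral>\<^sup>+x. indicator E x * p x \<partial>M)"
      using E by (intro nn_integral_cong) (auto simp: indicator_def)
    finally show ?thesis ..
  qed
  have "(\<integral>\<^sup>+x. indicator D x * p x \<partial>M) \<noteq> \<infinity>" using p_int[OF D(1)] by simp
  then have "AE x in M. indicator D x * p x \<noteq> \<infinity>"
    by (intro nn_integral_noteq_infinite) auto
  then have AE_fin: "AE x in M. x \<in> D \<longrightarrow> p x \<noteq> \<infinity>"
    by eventually_elim (auto simp: indicator_def)
  define q where "q x = enn2real (p x) - B" for x
  have [measurable]: "q \<in> borel_measurable M" unfolding q_def by measurable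
  have rq: "integrable M (\<lambda>x. indicator E x * q x)" "(\<integral>x. indicator E x * q x \<partial>M) = r E"
    if E[measurable]: "E \<in> sets M" "E \<subseteq> D" for E
  proof -
    have "E \<inter> D = E" using E by auto
    have intE: "integrable M (indicator E :: 'a \<Rightarrow> real)"
      using E fin[of E] \<open>E \<inter> D = E\<close> by (intro integrable_real_indicator) auto
    have "(\<integral>\<^sup>+x. ennreal (indicator E x * enn2real (p x)) \<partial>M) = (\<integral>\<^sup>+x. indicator E x * p x \<partial>M)"
      using AE_fin E by (intro nn_integral_cong_AE) (auto elim!: eventually_mono simp: indicator_def ennreal_enn2real_if)
    then have nn: "(\<integral>\<^sup>+x. ennreal (indicator E x * enn2real (p x)) \<partial>M) = ennreal (n E)"
      using p_int[OF E] by simp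
    have "has_bochner_integral M (\<lambda>x. indicator E x * enn2real (p x)) (n E)"
      by (rule has_bochner_integral_nn_integral[OF _ _ _ nn]) (use n_nonneg E in auto)
    moreover have "has_bochner_integral M (\<lambda>x. B * indicator E x) (B * measure M E)"
      using E intE by (simp add: has_bochner_integral_iff)
    ultimately have "has_bochner_integral M (\<lambda>x. indicator E x * enn2real (p x) - B * indicator E x) (n E - B * measure M E)"
      by (rule has_bochner_integral_diff)
    moreover have "n E - B * measure M E = r E" using \<open>E \<inter> D = E\<close> by (simp add: n_def)
    ultimately show "integrable M (\<lambda>x. indicator E x * q x)" "(\<integral>x. indicator E x * q x \<partial>M) = r E"
      by (simp_all add: has_bochner_integral_iff q_def algebra_simps)
  qed
  have "AE x in M. x \<in> D \<longrightarrow> q x \<le> B"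
  proof -
    define E where "E = {x \<in> D. q x > B}"
    have E[measurable]: "E \<in> sets M" and ED: "E \<subseteq> D"
    proof -
      have "E = {x \<in> space M. q x > B} \<inter> D" using sets.sets_into_space[OF D(1)] by (auto simp: E_def)
      then show "E \<in> sets M" by simp
    qed (auto simp: E_def)
    have "emeasure M E < top" using fin[OF E] ED by (simp add: Int_absorb2)
    then have "E \<in> null_sets M"
      using rq[OF E ED] bound[OF E ED] E
      by (intro null_of_integral_le[of E M q B]) (auto simp: E_def)
    then show ?thesis by (rule AE_I') (auto simp: E_def)
  qed
  moreover have "- B \<le> q x" for x by (simp add: q_def)
  ultimately have AE_q: "AE x in M. x \<in> D \<longrightarrow> max (- B) (min B (q x)) = q x"
    by (auto elim!: eventually_mono)
  \<comment> \<open>The bound \<open>q x \<le> B\<close> is known only almost everywhere on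
    \<open>D\<close>. Truncation makes it hold at every point without changing the integrals, so
    that it passes directly to a function glued from possibly uncountably many densities.\<close>
  show ?thesis
  proof (intro bexI[of _ "\<lambda>x. max (- B) (min B (q x))"] conjI ballI impI allI)
    fix E assume E[measurable]: "E \<in> sets M" and ED: "E \<subseteq> D"
    have "(\<integral>x. indicator E x * max (- B) (min B (q x)) \<partial>M) = (\<integral>x. indicator E x * q x \<partial>M)"
      using AE_q ED by (intro integral_cong_AE) (auto elim!: eventually_mono split: split_indicator)
    then show "r E = (\<integral>x. indicator E x * max (- B) (min B (q x)) \<partial>M)"
      using rq(2)[OF E ED] by simp
  qed (use B in auto)
qed

text \<open>Haar measure has such a family even when it is not sigma-finite; Radon-Nikodym densities on
  its members can be glued.\<close>

definition localizing :: "'a measure \<Rightarrow> 'a set set \<Rightarrow> bool" where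
  "localizing M \<D> \<longleftrightarrow> \<D> \<subseteq> sets M \<and> (\<forall>D\<in>\<D>. emeasure M D < top) \<and> disjoint \<D> \<and>
     (\<forall>E\<in>sets M. emeasure M E < top \<longrightarrow> (\<exists>C\<subseteq>\<D>. countable C \<and> E \<subseteq> \<Union>C))"

context L1_functional
begin

text \<open>The real and imaginary parts of \<open>\<Phi> (indicator E)\<close> have densities of
  modulus at most \<open>B\<close> each, hence the crude constant \<open>2 * B\<close>; the exact
  norm is recovered in \<open>T_norm\<close>.\<close>

lemma density_on_finite_set:
  assumes D: "D \<in> sets M" "emeasure M D < top"
  shows "\<exists>g\<in>borel_measurable M. (\<forall>x. cmod (g x) \<le> 2 * B) \<and>
    (\<forall>E\<in>sets M. E \<subseteq> D \<longrightarrow> \<Phi> (indicator E) = (\<integral>x. indicator E x * cnj (g x) \<partial>M))"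
proof -
  have fin: "emeasure M E < top" if "E \<in> sets M" "E \<subseteq> D" for E
    using emeasure_mono[of E D M] D that by (auto intro: le_less_trans)
  have int: "integrable M (indicator E :: 'a \<Rightarrow> complex)" "integrable M (indicator E :: 'a \<Rightarrow> real)"
    if "E \<in> sets M" "E \<subseteq> D" for E
    using that fin[OF that] by (auto intro: integrable_complex_indicator integrable_real_indicator)
  have bd: "cmod (\<Phi> (indicator E)) \<le> B * measure M E" if "E \<in> sets M" "E \<subseteq> D" for E
  proof -
    have "(\<lambda>x. cmod (indicator E x)) = indicator E" by (auto simp: indicator_def)
    then show ?thesis using bound[OF int(1)[OF that]] that(1) by simp
  qed
  have sums: "(\<lambda>i. \<Phi> (indicator (A i))) sums \<Phi> (indicator (\<Union>i. A i))"
    if A: "range A \<subseteq> sets M" "disjoint_family A" "(\<Union>i. A i) \<subseteq> D" for A :: "nat \<Rightarrow> 'a set"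
    unfolding sums_def
  proof -
    have Ai: "A i \<in> sets M" "A i \<subseteq> D" for i using A by auto
    have U: "(\<Union>i\<in>I. A i) \<in> sets M" "(\<Union>i\<in>I. A i) \<subseteq> D" for I using A by auto
    have fin_sum: "\<Phi> (indicator (\<Union>i<n. A i)) = (\<Sum>i<n. \<Phi> (indicator (A i)))" for n
    proof (induction n)
      case 0
      have "\<Phi> (\<lambda>_. 0) = 0" using bound[of "\<lambda>_. 0"] by simp
      then show ?case by simp
    next
      case (Suc n)
      have "A n \<inter> (\<Union>i<n. A i) = {}"
      proof -
        have "x \<notin> A n" if "x \<in> A i" "i < n" for x i
          using disjoint_family_onD[OF A(2), of n i] that by auto
        then show ?thesis by auto
      qed
      then have "indicator (\<Union>i<Suc n. A i) = (\<lambda>x. indicator (A n) x + indicator (\<Union>i<n. A i) x :: complex)"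
        by (auto simp: lessThan_Suc indicator_def fun_eq_iff)
      then show ?case
        using Suc add[OF int(1)[OF Ai] int(1)[OF U]] by simp
    qed
    have "(\<lambda>n. \<Phi> (indicator (\<Union>i<n. A i))) \<longlonglongrightarrow> \<Phi> (indicator (\<Union>i. A i))"
    proof (rule tendsto[where w="indicator D"])
      show "(\<lambda>n. indicator (\<Union>i<n. A i) x) \<longlonglongrightarrow> (indicator (\<Union>i. A i) x :: complex)" for x
        by (rule LIMSEQ_indicator_UN)
      show "cmod (indicator (\<Union>i<n. A i) x) \<le> indicator D x" for n x
        using U[of "{..<n}"] by (auto split: split_indicator)
    qed (use U int D in auto)
    then show "(\<lambda>n. \<Sum>i<n. \<Phi> (indicator (A i))) \<longlonglongrightarrow> \<Phi> (indicator (\<Union>i. A i))"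
      by (simp add: fin_sum)
  qed
  have "\<exists>q\<in>borel_measurable M. (\<forall>x. \<bar>q x\<bar> \<le> B) \<and>
    (\<forall>E\<in>sets M. E \<subseteq> D \<longrightarrow> Re (\<Phi> (indicator E)) = (\<integral>x. indicator E x * q x \<partial>M))"
    using sums_Re[OF sums] bd abs_Re_le_cmod
    by (intro real_density_exists[OF D B_nonneg]) (auto intro: order_trans)
  then obtain q1 where q1[measurable]: "q1 \<in> borel_measurable M" and q1': "\<And>x. \<bar>q1 x\<bar> \<le> B"
    "\<And>E. E \<in> sets M \<Longrightarrow> E \<subseteq> D \<Longrightarrow> Re (\<Phi> (indicator E)) = (\<integral>x. indicator E x * q1 x \<partial>M)" by blast
  have "\<exists>q\<in>borel_measurable M. (\<forall>x. \<bar>q x\<bar> \<le> B) \<and>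
    (\<forall>E\<in>sets M. E \<subseteq> D \<longrightarrow> Im (\<Phi> (indicator E)) = (\<integral>x. indicator E x * q x \<partial>M))"
    using sums_Im[OF sums] bd abs_Im_le_cmod
    by (intro real_density_exists[OF D B_nonneg]) (auto intro: order_trans)
  then obtain q2 where q2[measurable]: "q2 \<in> borel_measurable M" and q2': "\<And>x. \<bar>q2 x\<bar> \<le> B"
    "\<And>E. E \<in> sets M \<Longrightarrow> E \<subseteq> D \<Longrightarrow> Im (\<Phi> (indicator E)) = (\<integral>x. indicator E x * q2 x \<partial>M)" by blast
  \<comment> \<open>The sign of the imaginary part is reversed because the pairing conjugates its
    second argument.\<close>
  show ?thesis
  proof (intro bexI[of _ "\<lambda>x. Complex (q1 x) (- q2 x)"] conjI allI ballI impI)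
    show "cmod (Complex (q1 x) (- q2 x)) \<le> 2 * B" for x
      using cmod_le[of "Complex (q1 x) (- q2 x)"] q1'(1)[of x] q2'(1)[of x] by simp
    show "(\<lambda>x. Complex (q1 x) (- q2 x)) \<in> borel_measurable M"
      unfolding Complex_eq by measurable
    fix E assume E[measurable]: "E \<in> sets M" and ED: "E \<subseteq> D"
    have i: "integrable M (\<lambda>x. indicator E x * q x)" if [measurable]: "q \<in> borel_measurable M" and "\<And>x. \<bar>q x\<bar> \<le> B" for q :: "'a \<Rightarrow> real"
      by (rule integrableI_bounded_set[where A=E and B=B]) (use that fin[OF E ED] in auto)
    have "(\<integral>x. indicator E x * cnj (Complex (q1 x) (- q2 x)) \<partial>M) =
        (\<integral>x. of_real (indicator E x * q1 x) + \<i> * of_real (indicator E x * q2 x) \<partial>M)"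
      by (intro Bochner_Integration.integral_cong) (auto simp: complex_eq_iff indicator_def)
    also have "\<dots> = of_real (\<integral>x. indicator E x * q1 x \<partial>M) + \<i> * of_real (\<integral>x. indicator E x * q2 x \<partial>M)"
      using i[OF q1 q1'(1)] i[OF q2 q2'(1)] by (simp del: of_real_mult)
    also have "\<dots> = \<Phi> (indicator E)"
      using q1'(2)[OF E ED] q2'(2)[OF E ED] by (simp add: complex_eq_iff)
    finally show "\<Phi> (indicator E) = (\<integral>x. indicator E x * cnj (Complex (q1 x) (- q2 x)) \<partial>M)" ..
  qed
qed

lemmas \<Phi>_add = add

text \<open>The densities on the disjoint members of \<open>\<D>\<close> are glued. A set of finite
  measure is covered by countably many of these members, so the glued function is locally measurable
  and countable exhaustion determines \<open>\<Phi>\<close> on the indicator of that set.\<close>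

lemma dual_representation:
  assumes loc: "localizing M \<D>"
  shows "\<exists>g\<in>Linf_funs M. \<forall>f. integrable M f \<longrightarrow> \<Phi> f = pairing M f g"
proof -
  have D: "\<And>D. D \<in> \<D> \<Longrightarrow> D \<in> sets M" "\<And>D. D \<in> \<D> \<Longrightarrow> emeasure M D < top"
    and disj: "\<And>D D'. D \<in> \<D> \<Longrightarrow> D' \<in> \<D> \<Longrightarrow> D \<noteq> D' \<Longrightarrow> D \<inter> D' = {}"
    and cover: "\<And>E. E \<in> sets M \<Longrightarrow> emeasure M E < top \<Longrightarrow> \<exists>C\<subseteq>\<D>. countable C \<and> E \<subseteq> \<Union>C"
    using loc by (auto simp: localizing_def disjoint_def)
  have "\<forall>D\<in>\<D>. \<exists>g\<in>borel_measurable M. (\<forall>x. cmod (g x) \<le> 2 * B) \<and>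
    (\<forall>E\<in>sets M. E \<subseteq> D \<longrightarrow> \<Phi> (indicator E) = (\<integral>x. indicator E x * cnj (g x) \<partial>M))"
    using density_on_finite_set D by blast
  then obtain gD where gD: "\<And>D. D \<in> \<D> \<Longrightarrow> gD D \<in> borel_measurable M" "\<And>D x. D \<in> \<D> \<Longrightarrow> cmod (gD D x) \<le> 2 * B"
    "\<And>D E. D \<in> \<D> \<Longrightarrow> E \<in> sets M \<Longrightarrow> E \<subseteq> D \<Longrightarrow> \<Phi> (indicator E) = (\<integral>x. indicator E x * cnj (gD D x) \<partial>M)"
    by metis
  \<comment> \<open>Disjointness makes the chosen \<open>D\<close> the only one containing
    \<open>x\<close>.\<close>
  define g where "g x = (if x \<in> \<Union>\<D> then gD (SOME D. D \<in> \<D> \<and> x \<in> D) x else 0)" for x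
  have g_eq: "g x = gD D x" if "D \<in> \<D>" "x \<in> D" for D x
  proof -
    have "(SOME D. D \<in> \<D> \<and> x \<in> D) = D"
      using that disj by (intro some_equality) auto
    then show ?thesis using that by (auto simp: g_def)
  qed
  have g_bound: "cmod (g x) \<le> 2 * B" for x
  proof (cases "x \<in> \<Union>\<D>")
    case True
    then show ?thesis using g_eq gD(2) by fastforce
  qed (use B_nonneg in \<open>auto simp: g_def\<close>)
  have g_meas: "loc_measurable M g"
    unfolding loc_measurable_def loc_sets_def
  proof safe
    fix A :: "complex set" and F assume A: "A \<in> sets borel" and F: "F \<in> sets M" "emeasure M F < \<infinity>"
    obtain C where C: "C \<subseteq> \<D>" "countable C" "F \<subseteq> \<Union>C" using cover[of F] F by auto
    have "g -` A \<inter> space M \<inter> F = (\<Union>D\<in>C. (gD D -` A \<inter> space M) \<inter> D \<inter> F)"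
    proof (intro set_eqI iffI)
      fix x assume x: "x \<in> g -` A \<inter> space M \<inter> F"
      then obtain D where "D \<in> C" "x \<in> D" using C(3) by blast
      then show "x \<in> (\<Union>D\<in>C. (gD D -` A \<inter> space M) \<inter> D \<inter> F)"
        using x C(1) g_eq[of D x] by (intro UN_I[of D]) auto
    next
      fix x assume "x \<in> (\<Union>D\<in>C. (gD D -` A \<inter> space M) \<inter> D \<inter> F)"
      then obtain D where "D \<in> C" "x \<in> (gD D -` A \<inter> space M) \<inter> D \<inter> F" by blast
      then show "x \<in> g -` A \<inter> space M \<inter> F"
        using C(1) g_eq[of D x] by auto
    qed
    also have "\<dots> \<in> sets M"
      using C D F gD(1) A by (intro sets.countable_UN'' sets.Int measurable_sets[OF _ A]) auto
    finally show "g -` A \<inter> space M \<inter> F \<in> sets M" .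
  qed
  have g_loc: "loc_AE M (\<lambda>x. cmod (g x) \<le> 2 * B)"
    by (rule loc_AE_I) (rule g_bound)
  have g: "g \<in> Linf_funs M" using g_meas g_loc by (auto simp: Linf_funs_def)
  note int_g = pairing_bound(1)[OF _ g_meas g_loc]
  \<comment> \<open>Pairing with \<open>g\<close> is itself such a functional, so both sides of the
    claim obey the same limit lemma.\<close>
  interpret G: L1_functional M "\<lambda>f. pairing M f g" "2 * B"
    using pairing_bound(2)[OF _ g_meas g_loc] B_nonneg
    by unfold_locales (auto simp: distrib_right int_g mult.assoc)
  have ind: "\<Phi> (indicator E) = (\<integral>x. indicator E x * cnj (g x) \<partial>M)"
    if E: "E \<in> sets M" "emeasure M E < top" for E
  proof -
    obtain C where C: "C \<subseteq> \<D>" "countable C" "E \<subseteq> \<Union>C" using cover[of E] E by auto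
    have int: "integrable M (indicator (E \<inter> F) :: 'a \<Rightarrow> complex)" if "F \<in> sets M" for F
      using E that emeasure_mono[of "E \<inter> F" E M] by (auto intro!: integrable_complex_indicator intro: le_less_trans)
    have fin: "\<Phi> (indicator (E \<inter> \<Union>S)) = (\<integral>x. indicator (E \<inter> \<Union>S) x * cnj (g x) \<partial>M)" if "finite S" "S \<subseteq> \<D>" for S
      using that
    proof (induction S rule: finite_induct)
      case empty
      show ?case using bound[of "\<lambda>_. 0"] by (simp add: indicator_def[abs_def])
    next
      case (insert F S)
      then have F: "F \<in> \<D>" "S \<subseteq> \<D>" "F \<notin> S" by auto
      have "F \<inter> \<Union>S = {}" using F disj by blast
      then have eq: "indicator (E \<inter> \<Union>(insert F S)) = (\<lambda>x. indicator (E \<inter> F) x + indicator (E \<inter> \<Union>S) x :: complex)"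
        by (auto simp: indicator_def fun_eq_iff)
      have S: "\<Union>S \<in> sets M" using insert.hyps F D by (intro sets.finite_Union) auto
      have "(\<integral>x. indicator (E \<inter> F) x * cnj (gD F x) \<partial>M) = (\<integral>x. indicator (E \<inter> F) x * cnj (g x) \<partial>M)"
        using g_eq F by (intro Bochner_Integration.integral_cong) (auto simp: indicator_def)
      then have "\<Phi> (indicator (E \<inter> F)) = (\<integral>x. indicator (E \<inter> F) x * cnj (g x) \<partial>M)"
        using gD(3)[of F "E \<inter> F"] F E D by auto
      then show ?case
        unfolding eq using insert.IH F add[OF int int] G.add[OF int int] S D by simp
    qed
    show ?thesis
    proof (cases "C = {}")
      case True
      then show ?thesis using fin[of "{}"] C by simp
    next
      case False
      \<comment> \<open>\<open>from_nat_into\<close> needs \<open>C\<close> nonempty and repeats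
        members when \<open>C\<close> is finite; the unions absorb the repetitions.\<close>
      define s :: "nat \<Rightarrow> 'a \<Rightarrow> complex" where "s n = indicator (E \<inter> \<Union>(from_nat_into C ` {..<n}))" for n
      have in_\<D>: "from_nat_into C n \<in> \<D>" for n using from_nat_into[OF False] C by auto
      have E_eq: "E = (\<Union>n. E \<inter> from_nat_into C n)"
        using C range_from_nat_into[OF False C(2)] by auto
      have s_lim: "(\<lambda>n. s n x) \<longlonglongrightarrow> indicator E x" for x
      proof -
        have "(\<lambda>n. indicator (\<Union>i<n. E \<inter> from_nat_into C i) x :: complex) \<longlonglongrightarrow> indicator (\<Union>i. E \<inter> from_nat_into C i) x"
          by (rule LIMSEQ_indicator_UN)
        then show ?thesis using E_eq by (simp add: s_def)
      qed
      have s_meas: "s n \<in> borel_measurable M" for n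
        unfolding s_def using in_\<D> D E by (intro borel_measurable_indicator sets.Int sets.finite_UN) auto
      have w: "integrable M (indicator E :: 'a \<Rightarrow> real)" using E by (intro integrable_real_indicator) auto
      have "(\<lambda>n. \<Phi> (s n)) \<longlonglongrightarrow> \<Phi> (indicator E)"
        by (rule tendsto[OF s_meas _ w s_lim]) (use E in \<open>auto simp: s_def indicator_def\<close>)
      moreover have "(\<lambda>n. \<integral>x. s n x * cnj (g x) \<partial>M) \<longlonglongrightarrow> (\<integral>x. indicator E x * cnj (g x) \<partial>M)"
        by (rule G.tendsto[OF s_meas _ w s_lim]) (use E in \<open>auto simp: s_def indicator_def\<close>)
      moreover have "\<Phi> (s n) = (\<integral>x. s n x * cnj (g x) \<partial>M)" for n
        unfolding s_def using in_\<D> by (intro fin) auto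
      ultimately show ?thesis using LIMSEQ_unique by simp
    qed
  qed
  have "\<Phi> f = pairing M f g" if "integrable M f" for f
    using that
  proof (induction rule: integrable_induct)
    case (base A c)
    have "integrable M (indicator A :: 'a \<Rightarrow> complex)"
      using base by (intro integrable_complex_indicator) auto
    then show ?case
      using scale[of "indicator A" c] ind[OF base(1) base(2)[unfolded infinity_ennreal_def]] by (simp add: scaleR_conv_of_real of_real_indicator mult.commute[of _ c] mult.assoc)
  next
    case (add f g)
    then show ?case using add \<Phi>_add[OF add(1,2)] G.add[OF add(1,2)] by simp
  next
    case (lim f s)
    have w: "integrable M (\<lambda>x. 2 * cmod (f x))" using lim by simp
    have "(\<lambda>n. \<Phi> (s n)) \<longlonglongrightarrow> \<Phi> f"
      by (rule tendsto[OF _ _ w]) (use lim in auto)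
    moreover have "(\<lambda>n. \<integral>x. s n x * cnj (g x) \<partial>M) \<longlonglongrightarrow> (pairing M f g)"
      by (rule G.tendsto[OF _ _ w]) (use lim in auto)
    ultimately show ?case using lim LIMSEQ_unique by simp
  qed
  with g show ?thesis by blast
qed

end

section \<open>Decomposition and density for Haar measure\<close>

text \<open>The finite sums of the measures of the \<open>V i\<close> are bounded by the measure of
  \<open>U\<close>, and a summable family has countable support.\<close>

lemma countable_disjoint_positive:
  fixes V :: "'b \<Rightarrow> 'a set"
  assumes V: "\<And>i. i \<in> I \<Longrightarrow> V i \<in> sets M" "\<And>i. i \<in> I \<Longrightarrow> V i \<subseteq> U" "\<And>i. i \<in> I \<Longrightarrow> emeasure M (V i) > 0"
    and disj: "disjoint_family_on V I" and U: "U \<in> sets M" "emeasure M U < top"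
  shows "countable I"
proof -
  have fin: "emeasure M (V i) < top" if "i \<in> I" for i
    using V(2)[OF that] U emeasure_mono[of "V i" U M] by (auto intro: le_less_trans)
  have "(\<lambda>i. measure M (V i)) summable_on I"
  proof (rule nonneg_bdd_above_summable_on)
    show "bdd_above (sum (\<lambda>i. measure M (V i)) ` {F. F \<subseteq> I \<and> finite F})"
    proof (rule bdd_aboveI2)
      fix F assume "F \<in> {F. F \<subseteq> I \<and> finite F}"
      then have F: "F \<subseteq> I" "finite F" by auto
      have "(\<Sum>i\<in>F. measure M (V i)) = measure M (\<Union>i\<in>F. V i)"
        using F V fin
        by (intro measure_finite_Union[symmetric] disjoint_family_on_mono[OF F(1) disj]) (auto simp: less_top)
      also have "\<dots> \<le> measure M U"
        using F V U by (intro measure_mono_fmeasurable) (auto simp: fmeasurable_def)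
      finally show "(\<Sum>i\<in>F. measure M (V i)) \<le> measure M U" .
    qed
  qed simp
  then have "countable {i \<in> I. measure M (V i) \<noteq> 0}" by (rule summable_countable_real)
  moreover have "measure M (V i) \<noteq> 0" if "i \<in> I" for i
    using V(3)[OF that] fin[OF that] by (auto simp: measure_def enn2real_eq_0_iff)
  then have "{i \<in> I. measure M (V i) \<noteq> 0} = I" by auto
  ultimately show ?thesis by simp
qed

context haar_measure
begin

text \<open>The subgroup is generated by a compact neighbourhood of the identity.\<close>

lemma open_sigma_compact_subgroup:
  obtains K :: "nat \<Rightarrow> 'a set" where "\<And>n. compact (K n)" "open (\<Union>n. K n)" "0 \<in> (\<Union>n. K n)"
    "\<And>x y. x \<in> (\<Union>n. K n) \<Longrightarrow> y \<in> (\<Union>n. K n) \<Longrightarrow> x + y \<in> (\<Union>n. K n)"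
    "\<And>x. x \<in> (\<Union>n. K n) \<Longrightarrow> - x \<in> (\<Union>n. K n)"
proof -
  obtain V N :: "'a set" where V: "open V" "compact N" "0 \<in> V" "V \<subseteq> N"
    by (rule locally_compactE[OF lc, of 0]) (rule that)
  define S where "S = N \<union> uminus ` N"
  have S: "compact S" unfolding S_def
    using V by (intro compact_Un compact_continuous_image continuous_intros)
  have S_minus: "- v \<in> S" if "v \<in> S" for v using that by (auto simp: S_def)
  \<comment> \<open>\<open>K n\<close> consists of the n-fold sums of elements of the symmetric set
    \<open>S\<close>.\<close>
  define K where "K = rec_nat {0} (\<lambda>_ A. (\<lambda>(x, y). x + y) ` (A \<times> S))"
  have K0: "K 0 = {0}" and KS: "K (Suc n) = (\<lambda>(x, y). x + y) ` (K n \<times> S)" for n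
    by (simp_all add: K_def)
  have KSuc: "x + v \<in> K (Suc n)" if "x \<in> K n" "v \<in> S" for x v n
    unfolding KS using that by (intro image_eqI[of _ _ "(x, v)"]) auto
  have K_plus: "x + y \<in> K (m + n)" if "x \<in> K m" "y \<in> K n" for x y m n
    using that(2)
  proof (induction n arbitrary: y)
    case 0
    then show ?case using that(1) by (simp add: K0)
  next
    case (Suc n)
    then obtain z v where "y = z + v" "z \<in> K n" "v \<in> S" by (auto simp: KS)
    then show ?case using Suc.IH[of z] KSuc[of "x + z" "m + n" v] by (simp add: add.assoc)
  qed
  have K_minus: "- x \<in> K n" if "x \<in> K n" for x n
    using that
  proof (induction n arbitrary: x)
    case (Suc n)
    then obtain z v where "x = z + v" "z \<in> K n" "v \<in> S" by (auto simp: KS)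
    moreover have "- v \<in> K 1" using KSuc[of 0 0 "- v"] S_minus \<open>v \<in> S\<close> by (simp add: K0)
    ultimately show ?case using K_plus[of "- v" 1 "- z" n] Suc.IH[of z] by (simp add: minus_add)
  qed (simp add: K0)
  show ?thesis
  proof (rule that[of K])
    show "compact (K n)" for n
      by (induction n) (auto simp: K0 KS intro: compact_plus S)
    show "open (\<Union>n. K n)"
      unfolding open_subopen[of "\<Union>n. K n"]
    proof
      fix x assume "x \<in> (\<Union>n. K n)"
      then obtain n where x: "x \<in> K n" by blast
      have "open ((\<lambda>y. x + y) ` V)"
        unfolding image_plus_left by (intro open_vimage V continuous_intros)
      moreover have "x \<in> (\<lambda>y. x + y) ` V" using V by (intro image_eqI[of _ _ 0]) auto
      moreover have "(\<lambda>y. x + y) ` V \<subseteq> (\<Union>n. K n)"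
        using KSuc[OF x] V by (auto simp: S_def)
      ultimately show "\<exists>T. open T \<and> x \<in> T \<and> T \<subseteq> (\<Union>n. K n)" by blast
    qed
    show "0 \<in> (\<Union>n. K n)" using K0 by blast
    fix x assume "x \<in> (\<Union>n. K n)"
    then obtain m where x: "x \<in> K m" by blast
    show "- x \<in> (\<Union>n. K n)" using K_minus[OF x] by blast
    fix y assume "y \<in> (\<Union>n. K n)"
    then obtain n where "y \<in> K n" by blast
    from K_plus[OF x this] show "x + y \<in> (\<Union>n. K n)" by blast
  qed
qed

text \<open>The cosets of an open sigma-compact subgroup are open, and each splits into countably
  many disjoint pieces of finite measure. A set of finite measure lies in an open \<open>U\<close>
  of finite measure, and \<open>U\<close> meets only countably many cosets, since each nonempty
  intersection is open and so has positive measure.\<close>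

lemma localizing_exists: "\<exists>\<D>. localizing lam \<D>"
proof -
  obtain K :: "nat \<Rightarrow> 'a set" where K: "\<And>n. compact (K n)" "open (\<Union>n. K n)" "0 \<in> (\<Union>n. K n)"
    "\<And>x y. x \<in> (\<Union>n. K n) \<Longrightarrow> y \<in> (\<Union>n. K n) \<Longrightarrow> x + y \<in> (\<Union>n. K n)"
    "\<And>x. x \<in> (\<Union>n. K n) \<Longrightarrow> - x \<in> (\<Union>n. K n)"
    by (rule open_sigma_compact_subgroup) (rule that)
  define S where "S = (\<Union>n. K n)"
  note S = K(2-5)[folded S_def]
  define coset where "coset x = (\<lambda>s. x + s) ` S" for x
  have coset_iff: "y \<in> coset x \<longleftrightarrow> - x + y \<in> S" for x y
    by (simp add: coset_def image_plus_left)
  have self: "x \<in> coset x" for x using S by (simp add: coset_iff)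
  have coset_eq: "coset x = coset y" if "y \<in> coset x" for x y
  proof -
    have 1: "- x + y \<in> S" using that by (simp add: coset_iff)
    have 2: "- y + x \<in> S" using S(4)[OF 1] by (simp add: minus_add)
    show ?thesis
    proof (intro set_eqI iffI)
      fix z assume "z \<in> coset x"
      then have "(- y + x) + (- x + z) \<in> S" using S(3)[OF 2] by (simp add: coset_iff)
      then show "z \<in> coset y" by (simp add: coset_iff add.assoc)
    next
      fix z assume "z \<in> coset y"
      then have "(- x + y) + (- y + z) \<in> S" using S(3)[OF 1] by (simp add: coset_iff)
      then show "z \<in> coset x" by (simp add: coset_iff add.assoc)
    qed
  qed
  have coset_open: "open (coset x)" for x
    unfolding coset_def image_plus_left by (intro open_vimage S continuous_intros)
  \<comment> \<open>One representative per coset, so that the pieces depend on the coset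
    alone.\<close>
  define rep where "rep C = (SOME x. coset x = C)" for C
  have rep: "coset (rep C) = C" if "C \<in> range coset" for C
    using that unfolding rep_def by (metis (mono_tags, lifting) rangeE someI)
  define D where "D C = disjointed (\<lambda>n. (\<lambda>s. rep C + s) ` K n)" for C
  have cpt: "compact ((\<lambda>s. rep C + s) ` K n)" for C n
    by (intro compact_continuous_image K continuous_intros)
  have D_UN: "(\<Union>n. D C n) = C" if "C \<in> range coset" for C
  proof -
    have "(\<Union>n. D C n) = coset (rep C)"
      by (auto simp: D_def UN_disjointed_eq coset_def S_def)
    then show ?thesis using rep that by simp
  qed
  define \<D> where "\<D> = (\<Union>C\<in>range coset. range (D C))"
  have D_sets: "D C n \<in> sets lam" for C n
    unfolding D_def disjointed_def
    by (intro sets.Diff sets.finite_UN) (simp_all add: borel_compact[OF cpt])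
  have D_fin: "emeasure lam (D C n) < top" for C n
    using emeasure_mono[of "D C n" "(\<lambda>s. rep C + s) ` K n" lam] emeasure_compact[OF cpt] cpt
      disjointed_subset[of "\<lambda>n. (\<lambda>s. rep C + s) ` K n" n]
    by (auto simp: D_def borel_compact intro: le_less_trans)
  have disj: "C = C' \<and> n = n'" if "x \<in> D C n" "x \<in> D C' n'" "C \<in> range coset" "C' \<in> range coset" for C C' n n' x
  proof -
    have "x \<in> C" "x \<in> C'" using D_UN that by blast+
    moreover obtain a b where "C = coset a" "C' = coset b"
      using \<open>C \<in> range coset\<close> \<open>C' \<in> range coset\<close> by auto
    ultimately have CC: "C = C'" using coset_eq[of x a] coset_eq[of x b] by simp
    moreover have "n = n'"
      using disjoint_family_disjointed[of "\<lambda>n. (\<lambda>s. rep C + s) ` K n"] that(1,2)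
      unfolding D_def CC disjoint_family_on_def by auto
    ultimately show ?thesis by simp
  qed
  have "localizing lam \<D>"
    unfolding localizing_def
  proof (intro conjI ballI impI)
    show "\<D> \<subseteq> sets lam" unfolding \<D>_def using D_sets by (intro UN_least image_subsetI)
    show "emeasure lam E < top" if "E \<in> \<D>" for E
    proof -
      obtain C n where "E = D C n" using \<open>E \<in> \<D>\<close> unfolding \<D>_def by blast
      then show ?thesis by (simp only: D_fin)
    qed
    show "disjoint \<D>"
    proof (unfold disjoint_def, intro ballI impI)
      fix a b assume ab: "a \<in> \<D>" "b \<in> \<D>" "a \<noteq> b"
      obtain C n where C: "a = D C n" "C \<in> range coset" using ab unfolding \<D>_def by blast
      obtain C' n' where C': "b = D C' n'" "C' \<in> range coset" using ab unfolding \<D>_def by blast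
      show "a \<inter> b = {}"
      proof (rule ccontr)
        assume "a \<inter> b \<noteq> {}"
        then obtain x where "x \<in> D C n" "x \<in> D C' n'" unfolding C(1) C'(1) by (metis IntE ex_in_conv)
        from disj[OF this C(2) C'(2)] show False using ab(3) C(1) C'(1) by simp
      qed
    qed
    fix E assume E: "E \<in> sets lam" "emeasure lam E < top"
    obtain U where U: "open U" "E \<subseteq> U" "emeasure lam U < top"
      by (rule outer_regular[of E top]) (use E that in auto)
    define I where "I = {C \<in> range coset. U \<inter> C \<noteq> {}}"
    have "countable I"
    proof (rule countable_disjoint_positive[where V="\<lambda>C. U \<inter> C" and M=lam and U=U])
      show "U \<inter> C \<in> sets lam" if "C \<in> I" for C
        using that U coset_open by (auto simp: I_def)
      show "emeasure lam (U \<inter> C) > 0" if C: "C \<in> I" for C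
      proof -
        obtain x where "x \<in> U \<inter> C" using C by (auto simp: I_def)
        then show ?thesis using C U coset_open by (intro emeasure_open_pos[of _ x]) (auto simp: I_def)
      qed
      show "disjoint_family_on (\<lambda>C. U \<inter> C) I"
        unfolding disjoint_family_on_def
      proof (intro ballI impI)
        fix C C' assume "C \<in> I" "C' \<in> I" "C \<noteq> C'"
        moreover then obtain a b where ab: "C = coset a" "C' = coset b" unfolding I_def by blast
        ultimately have "x \<notin> C'" if "x \<in> C" for x
          using coset_eq[of x a] coset_eq[of x b] that by blast
        then show "(U \<inter> C) \<inter> (U \<inter> C') = {}" by blast
      qed
    qed (use U in auto)
    define C where "C = (\<Union>C\<in>I. range (D C))"
    have "E \<subseteq> \<Union>C"
    proof
      fix x assume "x \<in> E"
      then have "coset x \<in> I" using U self unfolding I_def by blast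
      moreover obtain n where "x \<in> D (coset x) n" using D_UN[of "coset x"] self[of x] by blast
      ultimately show "x \<in> \<Union>C" unfolding C_def by blast
    qed
    moreover have "countable C" unfolding C_def using \<open>countable I\<close> by (intro countable_UN) auto
    moreover have "C \<subseteq> \<D>" unfolding C_def \<D>_def I_def by blast
    ultimately show "\<exists>C\<subseteq>\<D>. countable C \<and> E \<subseteq> \<Union>C" by blast
  qed
  then show ?thesis ..
qed

section \<open>Density of \<open>Cc\<close> in \<open>L1\<close>\<close>

lemma Cc_approximates_indicator:
  assumes E: "E \<in> sets borel" "emeasure lam E < top" and e: "e > 0"
  obtains f :: "'a \<Rightarrow> real" where "f \<in> Cc" "(\<integral>x. \<bar>indicator E x - f x\<bar> \<partial>lam) < e"
proof -
  have E_eq: "emeasure lam E = ennreal (measure lam E)"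
    using E(2) by (intro emeasure_eq_ennreal_measure) simp
  have "emeasure lam E < ennreal (measure lam E + e / 2)"
    unfolding E_eq using e by (simp add: ennreal_less_iff)
  then obtain U where U: "open U" "E \<subseteq> U" "emeasure lam U < ennreal (measure lam E + e / 2)"
    by (rule outer_regular[OF E(1)]) (rule that)
  have U_fin: "emeasure lam U < top" by (rule less_trans[OF U(3)]) simp
  have U_eq: "emeasure lam U = ennreal (measure lam U)"
    using U_fin by (intro emeasure_eq_ennreal_measure) simp
  have mU: "measure lam U < measure lam E + e / 2"
    using U(3) unfolding U_eq by (simp add: ennreal_less_iff)
  \<comment> \<open>Inner regularity is given for open sets, so \<open>K\<close> approximates
    \<open>U\<close> from inside and may stick out of \<open>E\<close>; the error is estimated by
    the two differences U - E and U - K.\<close>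
  obtain K where K: "compact K" "K \<subseteq> U" "measure lam U - e / 2 < measure lam K"
  proof (cases "measure lam U - e / 2 < 0")
    \<comment> \<open>\<open>ennreal\<close> sends negative numbers to 0, so a negative bound would
      not lie strictly below the measure of a null \<open>U\<close>; the empty set serves
      here.\<close>
    case True
    then show ?thesis using that[of "{}"] by simp
  next
    case False
    then have "ennreal (measure lam U - e / 2) < emeasure lam U"
      unfolding U_eq using e False by (simp add: ennreal_less_iff)
    then obtain K where K: "compact K" "K \<subseteq> U" "ennreal (measure lam U - e / 2) < emeasure lam K"
      by (rule inner_regular[OF U(1)]) (rule that)
    have "emeasure lam K = ennreal (measure lam K)"
      using emeasure_compact[OF K(1)] by (intro emeasure_eq_ennreal_measure) simp
    with K False show ?thesis by (intro that[of K]) (simp_all add: ennreal_less_iff)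
  qed
  obtain f :: "'a \<Rightarrow> real" and L where f: "continuous_on UNIV f" "\<And>x. 0 \<le> f x" "\<And>x. x \<in> K \<Longrightarrow> f x = 1"
    "compact L" "\<And>x. x \<notin> L \<inter> U \<Longrightarrow> f x = 0" "\<And>x. f x \<le> 1"
    by (rule urysohn_locally_compact[OF lc K(1) U(1) K(2)]) (use that in auto)
  have Cc: "f \<in> Cc" using f by (intro CcI[of f L]) auto
  have sets: "E \<in> sets lam" "U \<in> sets lam" "K \<in> sets lam" using E U K by (auto simp: borel_compact)
  have fins: "emeasure lam E < \<infinity>" "emeasure lam U < \<infinity>" "emeasure lam K < \<infinity>"
    using E U_fin emeasure_compact[OF K(1)] by auto
  have int: "integrable lam (indicator E :: 'a \<Rightarrow> real)" "integrable lam (indicator U :: 'a \<Rightarrow> real)" "integrable lam (indicator K :: 'a \<Rightarrow> real)"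
    using sets fins by (auto intro: integrable_real_indicator)
  have "(\<integral>x. \<bar>indicator E x - f x\<bar> \<partial>lam) \<le> (\<integral>x. (indicator U x - indicator E x) + (indicator U x - indicator K x) \<partial>lam)"
  proof (intro integral_mono)
    show "\<bar>indicator E x - f x\<bar> \<le> (indicator U x - indicator E x) + (indicator U x - indicator K x)" for x
      using f(2)[of x] f(6)[of x] f(3)[of x] f(5)[of x] U(2) K(2) by (auto simp: indicator_def)
  qed (use int integrable_Cc[OF Cc] in auto)
  also have "\<dots> = (measure lam U - measure lam E) + (measure lam U - measure lam K)"
    using int sets by simp
  also have "\<dots> < e" using mU K(3) by simp
  finally show ?thesis using that Cc by blast
qed

lemma Cc_dense:
  assumes "integrable lam f"
  shows "\<forall>e>0. \<exists>g\<in>Cc. (L1_dist lam f g) < e"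
  using assms
proof (induction rule: integrable_induct)
  case (base A c)
  show ?case
  proof (intro allI impI)
    fix e :: real assume e: "e > 0"
    obtain f :: "'a \<Rightarrow> real" where f: "f \<in> Cc" "(\<integral>x. \<bar>indicator A x - f x\<bar> \<partial>lam) < e / (1 + cmod c)"
      by (rule Cc_approximates_indicator[of A "e / (1 + cmod c)"])
        (use base e that in \<open>auto simp: add_pos_nonneg\<close>)
    have "(\<lambda>x. f x *\<^sub>R c) \<in> Cc"
      by (rule Cc_compose[OF f(1), where F="\<lambda>y. y *\<^sub>R c"]) (auto intro!: continuous_intros)
    moreover have "(\<integral>x. cmod (indicator A x *\<^sub>R c - f x *\<^sub>R c) \<partial>lam) = cmod c * (\<integral>x. \<bar>indicator A x - f x\<bar> \<partial>lam)"
      by (simp flip: scaleR_left_diff_distrib add: mult.commute)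
    moreover have "cmod c * (\<integral>x. \<bar>indicator A x - f x\<bar> \<partial>lam) < e"
    proof -
      have "cmod c * (\<integral>x. \<bar>indicator A x - f x\<bar> \<partial>lam) \<le> cmod c * (e / (1 + cmod c))"
        using f(2) by (intro mult_left_mono) auto
      also have "\<dots> < e" using e by (simp add: field_simps add_pos_nonneg)
      finally show ?thesis .
    qed
    ultimately show "\<exists>g\<in>Cc. (\<integral>x. cmod (indicator A x *\<^sub>R c - g x) \<partial>lam) < e" by force
  qed
next
  case (add f g)
  show ?case
  proof (intro allI impI)
    fix e :: real assume e: "e > 0"
    obtain f' where f': "f' \<in> Cc" "L1_dist lam f f' < e / 2" using add(3) e half_gt_zero by blast
    obtain g' where g': "g' \<in> Cc" "L1_dist lam g g' < e / 2" using add(4) e half_gt_zero by blast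
    note [simp] = integrable_Cc[OF f'(1)] integrable_Cc[OF g'(1)]
    have "(\<integral>x. cmod (f x + g x - (f' x + g' x)) \<partial>lam) \<le> (\<integral>x. cmod (f x - f' x) + cmod (g x - g' x) \<partial>lam)"
      using add(1,2) f'(1) g'(1)
      by (intro integral_mono) (auto simp: norm_diff_triangle_ineq)
    also have "\<dots> < e" using add(1,2) f' g' by (simp add: integrable_Cc)
    finally show "\<exists>h\<in>Cc. (\<integral>x. cmod (f x + g x - h x) \<partial>lam) < e"
      using Cc_add[OF f'(1) g'(1)] by force
  qed
next
  case (lim f s)
  show ?case
  proof (intro allI impI)
    fix e :: real assume e: "e > 0"
    have [measurable]: "f \<in> borel_measurable lam" "s i \<in> borel_measurable lam" for i using lim by auto
    have "(\<lambda>n. \<integral>x. cmod (f x - s n x) \<partial>lam) \<longlonglongrightarrow> (\<integral>x. 0 \<partial>lam)"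
    proof (rule integral_dominated_convergence[where w="\<lambda>x. 3 * cmod (f x)"])
      have "(\<lambda>n. f x - s n x) \<longlonglongrightarrow> 0" if "x \<in> space lam" for x
        using tendsto_diff[OF tendsto_const[of "f x"] lim(2)[OF that]] by simp
      then show "AE x in lam. (\<lambda>n. cmod (f x - s n x)) \<longlonglongrightarrow> 0"
        by (intro AE_I2 tendsto_norm_zero)
      \<comment> \<open>The induction rule bounds \<open>s n\<close> by
        \<open>2 * cmod (f x)\<close>, whence the factor 3.\<close>
      have "cmod (f x - s n x) \<le> 3 * cmod (f x)" for n x
        using norm_triangle_ineq4[of "f x" "s n x"] lim(3)[of x n] by simp
      then show "AE x in lam. norm (cmod (f x - s n x)) \<le> 3 * cmod (f x)" for n
        by (intro AE_I2) simp
    qed (use lim in auto)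
    then have "\<forall>\<^sub>F n in sequentially. (\<integral>x. cmod (f x - s n x) \<partial>lam) < e / 2"
      using e by (intro order_tendstoD) auto
    then obtain n where n: "(\<integral>x. cmod (f x - s n x) \<partial>lam) < e / 2"
      by (auto simp: eventually_sequentially)
    obtain g where g: "g \<in> Cc" "(\<integral>x. cmod (s n x - g x) \<partial>lam) < e / 2" using lim(5) e half_gt_zero by blast
    note [simp] = integrable_Cc[OF g(1)]
    have "L1_dist lam f g \<le> (\<integral>x. cmod (f x - s n x) + cmod (s n x - g x) \<partial>lam)"
      using lim(1,4) g(1)
      by (intro integral_mono) (auto intro: norm_diff_triangle_le)
    also have "\<dots> < e" using lim(1,4) n g by (simp add: integrable_Cc)
    finally show "\<exists>g\<in>Cc. (L1_dist lam f g) < e" using g by blast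
  qed
qed

end

section \<open>Averaging over the compact subgroup\<close>

context haar_compact_subgroup
begin

lemma emeasure_vimage_right:
  assumes F: "F \<in> sets borel" and h: "h \<in> H"
  shows "emeasure lam ((\<lambda>x. x + h) -` F) = emeasure lam F"
proof -
  have "(\<lambda>x. x + h) \<in> measurable lam lam" by measurable
  then have "emeasure (distr lam lam (\<lambda>x. x + h)) F = emeasure lam ((\<lambda>x. x + h) -` F \<inter> space lam)"
    using F by (intro emeasure_distr) auto
  then show ?thesis using distr_right[OF h] by simp
qed

text \<open>\<open>F'\<close> is \<open>F\<close> translated by \<open>h\<close>, again of finite
  measure; testing a translate of \<open>N\<close> on \<open>F\<close> becomes testing
  \<open>N\<close> on \<open>F'\<close>.\<close>

lemma right_vimage_Int:
  assumes F: "F \<in> sets lam" "emeasure lam F < \<infinity>" and h: "h \<in> H"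
  obtains F' where "F' \<in> sets lam" "emeasure lam F' < top"
    "\<And>N. (\<lambda>x. x + h) -` N \<inter> F = (\<lambda>x. x + h) -` (N \<inter> F')"
proof (rule that)
  show "(\<lambda>x. x + - h) -` F \<in> sets lam"
    using F measurable_sets[OF borel_plus_right, of F "- h"] by simp
  have "emeasure lam ((\<lambda>x. x + - h) -` F) = emeasure lam F"
    using F by (intro emeasure_vimage_right minus_in_H h) simp
  with F(2) show "emeasure lam ((\<lambda>x. x + - h) -` F) < top" by simp
qed (auto simp: add.assoc)

lemma right_loc_sets:
  assumes N: "N \<in> loc_sets lam" and h: "h \<in> H"
  shows "(\<lambda>x. x + h) -` N \<in> loc_sets lam"
  unfolding loc_sets_def
proof safe
  fix F assume "F \<in> sets lam" "emeasure lam F < \<infinity>"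
  then obtain F' where F': "F' \<in> sets lam" "emeasure lam F' < top"
    "\<And>N. (\<lambda>x. x + h) -` N \<inter> F = (\<lambda>x. x + h) -` (N \<inter> F')"
    using right_vimage_Int[OF _ _ h] by metis
  show "(\<lambda>x. x + h) -` N \<inter> F \<in> sets lam"
    using measurable_sets[OF borel_plus_right, of "N \<inter> F'" h] loc_setsD[OF N F'(1,2)] by (simp add: F'(3))
qed simp

lemma right_loc_null:
  assumes N: "N \<in> loc_null_sets lam" and h: "h \<in> H"
  shows "(\<lambda>x. x + h) -` N \<in> loc_null_sets lam"
  unfolding loc_null_sets_def
proof safe
  show "(\<lambda>x. x + h) -` N \<in> loc_sets lam"
    using N h by (intro right_loc_sets) (auto simp: loc_null_sets_def)
  fix F assume "F \<in> sets lam" "emeasure lam F < \<infinity>"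
  then obtain F' where F': "F' \<in> sets lam" "emeasure lam F' < top"
    "\<And>N. (\<lambda>x. x + h) -` N \<inter> F = (\<lambda>x. x + h) -` (N \<inter> F')"
    using right_vimage_Int[OF _ _ h] by metis
  have "N \<inter> F' \<in> null_sets lam" by (rule loc_null_setsD[OF N F'(1,2)])
  then show "emeasure lam ((\<lambda>x. x + h) -` N \<inter> F) = 0"
    unfolding F'(3) using emeasure_vimage_right[OF _ h, of "N \<inter> F'"]
    by (metis null_setsD1 null_setsD2 sets_lam)
qed

lemma right_loc_measurable:
  assumes "loc_measurable lam g" "h \<in> H"
  shows "loc_measurable lam (\<lambda>x. g (x + h))"
  unfolding loc_measurable_def
proof
  fix A :: "complex set" assume "A \<in> sets borel"
  then have "(\<lambda>x. x + h) -` (g -` A \<inter> space lam) \<in> loc_sets lam"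
    using assms by (intro right_loc_sets) (auto simp: loc_measurable_def)
  then show "(\<lambda>x. g (x + h)) -` A \<inter> space lam \<in> loc_sets lam"
    by (simp add: vimage_def)
qed

lemma right_loc_AE:
  assumes "loc_AE lam P" "h \<in> H"
  shows "loc_AE lam (\<lambda>x. P (x + h))"
proof -
  obtain N where N: "N \<in> loc_null_sets lam" "{x \<in> space lam. \<not> P x} \<subseteq> N"
    using assms(1) unfolding loc_AE_def by blast
  then have "{x \<in> space lam. \<not> P (x + h)} \<subseteq> (\<lambda>x. x + h) -` N" by auto
  with right_loc_null[OF N(1) assms(2)] show ?thesis unfolding loc_AE_def by (rule bexI[rotated])
qed

lemma right_Linf_funs:
  assumes "g \<in> Linf_funs lam" "h \<in> H"
  shows "(\<lambda>x. g (x + h)) \<in> Linf_funs lam"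
proof -
  obtain t where "loc_AE lam (\<lambda>x. cmod (g x) \<le> t)" using assms by (auto simp: Linf_funs_def)
  from right_loc_AE[OF this assms(2)] show ?thesis
    using assms right_loc_measurable by (auto simp: Linf_funs_def)
qed

end

lemma loc_measurable_compose:
  assumes "loc_measurable M g" "F \<in> borel_measurable borel"
  shows "loc_measurable M (\<lambda>x. F (g x))"
  unfolding loc_measurable_def
proof
  fix A :: "complex set" assume "A \<in> sets borel"
  then have "F -` A \<in> sets borel" using measurable_sets[OF assms(2)] by simp
  moreover have "(\<lambda>x. F (g x)) -` A = g -` (F -` A)" by auto
  ultimately show "(\<lambda>x. F (g x)) -` A \<inter> space M \<in> loc_sets M"
    using assms(1) by (simp add: loc_measurable_def)
qed

lemma loc_measurable_cmult: "loc_measurable M g \<Longrightarrow> loc_measurable M (\<lambda>x. c * g x)"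
  by (rule loc_measurable_compose) auto

section \<open>Twisted translates and their convex hulls\<close>

locale haar_character = haar_compact_subgroup +
  fixes \<xi> :: "'a \<Rightarrow> complex"
  assumes character: "is_character H \<xi>"
begin

lemma norm_\<xi>: "h \<in> H \<Longrightarrow> cmod (\<xi> h) = 1" and \<xi>_add: "h \<in> H \<Longrightarrow> k \<in> H \<Longrightarrow> \<xi> (h + k) = \<xi> h * \<xi> k"
  using character by (auto simp: is_character_def)

lemma \<xi>_zero: "\<xi> 0 = 1"
  using \<xi>_add[OF zero_in_H zero_in_H] norm_\<xi>[OF zero_in_H] by auto

lemma cnj_\<xi>: "h \<in> H \<Longrightarrow> cnj (\<xi> h) * \<xi> h = 1"
  using norm_\<xi>[of h] complex_norm_square[of "\<xi> h"] by (simp add: mult.commute)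

lemma \<xi>_minus: "h \<in> H \<Longrightarrow> \<xi> (- h) = cnj (\<xi> h)"
proof -
  assume h: "h \<in> H"
  have "\<xi> h * \<xi> (- h) = 1" using \<xi>_add[OF h minus_in_H[OF h]] \<xi>_zero by simp
  then have "cnj (\<xi> h) * (\<xi> h * \<xi> (- h)) = cnj (\<xi> h)" by simp
  then show ?thesis using cnj_\<xi>[OF h] by (simp flip: mult.assoc)
qed

definition twist :: "'a \<Rightarrow> ('a \<Rightarrow> complex) \<Rightarrow> 'a \<Rightarrow> complex" where
  "twist h f = (\<lambda>x. cnj (\<xi> h) * f (x + h))"

text \<open>The form of \<open>M_xi\<close> with compact support in the group itself; the two agree
  because \<open>H\<close> is compact, see \<open>M_xi_eq_covariant\<close>.\<close>

definition covariant :: "('a \<Rightarrow> complex) set" where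
  "covariant = {\<psi> \<in> Cc. \<forall>x. \<forall>h\<in>H. \<psi> (x + h) = \<xi> h * \<psi> x}"

text \<open>Built from binary combinations, so that a property of the hull follows by induction from
  the single twists and one convexity step.\<close>

inductive_set twist_hull :: "('a \<Rightarrow> complex) \<Rightarrow> ('a \<Rightarrow> complex) set" for f where
  base: "h \<in> H \<Longrightarrow> twist h f \<in> twist_hull f"
| convex: "u \<in> twist_hull f \<Longrightarrow> v \<in> twist_hull f \<Longrightarrow> 0 \<le> t \<Longrightarrow> t \<le> 1 \<Longrightarrow>
    (\<lambda>x. of_real t * u x + of_real (1 - t) * v x) \<in> twist_hull f"

lemma twist_twist: "h \<in> H \<Longrightarrow> k \<in> H \<Longrightarrow> twist k (twist h f) = twist (k + h) f"
  by (auto simp: twist_def \<xi>_add add.assoc mult_ac)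

lemma twist_Cc: "f \<in> Cc \<Longrightarrow> twist h f \<in> Cc"
  unfolding twist_def by (intro Cc_cmult Cc_translate_right)

lemma hull_Cc: "g \<in> twist_hull f \<Longrightarrow> f \<in> Cc \<Longrightarrow> g \<in> Cc"
  by (induction rule: twist_hull.induct) (auto intro!: twist_Cc Cc_add Cc_cmult)

lemma self_in_hull: "f \<in> twist_hull f"
  using twist_hull.base[OF zero_in_H, of f] by (simp add: twist_def \<xi>_zero)

text \<open>Makes the twists of a minimising sequence available as competitors for the
  minimum.\<close>

lemma hull_twist: "g \<in> twist_hull f \<Longrightarrow> k \<in> H \<Longrightarrow> twist k g \<in> twist_hull f"
proof (induction rule: twist_hull.induct)
  case (base h)
  then show ?case by (simp add: twist_twist twist_hull.base plus_in_H)
next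
  case (convex u v t)
  have "twist k (\<lambda>x. of_real t * u x + of_real (1 - t) * v x) =
      (\<lambda>x. of_real t * twist k u x + of_real (1 - t) * twist k v x)"
    by (auto simp: twist_def algebra_simps)
  then show ?case using twist_hull.convex convex by simp
qed

lemma convex_norm_le:
  assumes "cmod a \<le> e" "cmod b \<le> e" "0 \<le> t" "t \<le> 1"
  shows "cmod (of_real t * a + of_real (1 - t) * b) \<le> e"
proof -
  have "cmod (of_real t * a + of_real (1 - t) * b) \<le> t * cmod a + (1 - t) * cmod b"
    using assms by (intro order_trans[OF norm_triangle_ineq]) (simp add: norm_mult del: of_real_diff)
  also have "\<dots> \<le> t * e + (1 - t) * e"
    using assms by (intro add_mono mult_left_mono) auto
  finally show ?thesis by (simp add: algebra_simps)
qed

text \<open>A common support turns uniform convergence in the hull into \<open>L1\<close>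
  convergence.\<close>

lemma hull_support:
  assumes f: "f \<in> Cc"
  obtains K where "compact K" "\<And>g x. g \<in> twist_hull f \<Longrightarrow> x \<notin> K \<Longrightarrow> g x = 0"
proof -
  obtain K where K: "continuous_on UNIV f" "compact K" "\<And>x. x \<notin> K \<Longrightarrow> f x = 0"
    using CcE[OF f] by metis
  obtain A where A: "compact A" and inA: "\<And>x s. x + s \<in> K \<Longrightarrow> s \<in> H \<Longrightarrow> x \<in> A"
    using compact_translates[OF K(2) compact_H] by metis
  have "g x = 0" if "g \<in> twist_hull f" "x \<notin> A" for g x
    using that
  proof (induction rule: twist_hull.induct)
    case (base h)
    then show ?case using inA K(3) by (auto simp: twist_def)
  qed auto
  then show ?thesis using that A by blast
qed

text \<open>The twists share a modulus of continuity by
  \<open>right_translates_equicontinuous\<close>, since the factors \<open>cnj (\<xi> h)\<close>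
  have modulus 1, and convex combinations inherit it.\<close>

lemma hull_equicontinuous:
  assumes f: "f \<in> Cc" and e: "e > 0"
  obtains U where "open U" "0 \<in> U"
    "\<And>g u x. g \<in> twist_hull f \<Longrightarrow> u \<in> U \<Longrightarrow> cmod (g (x + u) - g x) \<le> e"
proof -
  obtain U where U: "open U" "0 \<in> U" "\<And>u h x. u \<in> U \<Longrightarrow> h \<in> H \<Longrightarrow> cmod (f (x + u + h) - f (x + h)) \<le> e"
    using right_translates_equicontinuous[OF lc f compact_H e] by metis
  have "cmod (g (x + u) - g x) \<le> e" if "g \<in> twist_hull f" "u \<in> U" for g u x
    using that
  proof (induction rule: twist_hull.induct)
    case (base h)
    have "cmod (twist h f (x + u) - twist h f x) = cmod (cnj (\<xi> h) * (f (x + u + h) - f (x + h)))"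
      by (simp add: twist_def right_diff_distrib)
    then show ?case using U(3) base norm_\<xi> by (simp add: norm_mult)
  next
    case (convex g v t)
    have "of_real t * g (x + u) + of_real (1 - t) * v (x + u) - (of_real t * g x + of_real (1 - t) * v x) =
        of_real t * (g (x + u) - g x) + of_real (1 - t) * (v (x + u) - v x)"
      by (simp add: algebra_simps)
    then show ?case using convex_norm_le convex by metis
  qed
  then show ?thesis using that U by blast
qed

lemma integral_norm_twist:
  assumes "f \<in> Cc" "h \<in> H"
  shows "(\<integral>x. cmod (twist h f x) \<partial>lam) = L1_norm lam f"
  using integral_right[of "\<lambda>x. cmod (f x)" h] assms Cc_borel[OF assms(1)] norm_\<xi>
  by (simp add: twist_def norm_mult)

lemma hull_L1_norm:
  assumes "g \<in> twist_hull f" "f \<in> Cc"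
  shows "L1_norm lam g \<le> L1_norm lam f"
  using assms
proof (induction rule: twist_hull.induct)
  case (base h)
  then show ?case by (simp add: integral_norm_twist)
next
  case (convex u v t)
  then have [simp]: "integrable lam u" "integrable lam v"
    using integrable_Cc hull_Cc by blast+
  have "(\<integral>x. cmod (of_real t * u x + of_real (1 - t) * v x) \<partial>lam) \<le> (\<integral>x. t * cmod (u x) + (1 - t) * cmod (v x) \<partial>lam)"
  proof (intro integral_mono)
    show "cmod (of_real t * u x + of_real (1 - t) * v x) \<le> t * cmod (u x) + (1 - t) * cmod (v x)" for x
      using convex by (intro order_trans[OF norm_triangle_ineq]) (simp add: norm_mult del: of_real_diff)
  qed auto
  also have "\<dots> = t * L1_norm lam u + (1 - t) * L1_norm lam v"
    by simp
  also have "\<dots> \<le> t * L1_norm lam f + (1 - t) * L1_norm lam f"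
    using convex by (intro add_mono mult_left_mono) auto
  finally show ?case by (simp add: algebra_simps)
qed

text \<open>The factor \<open>cnj (\<xi> h)\<close> moves into the conjugate, where covariance turns
  \<open>\<xi> h * g x\<close> into \<open>g (x + h)\<close>; right invariance then removes the
  common translation.\<close>

lemma pairing_twist:
  assumes f: "f \<in> Cc" and h: "h \<in> H" and g: "loc_measurable lam g"
    and cov: "loc_AE lam (\<lambda>x. g (x + h) = \<xi> h * g x)"
  shows "(\<integral>x. twist h f x * cnj (g x) \<partial>lam) = pairing lam f g"
proof -
  have "(\<integral>x. twist h f x * cnj (g x) \<partial>lam) = (\<integral>x. f (x + h) * cnj (\<xi> h * g x) \<partial>lam)"
    by (simp add: twist_def mult_ac)
  also have "\<dots> = (\<integral>x. f (x + h) * cnj (g (x + h)) \<partial>lam)"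
    using f g h cov by (intro pairing_cong[symmetric] integrable_Cc Cc_translate_right right_loc_measurable loc_measurable_cmult)
  also have "\<dots> = pairing lam f g"
    using integral_right[of "\<lambda>x. f x * cnj (g x)" h] borel_measurable_pairing[OF integrable_Cc[OF f] g] h
    by (simp add: borel_measurable_lam)
  finally show ?thesis .
qed

lemma hull_pairing:
  assumes "u \<in> twist_hull f" "f \<in> Cc" and g: "g \<in> Linf_funs lam"
    and cov: "\<And>h. h \<in> H \<Longrightarrow> loc_AE lam (\<lambda>x. g (x + h) = \<xi> h * g x)"
  shows "pairing lam u g = pairing lam f g"
  using assms(1,2)
proof (induction rule: twist_hull.induct)
  case (base h)
  from g have "loc_measurable lam g" by (simp add: Linf_funs_def)
  from pairing_twist[OF base(2) base(1) this cov[OF base(1)]] show ?case .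
next
  case (convex u v t)
  obtain s where s: "loc_measurable lam g" "loc_AE lam (\<lambda>x. cmod (g x) \<le> s)"
    using g by (auto simp: Linf_funs_def)
  have [simp]: "integrable lam (\<lambda>x. u x * cnj (g x))" "integrable lam (\<lambda>x. v x * cnj (g x))"
    using pairing_bound(1)[OF integrable_Cc[OF hull_Cc[OF convex(1) \<open>f \<in> Cc\<close>]] s]
      pairing_bound(1)[OF integrable_Cc[OF hull_Cc[OF convex(2) \<open>f \<in> Cc\<close>]] s] by blast+
  have "(\<integral>x. (of_real t * u x + of_real (1 - t) * v x) * cnj (g x) \<partial>lam) =
      (\<integral>x. of_real t * (u x * cnj (g x)) + of_real (1 - t) * (v x * cnj (g x)) \<partial>lam)"
    by (simp add: distrib_right mult.assoc del: of_real_diff)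
  also have "\<dots> = of_real t * (pairing lam u g) + of_real (1 - t) * (pairing lam v g)"
    by (simp del: of_real_diff)
  also have "\<dots> = pairing lam f g"
    using convex by (simp add: algebra_simps)
  finally show ?case .
qed

section \<open>Minimising the \<open>L2\<close> norm\<close>

definition energy :: "('a \<Rightarrow> complex) \<Rightarrow> real" where
  "energy f = (\<integral>x. (cmod (f x))\<^sup>2 \<partial>lam)"

lemma square_Cc: "f \<in> Cc \<Longrightarrow> (\<lambda>x. (cmod (f x))\<^sup>2) \<in> Cc"
  by (rule Cc_compose[where F="\<lambda>z. (cmod z)\<^sup>2"]) (auto intro!: continuous_intros)

lemma energy_twist:
  assumes "f \<in> Cc" "h \<in> H"
  shows "energy (twist h f) = energy f"
  using integral_right[of "\<lambda>x. (cmod (f x))\<^sup>2" h] assms Cc_borel[OF assms(1)] norm_\<xi>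
  by (simp add: twist_def norm_mult energy_def)

text \<open>The midpoint is written with weights \<open>1/2\<close> and \<open>1 - 1/2\<close> to
  match the rule \<open>twist_hull.convex\<close>.\<close>

lemma parallelogram:
  assumes "u \<in> Cc" "v \<in> Cc"
  shows "energy (\<lambda>x. u x - v x) =
    2 * energy u + 2 * energy v - 4 * energy (\<lambda>x. of_real (1/2) * u x + of_real (1 - 1/2) * v x)"
proof -
  define w where "w x = of_real (1/2) * u x + of_real (1 - 1/2) * v x" for x
  have c: "w \<in> Cc"
    unfolding w_def using assms by (intro Cc_add Cc_cmult)
  note [simp] = integrable_Cc[OF square_Cc[OF assms(1)]] integrable_Cc[OF square_Cc[OF assms(2)]]
    integrable_Cc[OF square_Cc[OF c]]
  have "(cmod (u x - v x))\<^sup>2 = 2 * (cmod (u x))\<^sup>2 + 2 * (cmod (v x))\<^sup>2 - 4 * (cmod (w x))\<^sup>2" for x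
  proof -
    have "w x = (u x + v x) / 2" by (simp add: w_def field_simps)
    then have eq: "cmod (w x) = cmod (u x + v x) / 2"
      by (metis norm_divide norm_numeral)
    have "(cmod (u x - v x))\<^sup>2 + (cmod (u x + v x))\<^sup>2 = 2 * (cmod (u x))\<^sup>2 + 2 * (cmod (v x))\<^sup>2"
      unfolding cmod_power2 by (simp add: power2_eq_square algebra_simps)
    then show ?thesis unfolding eq by (simp add: power_divide)
  qed
  then have "energy (\<lambda>x. u x - v x) = 2 * energy u + 2 * energy v - 4 * energy w"
    unfolding energy_def by simp
  then show ?thesis by (simp only: w_def[abs_def])
qed

text \<open>If \<open>u - v\<close> exceeds \<open>e\<close> in modulus at \<open>x\<close>,
  equicontinuity keeps it at least \<open>e / 2\<close> on the translate x + K of a compact set of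
  positive measure, and left invariance makes the resulting lower bound \<open>d\<close> for the
  energy independent of \<open>x\<close>.\<close>

lemma hull_energy_small:
  assumes f: "f \<in> Cc" and e: "e > 0"
  obtains d where "d > 0" "\<And>u v x. u \<in> twist_hull f \<Longrightarrow> v \<in> twist_hull f \<Longrightarrow>
    energy (\<lambda>x. u x - v x) < d \<Longrightarrow> cmod (u x - v x) \<le> e"
proof -
  \<comment> \<open>\<open>u\<close> and \<open>v\<close> each vary by at most \<open>e / 4\<close>,
    which leaves \<open>e / 2\<close> of their difference.\<close>
  obtain U where U: "open U" "0 \<in> U"
    "\<And>g u x. g \<in> twist_hull f \<Longrightarrow> u \<in> U \<Longrightarrow> cmod (g (x + u) - g x) \<le> e / 4"
    by (rule hull_equicontinuous[OF f, of "e / 4"]) (use e that in auto)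
  obtain K where K: "compact K" "K \<subseteq> U" "0 < emeasure lam K"
    by (rule inner_regular[OF U(1) emeasure_open_pos[OF U(1,2)]]) (rule that)
  have K_eq: "emeasure lam K = ennreal (measure lam K)"
    using emeasure_compact[OF K(1)] by (intro emeasure_eq_ennreal_measure) simp
  define d where "d = (e / 2)\<^sup>2 * measure lam K"
  have "d > 0" using K(3) e unfolding d_def K_eq by (auto simp: ennreal_less_iff[of 0, simplified])
  moreover have "cmod (u x - v x) \<le> e" if u: "u \<in> twist_hull f" and v: "v \<in> twist_hull f"
    and small: "energy (\<lambda>x. u x - v x) < d" for u v x
  proof (rule ccontr)
    assume "\<not> ?thesis"
    then have big: "cmod (u x - v x) > e" by simp
    have uv: "(\<lambda>x. u x - v x) \<in> Cc" using u v f hull_Cc by (intro Cc_diff) auto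
    define A where "A = (\<lambda>y. x + y) ` K"
    have "compact A" unfolding A_def by (intro compact_continuous_image K continuous_intros)
    then have A: "A \<in> sets lam" "emeasure lam A < top" by (auto simp: borel_compact emeasure_compact)
    have mA: "measure lam A = measure lam K"
      using emeasure_left[of K x] K(1) by (simp add: measure_def A_def borel_compact)
    have "d = (\<integral>y. (e / 2)\<^sup>2 * indicator A y \<partial>lam)"
      using A mA by (simp add: d_def)
    also have "\<dots> \<le> energy (\<lambda>x. u x - v x)"
      unfolding energy_def
    proof (intro integral_mono)
      show "integrable lam (\<lambda>y. (e / 2)\<^sup>2 * indicator A y)"
        using A by (intro integrable_mult_right integrable_real_indicator) auto
      show "integrable lam (\<lambda>x. (cmod (u x - v x))\<^sup>2)" by (intro integrable_Cc square_Cc uv)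
      show "(e / 2)\<^sup>2 * indicator A y \<le> (cmod (u y - v y))\<^sup>2" for y
      proof (cases "y \<in> A")
        case True
        then obtain k where k: "k \<in> U" "y = x + k" using K by (auto simp: A_def)
        have "cmod (u x - v x) \<le> cmod (u y - v y) + cmod (u y - u x) + cmod (v y - v x)"
          using norm_triangle_ineq4[of "u y - v y" "(u y - u x) - (v y - v x)"]
            norm_triangle_ineq4[of "u y - u x" "v y - v x"] by (simp add: algebra_simps)
        then have "e / 2 \<le> cmod (u y - v y)"
          using big U(3)[OF u k(1), of x] U(3)[OF v k(1), of x] k by simp
        then show ?thesis using True e by (simp add: power_mono)
      qed simp
    qed
    finally show False using small by simp
  qed
  ultimately show ?thesis using that by blast
qed

lemma ex_average:
  assumes f: "f \<in> Cc"
  shows "\<exists>\<psi>\<in>covariant. \<forall>e>0. \<exists>u\<in>twist_hull f. (L1_dist lam u \<psi>) < e"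
proof -
  define m where "m = Inf (energy ` twist_hull f)"
  have bdd: "bdd_below (energy ` twist_hull f)"
    by (rule bdd_belowI2[of _ 0]) (simp add: energy_def)
  have m_le: "m \<le> energy u" if "u \<in> twist_hull f" for u
    unfolding m_def using that bdd by (intro cINF_lower)
  have "\<exists>u\<in>twist_hull f. energy u < m + inverse (real (Suc n))" for n
    using cInf_lessD[of "energy ` twist_hull f" "m + inverse (real (Suc n))"] self_in_hull[of f]
    by (auto simp: m_def)
  then obtain g where g: "\<And>n. g n \<in> twist_hull f" "\<And>n. energy (g n) < m + inverse (real (Suc n))"
    by metis
  \<comment> \<open>The midpoint lies in the hull and has energy at least \<open>m\<close>, so the
    parallelogram law leaves less than
    \<open>2 * (m + d/4) + 2 * (m + d/4) - 4 * m = d\<close>.\<close>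
  have close: "energy (\<lambda>x. u x - v x) < d"
    if "u \<in> twist_hull f" "v \<in> twist_hull f" "energy u < m + d / 4" "energy v < m + d / 4" for u v d
  proof -
    have "(\<lambda>x. of_real (1/2) * u x + of_real (1 - 1/2) * v x) \<in> twist_hull f"
      by (intro twist_hull.convex that) auto
    from m_le[OF this] parallelogram[OF hull_Cc[OF that(1) f] hull_Cc[OF that(2) f]] that(3,4)
    show ?thesis by linarith
  qed
  have ev: "\<exists>N. \<forall>n\<ge>N. energy (g n) < m + d" if "d > 0" for d
  proof -
    obtain N where N: "inverse (real (Suc N)) < d" using reals_Archimedean[OF \<open>d > 0\<close>] by blast
    have "energy (g n) < m + d" if "n \<ge> N" for n
    proof -
      have "inverse (real (Suc n)) \<le> inverse (real (Suc N))" using that by (intro le_imp_inverse_le) auto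
      then show ?thesis using g(2)[of n] N by linarith
    qed
    then show ?thesis by blast
  qed
  \<comment> \<open>Two kinds of competitor \<open>u\<close> are covered at once: later members of
    the sequence, for the Cauchy property, and elements of energy at most that of
    \<open>g n\<close>, for its twists.\<close>
  have cauchy: "\<exists>N. \<forall>n\<ge>N. \<forall>u\<in>twist_hull f. energy u \<le> energy (g n) \<or> (\<exists>k\<ge>N. u = g k) \<longrightarrow>
      (\<forall>x. cmod (g n x - u x) \<le> e)" if "e > 0" for e
  proof -
    obtain d where d: "d > 0" "\<And>u v x. u \<in> twist_hull f \<Longrightarrow> v \<in> twist_hull f \<Longrightarrow>
        energy (\<lambda>x. u x - v x) < d \<Longrightarrow> cmod (u x - v x) \<le> e"
      by (rule hull_energy_small[OF f \<open>e > 0\<close>]) (rule that)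
    obtain N where N: "\<And>n. n \<ge> N \<Longrightarrow> energy (g n) < m + d / 4" using ev[of "d / 4"] d by auto
    show ?thesis
    proof (intro exI[of _ N] allI ballI impI)
      fix n u x assume n: "n \<ge> N" and u: "u \<in> twist_hull f" "energy u \<le> energy (g n) \<or> (\<exists>k\<ge>N. u = g k)"
      have "energy u < m + d / 4" using u(2) N[OF n] N by (auto intro: le_less_trans)
      then have "energy (\<lambda>x. g n x - u x) < d" by (rule close[OF g(1) u(1) N[OF n]])
      then show "cmod (g n x - u x) \<le> e" by (rule d(2)[OF g(1) u(1)])
    qed
  qed
  have "uniformly_Cauchy_on UNIV g"
    unfolding uniformly_Cauchy_on_def
  proof (intro allI impI)
    fix e :: real assume "e > 0"
    from cauchy[OF half_gt_zero[OF this]]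
    obtain N where N: "\<forall>n\<ge>N. \<forall>u\<in>twist_hull f. energy u \<le> energy (g n) \<or> (\<exists>k\<ge>N. u = g k) \<longrightarrow>
      (\<forall>x. cmod (g n x - u x) \<le> e / 2)" by (rule exE) (rule that)
    have "dist (g i x) (g j x) < e" if "i \<ge> N" "j \<ge> N" for x i j
    proof -
      have "cmod (g i x - g j x) \<le> e / 2"
        by (rule N[rule_format, OF that(1) g(1)]) (use that(2) in blast)
      then show ?thesis using \<open>e > 0\<close> by (simp add: dist_norm)
    qed
    then show "\<exists>N. \<forall>x\<in>UNIV. \<forall>i\<ge>N. \<forall>j\<ge>N. dist (g i x) (g j x) < e" by blast
  qed
  then obtain \<psi> where \<psi>: "uniform_limit UNIV g \<psi> sequentially"
    using Cauchy_uniformly_convergent uniformly_convergent_on_def by blast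
  then have lim: "(\<lambda>n. g n x) \<longlonglongrightarrow> \<psi> x" for x
    by (rule tendsto_uniform_limitI) simp
  obtain K where K: "compact K" "\<And>g x. g \<in> twist_hull f \<Longrightarrow> x \<notin> K \<Longrightarrow> g x = 0"
    by (rule hull_support[OF f]) (rule that)
  have \<psi>0: "\<psi> x = 0" if "x \<notin> K" for x
    using LIMSEQ_unique[OF lim[of x], of 0] K(2)[OF g(1) that] by simp
  have "continuous_on UNIV \<psi>"
    using g(1) hull_Cc[OF _ f] Cc_continuous by (intro uniform_limit_theorem[OF _ \<psi>] always_eventually allI) auto
  then have Cc: "\<psi> \<in> Cc" using K(1) \<psi>0 by (intro CcI[of \<psi> K])
  \<comment> \<open>The twist of \<open>g n\<close> has the same energy as \<open>g n\<close>, so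
    the two are uniformly close for large \<open>n\<close> and the limit is fixed by the
    twist.\<close>
  have cov: "\<psi> (x + h) = \<xi> h * \<psi> x" if h: "h \<in> H" for x h
  proof -
    have "(\<lambda>n. g n x - twist h (g n) x) \<longlonglongrightarrow> 0"
    proof (rule LIMSEQ_I)
      fix e :: real assume "e > 0"
      from cauchy[OF half_gt_zero[OF this]]
      obtain N where N: "\<forall>n\<ge>N. \<forall>u\<in>twist_hull f. energy u \<le> energy (g n) \<or> (\<exists>k\<ge>N. u = g k) \<longrightarrow>
        (\<forall>x. cmod (g n x - u x) \<le> e / 2)" by (rule exE) (rule that)
      have "cmod (g n x - twist h (g n) x) \<le> e / 2" if "n \<ge> N" for n
        by (rule N[rule_format, OF that hull_twist[OF g(1) h]])
          (simp add: energy_twist[OF hull_Cc[OF g(1) f] h])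
      then show "\<exists>N. \<forall>n\<ge>N. cmod (g n x - twist h (g n) x - 0) < e"
        using \<open>e > 0\<close> by (intro exI[of _ N]) (auto intro: le_less_trans[of _ "e / 2"])
    qed
    moreover have "(\<lambda>n. g n x - twist h (g n) x) \<longlonglongrightarrow> \<psi> x - twist h \<psi> x"
      unfolding twist_def by (intro tendsto_intros lim)
    ultimately have "\<psi> x = cnj (\<xi> h) * \<psi> (x + h)"
      using LIMSEQ_unique by (fastforce simp: twist_def)
    then show ?thesis using cnj_\<xi>[OF h] by (simp flip: mult.assoc add: mult.commute)
  qed
  have "\<exists>u\<in>twist_hull f. (L1_dist lam u \<psi>) < e" if e: "e > 0" for e
  proof -
    define d where "d = e / (2 * (1 + measure lam K))"
    have d: "d > 0" "d * measure lam K < e" using e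
      by (auto simp: d_def field_simps add_pos_nonneg add_nonneg_pos)
    obtain n where n: "\<And>x. dist (g n x) (\<psi> x) < d"
      using uniform_limitD[OF \<psi> d(1)] by (auto simp: eventually_sequentially)
    have K': "K \<in> sets lam" "emeasure lam K < top" using K by (auto simp: borel_compact emeasure_compact)
    have "(\<integral>x. cmod (g n x - \<psi> x) \<partial>lam) \<le> (\<integral>x. d * indicator K x \<partial>lam)"
    proof (intro integral_mono)
      show "integrable lam (\<lambda>x. cmod (g n x - \<psi> x))"
        using hull_Cc[OF g(1) f] Cc by (intro integrable_norm integrable_Cc Cc_diff)
      show "integrable lam (\<lambda>x. d * indicator K x)"
        using K' by (intro integrable_mult_right integrable_real_indicator) auto
      show "cmod (g n x - \<psi> x) \<le> d * indicator K x" for x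
        using n[of x] K(2)[OF g(1), of x n] \<psi>0[of x] by (auto simp: dist_norm indicator_def)
    qed
    also have "\<dots> < e" using K' d by simp
    finally show ?thesis using g(1) by blast
  qed
  moreover have "\<psi> \<in> covariant" using Cc cov by (simp add: covariant_def)
  ultimately show ?thesis by blast
qed

end

section \<open>Linear structure of \<open>Linf\<close> and testing against \<open>Cc\<close>\<close>

lemma le_epsilon_mult:
  fixes x y C :: real
  assumes "\<And>e. e > 0 \<Longrightarrow> x \<le> y + C * e"
  shows "x \<le> y"
proof (rule field_le_epsilon)
  fix d :: real assume d: "d > 0"
  define e where "e = d / (1 + \<bar>C\<bar>)"
  have e: "e > 0" using d by (simp add: e_def add_pos_nonneg)
  have "C * e \<le> \<bar>C\<bar> * e" using e by (intro mult_right_mono) auto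
  also have "\<dots> \<le> (1 + \<bar>C\<bar>) * e" using e by (intro mult_right_mono) auto
  also have "\<dots> = d" by (simp add: e_def add_pos_nonneg[THEN less_imp_neq, THEN not_sym])
  finally show "x \<le> y + d" using assms[OF e] by linarith
qed

text \<open>Reduces sums of locally measurable functions to sums of measurable ones.\<close>

lemma loc_measurable_iff:
  "loc_measurable M g \<longleftrightarrow>
    (\<forall>E\<in>sets M. emeasure M E < top \<longrightarrow> (\<lambda>x. indicator E x * g x) \<in> borel_measurable M)"
proof
  assume R: "\<forall>E\<in>sets M. emeasure M E < top \<longrightarrow> (\<lambda>x. indicator E x * g x) \<in> borel_measurable M"
  show "loc_measurable M g"
    unfolding loc_measurable_def loc_sets_def
  proof safe
    fix A :: "complex set" and F assume A: "A \<in> sets borel" and F: "F \<in> sets M" "emeasure M F < \<infinity>"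
    have "(\<lambda>x. indicator F x * g x) -` A \<inter> space M \<inter> F \<in> sets M"
      using R F by (intro sets.Int measurable_sets[OF _ A]) auto
    moreover have "(\<lambda>x. indicator F x * g x) -` A \<inter> space M \<inter> F = g -` A \<inter> space M \<inter> F"
      by auto
    ultimately show "g -` A \<inter> space M \<inter> F \<in> sets M" by simp
  qed
qed (auto intro: loc_measurable_restrict)

lemma loc_measurable_add:
  assumes "loc_measurable M f" "loc_measurable M g"
  shows "loc_measurable M (\<lambda>x. f x + g x)"
  using assms unfolding loc_measurable_iff by (simp add: distrib_left borel_measurable_add)

lemma borel_loc_measurable: "f \<in> borel_measurable M \<Longrightarrow> loc_measurable M f"
  unfolding loc_measurable_iff by auto

lemma Linf_funs_add:
  assumes "f \<in> Linf_funs M" "g \<in> Linf_funs M"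
  shows "(\<lambda>x. f x + g x) \<in> Linf_funs M"
proof -
  obtain s t where "loc_AE M (\<lambda>x. cmod (f x) \<le> s)" "loc_AE M (\<lambda>x. cmod (g x) \<le> t)"
    using assms unfolding Linf_funs_def by blast
  then have "loc_AE M (\<lambda>x. cmod (f x) \<le> s \<and> cmod (g x) \<le> t)" by (rule loc_AE_conj)
  then have "loc_AE M (\<lambda>x. cmod (f x + g x) \<le> s + t)"
    by (rule loc_AE_mono) (auto intro: norm_triangle_mono)
  then show ?thesis using assms loc_measurable_add unfolding Linf_funs_def by blast
qed

lemma Linf_funs_cmult:
  assumes "f \<in> Linf_funs M"
  shows "(\<lambda>x. c * f x) \<in> Linf_funs M"
proof -
  obtain s where "loc_AE M (\<lambda>x. cmod (f x) \<le> s)"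
    using assms unfolding Linf_funs_def by blast
  then have "loc_AE M (\<lambda>x. cmod (c * f x) \<le> cmod c * s)"
    by (rule loc_AE_mono) (auto simp: norm_mult intro: mult_left_mono)
  then show ?thesis using assms loc_measurable_cmult unfolding Linf_funs_def by blast
qed

lemma Linf_funs_diff:
  assumes "f \<in> Linf_funs M" "g \<in> Linf_funs M"
  shows "(\<lambda>x. f x - g x) \<in> Linf_funs M"
  using Linf_funs_add[OF assms(1) Linf_funs_cmult[OF assms(2), of "-1"]] by simp

lemma Linf_funsE:
  assumes "g \<in> Linf_funs M"
  obtains t where "loc_measurable M g" "0 \<le> t" "loc_AE M (\<lambda>x. cmod (g x) \<le> t)"
proof -
  obtain s where "loc_measurable M g" "loc_AE M (\<lambda>x. cmod (g x) \<le> s)"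
    using assms unfolding Linf_funs_def by blast
  moreover from this(2) have "loc_AE M (\<lambda>x. cmod (g x) \<le> max s 0)"
    by (rule loc_AE_mono) simp
  ultimately show ?thesis using that[of "max s 0"] by simp
qed

lemma pairing_integrable:
  assumes "integrable M f" "g \<in> Linf_funs M"
  shows "integrable M (\<lambda>x. f x * cnj (g x))"
  using assms by (elim Linf_funsE) (rule pairing_bound(1))

lemma pairing_diff_left:
  assumes "integrable M f" "integrable M f'" "g \<in> Linf_funs M"
  shows "(\<integral>x. (f x - f' x) * cnj (g x) \<partial>M) = (pairing M f g) - (pairing M f' g)"
  using assms by (simp add: left_diff_distrib pairing_integrable)

lemma pairing_diff_right:
  assumes "integrable M f" "g \<in> Linf_funs M" "g' \<in> Linf_funs M"
  shows "(\<integral>x. f x * cnj (g x - g' x) \<partial>M) = (pairing M f g) - (pairing M f g')"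
  using assms by (simp add: right_diff_distrib pairing_integrable)

context haar_measure
begin

lemma Cc_approx:
  assumes "integrable lam f" "e > 0"
  obtains u where "u \<in> Cc" "integrable lam u" "L1_dist lam f u < e"
  using Cc_dense[OF assms(1)] assms(2) integrable_Cc by blast

lemma L1_norm_triangle:
  fixes f g :: "'a \<Rightarrow> complex"
  assumes "integrable lam f" "integrable lam g"
  shows "(\<integral>x. cmod (f x + g x) \<partial>lam) \<le> L1_norm lam f + L1_norm lam g"
proof -
  have "(\<integral>x. cmod (f x + g x) \<partial>lam) \<le> (\<integral>x. cmod (f x) + cmod (g x) \<partial>lam)"
    using assms by (intro integral_mono) (auto intro: norm_triangle_ineq)
  then show ?thesis using assms by simp
qed

lemma L1_norm_commute: "L1_dist lam f g = L1_dist lam g f"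
  by (simp add: norm_minus_commute)

lemma L1_norm_approx:
  fixes f u :: "'a \<Rightarrow> complex"
  assumes "integrable lam f" "integrable lam u"
  shows "L1_norm lam u \<le> L1_norm lam f + L1_dist lam f u"
  using L1_norm_triangle[of f "\<lambda>x. u x - f x"] assms L1_norm_commute[of u f] by simp

text \<open>Both sides of the estimate are continuous in \<open>f\<close> for the \<open>L1\<close>
  norm and \<open>Cc\<close> is dense. The reduction matters because averages are constructed for
  functions in \<open>Cc\<close>.\<close>

lemma loc_AE_le_of_Cc:
  assumes g: "g \<in> Linf_funs lam" and B: "0 \<le> B"
    and le: "\<And>f. f \<in> Cc \<Longrightarrow> cmod (pairing lam f g) \<le> B * L1_norm lam f"
  shows "loc_AE lam (\<lambda>x. cmod (g x) \<le> B)"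
proof (rule loc_AE_le_of_pairing[OF g B])
  fix f :: "'a \<Rightarrow> complex" assume f: "integrable lam f"
  obtain t where t: "loc_measurable lam g" "0 \<le> t" "loc_AE lam (\<lambda>x. cmod (g x) \<le> t)"
    by (rule Linf_funsE[OF g])
  show "cmod (pairing lam f g) \<le> B * L1_norm lam f"
  proof (rule le_epsilon_mult[where C="B + t"])
    fix e :: real assume "e > 0"
    then obtain u where u: "u \<in> Cc" "integrable lam u" "L1_dist lam f u < e"
      using Cc_approx[OF f] by metis
    have "cmod (pairing lam f g) \<le> cmod (pairing lam u g) + cmod (\<integral>x. (f x - u x) * cnj (g x) \<partial>lam)"
      unfolding pairing_diff_left[OF f u(2) g] using norm_triangle_sub by (metis add.commute)
    also have "cmod (\<integral>x. (f x - u x) * cnj (g x) \<partial>lam) \<le> t * L1_dist lam f u"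
      using f u by (intro pairing_bound(2) t) auto
    also have "\<dots> \<le> t * e" using u t by (intro mult_left_mono) auto
    also have "cmod (pairing lam u g) \<le> B * L1_norm lam u" by (rule le[OF u(1)])
    also have "\<dots> \<le> B * (L1_norm lam f + e)"
      using L1_norm_approx[OF f u(2)] u(3) B by (intro mult_left_mono) auto
    finally show "cmod (pairing lam f g) \<le> B * L1_norm lam f + (B + t) * e"
      by (simp add: algebra_simps)
  qed
qed

lemma loc_AE_eq_of_Cc:
  assumes g: "g \<in> Linf_funs lam" "g' \<in> Linf_funs lam"
    and eq: "\<And>f. f \<in> Cc \<Longrightarrow> (pairing lam f g) = pairing lam f g'"
  shows "loc_AE lam (\<lambda>x. g x = g' x)"
proof -
  have "loc_AE lam (\<lambda>x. cmod (g x - g' x) \<le> 0)"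
  proof (rule loc_AE_le_of_Cc)
    show "cmod (\<integral>x. f x * cnj (g x - g' x) \<partial>lam) \<le> 0 * L1_norm lam f" if "f \<in> Cc" for f
      unfolding pairing_diff_right[OF integrable_Cc[OF that] g] using eq[OF that] by simp
  qed (use Linf_funs_diff[OF g] in auto)
  then show ?thesis by (rule loc_AE_mono) simp
qed

text \<open>A compact set of positive measure is not locally null. Consequently essential bounds are
  nonnegative, and the infimum in the norm of \<open>Linf_space\<close> is taken over a set bounded
  below.\<close>

lemma loc_AE_False: "\<not> loc_AE lam (\<lambda>x. False)"
proof
  assume "loc_AE lam (\<lambda>x. False)"
  then have U: "UNIV \<in> loc_null_sets lam" by (auto simp: loc_AE_def top.extremum_unique)
  obtain K :: "'a set" where K: "compact K" "0 < emeasure lam K"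
    using inner_regular[OF open_UNIV emeasure_open_pos[OF open_UNIV UNIV_I]] by metis
  then have "UNIV \<inter> K \<in> null_sets lam"
    by (intro loc_null_setsD[OF U]) (auto simp: borel_compact emeasure_compact)
  with K show False by auto
qed

text \<open>The value at \<open>f\<close> is characterised by its distance to the values at all \<open>u\<close>.\<close>

lemma Cc_functional_extends:
  assumes add: "\<And>f g. f \<in> Cc \<Longrightarrow> g \<in> Cc \<Longrightarrow> \<Psi> (\<lambda>x. f x + g x) = \<Psi> f + \<Psi> g"
    and scale: "\<And>f c. f \<in> Cc \<Longrightarrow> \<Psi> (\<lambda>x. c * f x) = c * \<Psi> f"
    and bound: "\<And>f. f \<in> Cc \<Longrightarrow> cmod (\<Psi> f) \<le> B * L1_norm lam f"
    and B: "0 \<le> B"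
  shows "\<exists>\<Phi>. L1_functional lam \<Phi> B \<and> (\<forall>f\<in>Cc. \<Phi> f = \<Psi> f)"
proof -
  have diff: "\<Psi> (\<lambda>x. f x - g x) = \<Psi> f - \<Psi> g" if "f \<in> Cc" "g \<in> Cc" for f g
    using add[OF that(1) Cc_cmult[OF that(2), of "-1"]] scale[OF that(2), of "-1"] by simp
  have lip: "cmod (\<Psi> u - \<Psi> v) \<le> B * L1_dist lam f u + B * L1_dist lam f v"
    if "u \<in> Cc" "v \<in> Cc" "integrable lam f" for u v f
  proof -
    have [simp]: "integrable lam u" "integrable lam v" using that integrable_Cc by blast+
    have "cmod (\<Psi> u - \<Psi> v) \<le> B * L1_dist lam u v"
      using bound[OF Cc_diff[OF that(1,2)]] diff[OF that(1,2)] by simp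
    also have "\<dots> \<le> B * (L1_dist lam f u + L1_dist lam f v)"
      using L1_norm_triangle[of "\<lambda>x. u x - f x" "\<lambda>x. f x - v x"] that(3) L1_norm_commute[of u f] B
      by (intro mult_left_mono) auto
    finally show ?thesis by (simp add: distrib_left)
  qed
  have ex: "\<exists>z. \<forall>u\<in>Cc. cmod (\<Psi> u - z) \<le> B * L1_dist lam f u" if f: "integrable lam f" for f
  proof -
    have "\<exists>u. u \<in> Cc \<and> (L1_dist lam f u) < inverse (real (Suc n))" for n
      using Cc_approx[OF f, of "inverse (real (Suc n))"] by (metis inverse_positive_iff_positive of_nat_0_less_iff zero_less_Suc)
    then obtain s where s: "\<And>n. s n \<in> Cc" "\<And>n. (\<integral>x. cmod (f x - s n x) \<partial>lam) < inverse (real (Suc n))"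
      by metis
    have lim0: "(\<lambda>n. \<integral>x. cmod (f x - s n x) \<partial>lam) \<longlonglongrightarrow> 0"
      by (rule tendsto_sandwich[OF _ _ tendsto_const LIMSEQ_inverse_real_of_nat])
        (use s(2) in \<open>auto intro!: always_eventually less_imp_le\<close>)
    have "Cauchy (\<lambda>n. \<Psi> (s n))"
    proof (rule metric_CauchyI)
      fix e :: real assume e: "e > 0"
      have "(\<lambda>n. B * (\<integral>x. cmod (f x - s n x) \<partial>lam)) \<longlonglongrightarrow> 0"
        using lim0 by (rule tendsto_mult_right_zero)
      then have "\<forall>\<^sub>F n in sequentially. B * (\<integral>x. cmod (f x - s n x) \<partial>lam) < e / 2"
        using e by (intro order_tendstoD) auto
      then obtain N where N: "\<And>n. n \<ge> N \<Longrightarrow> B * (\<integral>x. cmod (f x - s n x) \<partial>lam) < e / 2"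
        unfolding eventually_sequentially by blast
      have "dist (\<Psi> (s i)) (\<Psi> (s j)) < e" if "i \<ge> N" "j \<ge> N" for i j
        using lip[OF s(1) s(1) f, of i j] N[OF that(1)] N[OF that(2)] unfolding dist_norm by linarith
      then show "\<exists>N. \<forall>i\<ge>N. \<forall>j\<ge>N. dist (\<Psi> (s i)) (\<Psi> (s j)) < e" by blast
    qed
    then obtain z where z: "(\<lambda>n. \<Psi> (s n)) \<longlonglongrightarrow> z"
      using Cauchy_convergent convergent_def by blast
    have "cmod (\<Psi> u - z) \<le> B * L1_dist lam f u" if u: "u \<in> Cc" for u
    proof (rule LIMSEQ_le)
      show "(\<lambda>n. cmod (\<Psi> u - \<Psi> (s n))) \<longlonglongrightarrow> cmod (\<Psi> u - z)"
        by (intro tendsto_intros z)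
      show "(\<lambda>n. B * L1_dist lam f u + B * (\<integral>x. cmod (f x - s n x) \<partial>lam)) \<longlonglongrightarrow> B * L1_dist lam f u"
        using tendsto_add[OF tendsto_const tendsto_mult_right_zero[OF lim0, of B]] by simp
      show "\<exists>N. \<forall>n\<ge>N. cmod (\<Psi> u - \<Psi> (s n)) \<le> B * L1_dist lam f u + B * (\<integral>x. cmod (f x - s n x) \<partial>lam)"
        using lip[OF u s(1) f] by blast
    qed
    then show ?thesis by blast
  qed
  define \<Phi> where "\<Phi> f = (SOME z. \<forall>u\<in>Cc. cmod (\<Psi> u - z) \<le> B * L1_dist lam f u)" for f
  have \<Phi>: "cmod (\<Psi> u - \<Phi> f) \<le> B * L1_dist lam f u" if "integrable lam f" "u \<in> Cc" for u f
    using someI_ex[OF ex[OF that(1)]] that(2) unfolding \<Phi>_def by blast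
  have near: "cmod (\<Psi> u - \<Phi> f) \<le> B * e" if "integrable lam f" "u \<in> Cc" "L1_dist lam f u \<le> e" for u f e
    using \<Phi>[OF that(1,2)] mult_left_mono[OF that(3) B] by linarith
  have linear: "\<Phi> (\<lambda>x. c * f x + g x) = c * \<Phi> f + \<Phi> g"
    if f: "integrable lam f" and g: "integrable lam g" for f g c
  proof -
    \<comment> \<open>The combination of \<open>u\<close> and \<open>v\<close> is accurate to
      \<open>(cmod c + 1) * e\<close>. \<open>B\<close> times this error occurs twice: once for the
      combination and once for the two functions taken separately.\<close>
    have "cmod (\<Phi> (\<lambda>x. c * f x + g x) - (c * \<Phi> f + \<Phi> g)) \<le> 0"
    proof (rule le_epsilon_mult[where C="2 * (cmod c + 1) * B"])
      fix e :: real assume e: "e > 0"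
      obtain u where u: "u \<in> Cc" "integrable lam u" "L1_dist lam f u < e" using Cc_approx[OF f e] by metis
      obtain v where v: "v \<in> Cc" "integrable lam v" "L1_dist lam g v < e" using Cc_approx[OF g e] by metis
      have "(\<integral>x. cmod ((c * f x + g x) - (c * u x + v x)) \<partial>lam) \<le>
          (\<integral>x. cmod (c * f x - c * u x) \<partial>lam) + L1_dist lam g v"
        using L1_norm_triangle[of "\<lambda>x. c * f x - c * u x" "\<lambda>x. g x - v x"] f g u v by (simp add: add_diff_add)
      also have "(\<integral>x. cmod (c * f x - c * u x) \<partial>lam) = cmod c * L1_dist lam f u"
        by (simp flip: right_diff_distrib add: norm_mult)
      also have "\<dots> \<le> cmod c * e" using u by (intro mult_left_mono) auto
      also have "cmod c * e + L1_dist lam g v \<le> (cmod c + 1) * e" using v by (simp add: distrib_right)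
      finally have "cmod (\<Psi> (\<lambda>x. c * u x + v x) - \<Phi> (\<lambda>x. c * f x + g x)) \<le> B * ((cmod c + 1) * e)"
        using f g by (intro near Cc_add Cc_cmult u v) auto
      then have 1: "cmod (c * \<Psi> u + \<Psi> v - \<Phi> (\<lambda>x. c * f x + g x)) \<le> B * ((cmod c + 1) * e)"
        by (simp add: add[OF Cc_cmult[OF u(1)] v(1)] scale[OF u(1)])
      have "cmod (\<Psi> u - \<Phi> f) \<le> B * e" and 2: "cmod (\<Psi> v - \<Phi> g) \<le> B * e"
        using near[OF f u(1)] near[OF g v(1)] u v by auto
      then have 3: "cmod (c * (\<Psi> u - \<Phi> f)) \<le> cmod c * (B * e)" by (simp add: norm_mult mult_left_mono)
      have "\<Phi> (\<lambda>x. c * f x + g x) - (c * \<Phi> f + \<Phi> g) =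
          c * (\<Psi> u - \<Phi> f) + (\<Psi> v - \<Phi> g) - (c * \<Psi> u + \<Psi> v - \<Phi> (\<lambda>x. c * f x + g x))"
        by (simp add: algebra_simps)
      also have "cmod \<dots> \<le> cmod c * (B * e) + B * e + B * ((cmod c + 1) * e)"
        by (intro order_trans[OF norm_triangle_ineq4] order_trans[OF norm_triangle_ineq] add_mono 1 2 3)
      finally show "cmod (\<Phi> (\<lambda>x. c * f x + g x) - (c * \<Phi> f + \<Phi> g)) \<le> 0 + 2 * (cmod c + 1) * B * e"
        by (simp add: algebra_simps)
    qed
    then show ?thesis by simp
  qed
  have \<Phi>_Cc: "\<Phi> f = \<Psi> f" if "f \<in> Cc" for f
    using \<Phi>[OF integrable_Cc[OF that] that] by simp
  have zero: "(\<lambda>x. 0) \<in> Cc" by (rule CcI[of _ "{}"]) auto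
  have \<Phi>_zero: "\<Phi> (\<lambda>x. 0) = 0" using \<Phi>_Cc[OF zero] bound[OF zero] by simp
  have "L1_functional lam \<Phi> B"
  proof
    fix f g :: "'a \<Rightarrow> complex" assume f: "integrable lam f"
    show "\<Phi> (\<lambda>x. f x + g x) = \<Phi> f + \<Phi> g" if "integrable lam g"
      using linear[OF f that, of 1] by simp
    show "\<Phi> (\<lambda>x. c * f x) = c * \<Phi> f" for c
      using linear[OF f integrable_zero, of c] \<Phi>_zero by simp
  next
    fix f :: "'a \<Rightarrow> complex" assume f: "integrable lam f"
    show "cmod (\<Phi> f) \<le> B * L1_norm lam f"
    proof (rule le_epsilon_mult[where C="2 * B"])
      fix e :: real assume e: "e > 0"
      obtain u where u: "u \<in> Cc" "integrable lam u" "L1_dist lam f u < e" using Cc_approx[OF f e] by metis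
      have "cmod (\<Phi> f) \<le> cmod (\<Psi> u) + cmod (\<Psi> u - \<Phi> f)"
        using norm_triangle_ineq4[of "\<Psi> u" "\<Psi> u - \<Phi> f"] by simp
      also have "cmod (\<Psi> u - \<Phi> f) \<le> B * e" using near[OF f u(1)] u by auto
      also have "cmod (\<Psi> u) \<le> B * L1_norm lam u" by (rule bound[OF u(1)])
      also have "\<dots> \<le> B * (L1_norm lam f + e)"
        using L1_norm_approx[OF f u(2)] u(3) B by (intro mult_left_mono) auto
      finally show "cmod (\<Phi> f) \<le> B * L1_norm lam f + 2 * B * e"
        by (simp add: algebra_simps)
    qed
  qed (rule B)
  then show ?thesis using \<Phi>_Cc by blast
qed

end

section \<open>The averaging projection\<close>

context haar_character
begin

text \<open>The choice loses nothing: the hull determines the pairings of its covariant limits, and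
  by \<open>average_unique\<close> these determine the function.\<close>

definition average :: "('a \<Rightarrow> complex) \<Rightarrow> 'a \<Rightarrow> complex" where
  "average f = (SOME \<psi>. \<psi> \<in> covariant \<and> (\<forall>e>0. \<exists>u\<in>twist_hull f. (L1_dist lam u \<psi>) < e))"

definition covariant_Linf :: "('a \<Rightarrow> complex) set" where
  "covariant_Linf = {g \<in> Linf_funs lam. \<forall>h\<in>H. loc_AE lam (\<lambda>x. g (x + h) = \<xi> h * g x)}"

lemma covariant_Cc: "\<psi> \<in> covariant \<Longrightarrow> \<psi> \<in> Cc"
  by (simp add: covariant_def)

lemma covariant_integrable: "\<psi> \<in> covariant \<Longrightarrow> integrable lam \<psi>"
  by (intro integrable_Cc covariant_Cc)

lemma covariant_add: "\<psi> \<in> covariant \<Longrightarrow> \<theta> \<in> covariant \<Longrightarrow> (\<lambda>x. \<psi> x + \<theta> x) \<in> covariant"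
  by (auto simp: covariant_def distrib_left intro: Cc_add)

lemma covariant_cmult: "\<psi> \<in> covariant \<Longrightarrow> (\<lambda>x. c * \<psi> x) \<in> covariant"
  by (auto simp: covariant_def intro: Cc_cmult)

lemma covariant_diff: "\<psi> \<in> covariant \<Longrightarrow> \<theta> \<in> covariant \<Longrightarrow> (\<lambda>x. \<psi> x - \<theta> x) \<in> covariant"
  by (auto simp: covariant_def right_diff_distrib intro: Cc_diff)

lemma Cc_Linf:
  assumes "f \<in> Cc"
  shows "f \<in> Linf_funs lam"
proof -
  obtain B where "\<And>x. cmod (f x) \<le> B" using Cc_bounded[OF assms] by metis
  then have "loc_AE lam (\<lambda>x. cmod (f x) \<le> B)" by (intro loc_AE_I)
  moreover have "loc_measurable lam f"
    using Cc_borel[OF assms] by (intro borel_loc_measurable) (simp add: borel_measurable_lam)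
  ultimately show ?thesis unfolding Linf_funs_def by blast
qed

lemma covariant_subset_Linf: "\<psi> \<in> covariant \<Longrightarrow> \<psi> \<in> covariant_Linf"
proof -
  assume \<psi>: "\<psi> \<in> covariant"
  then have "loc_AE lam (\<lambda>x. \<psi> (x + h) = \<xi> h * \<psi> x)" if "h \<in> H" for h
    using that by (intro loc_AE_I) (simp add: covariant_def)
  then show ?thesis
    unfolding covariant_Linf_def using Cc_Linf[OF covariant_Cc[OF \<psi>]] by blast
qed

lemma average:
  assumes "f \<in> Cc"
  shows average_covariant: "average f \<in> covariant"
    and average_approx: "e > 0 \<Longrightarrow> \<exists>u\<in>twist_hull f. (L1_dist lam u (average f)) < e"
proof -
  have "\<exists>\<psi>. \<psi> \<in> covariant \<and> (\<forall>e>0. \<exists>u\<in>twist_hull f. (L1_dist lam u \<psi>) < e)"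
    using ex_average[OF assms] by blast
  from someI_ex[OF this] show "average f \<in> covariant"
    "e > 0 \<Longrightarrow> \<exists>u\<in>twist_hull f. (L1_dist lam u (average f)) < e"
    unfolding average_def[symmetric] by blast+
qed

lemma average_norm:
  assumes f: "f \<in> Cc"
  shows "L1_norm lam (average f) \<le> L1_norm lam f"
proof (rule le_epsilon_mult[where C=1])
  fix e :: real assume "e > 0"
  then obtain u where u: "u \<in> twist_hull f" "L1_dist lam u (average f) < e"
    using average_approx[OF f] by blast
  have "L1_norm lam (average f) \<le> L1_norm lam u + L1_dist lam u (average f)"
    by (intro L1_norm_approx integrable_Cc hull_Cc[OF u(1) f] covariant_integrable average_covariant f)
  then show "L1_norm lam (average f) \<le> L1_norm lam f + 1 * e"
    using hull_L1_norm[OF u(1) f] u(2) by linarith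
qed

text \<open>Every member of the hull pairs with \<open>g\<close> as \<open>f\<close> does, by
  \<open>hull_pairing\<close>, and pairing with \<open>g\<close> is continuous in the
  \<open>L1\<close> norm.\<close>

lemma average_pairing:
  assumes f: "f \<in> Cc" and g: "g \<in> covariant_Linf"
  shows "pairing lam (average f) g = pairing lam f g"
proof -
  have g': "g \<in> Linf_funs lam" "\<And>h. h \<in> H \<Longrightarrow> loc_AE lam (\<lambda>x. g (x + h) = \<xi> h * g x)"
    using g by (auto simp: covariant_Linf_def)
  obtain t where t: "loc_measurable lam g" "0 \<le> t" "loc_AE lam (\<lambda>x. cmod (g x) \<le> t)"
    by (rule Linf_funsE[OF g'(1)])
  have "cmod ((pairing lam f g) - (pairing lam (average f) g)) \<le> 0"
  proof (rule le_epsilon_mult[where C=t])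
    fix e :: real assume "e > 0"
    then obtain u where u: "u \<in> twist_hull f" "L1_dist lam u (average f) < e"
      using average_approx[OF f] by blast
    have i: "integrable lam u" "integrable lam (average f)"
      using integrable_Cc[OF hull_Cc[OF u(1) f]] covariant_integrable[OF average_covariant[OF f]] by blast+
    have "(pairing lam f g) - (pairing lam (average f) g) = (\<integral>x. (u x - average f x) * cnj (g x) \<partial>lam)"
      using pairing_diff_left[OF i g'(1)] hull_pairing[OF u(1) f g'] by simp
    also have "cmod \<dots> \<le> t * L1_dist lam u (average f)"
      using i by (intro pairing_bound(2) t) auto
    also have "\<dots> \<le> t * e" using u t by (intro mult_left_mono) auto
    finally show "cmod ((pairing lam f g) - (pairing lam (average f) g)) \<le> 0 + t * e" by simp
  qed
  then show ?thesis by simp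
qed

text \<open>The difference of two candidates is covariant, so pairing it with itself gives squared
  \<open>L2\<close> norm 0, and continuity makes it vanish everywhere. Linearity, invariance under
  twists and idempotence of \<open>average\<close> are all instances.\<close>

lemma average_unique:
  assumes f: "f \<in> Cc" and \<psi>: "\<psi> \<in> covariant"
    and eq: "\<And>\<theta>. \<theta> \<in> covariant \<Longrightarrow> (pairing lam \<psi> \<theta>) = pairing lam f \<theta>"
  shows "average f = \<psi>"
proof (rule ccontr)
  assume "average f \<noteq> \<psi>"
  then obtain y where y: "average f y \<noteq> \<psi> y" by blast
  define \<theta> where "\<theta> x = average f x - \<psi> x" for x
  have \<theta>: "\<theta> \<in> covariant" unfolding \<theta>_def by (intro covariant_diff average_covariant f \<psi>)
  have "pairing lam \<theta> \<theta> = 0"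
    using pairing_diff_left[OF covariant_integrable[OF average_covariant[OF f]] covariant_integrable[OF \<psi>] Cc_Linf[OF covariant_Cc[OF \<theta>]]]
      eq[OF \<theta>] average_pairing[OF f covariant_subset_Linf[OF \<theta>]] by (simp add: \<theta>_def)
  moreover have "(\<lambda>x. \<theta> x * cnj (\<theta> x)) = (\<lambda>x. of_real ((cmod (\<theta> x))\<^sup>2))"
    by (rule ext) (rule complex_norm_square[symmetric])
  ultimately have "(\<integral>x. (cmod (\<theta> x))\<^sup>2 \<partial>lam) = 0"
    by (simp only: integral_complex_of_real of_real_eq_0_iff)
  moreover have "(\<integral>x. (cmod (\<theta> x))\<^sup>2 \<partial>lam) > 0"
    using y by (intro integral_Cc_pos[of _ y] square_Cc covariant_Cc \<theta>) (auto simp: \<theta>_def)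
  ultimately show False by simp
qed

lemma average_add:
  assumes "f \<in> Cc" "g \<in> Cc"
  shows "average (\<lambda>x. f x + g x) = (\<lambda>x. average f x + average g x)"
proof (rule average_unique)
  fix \<theta> assume \<theta>: "\<theta> \<in> covariant"
  note i = pairing_integrable[OF integrable_Cc Cc_Linf[OF covariant_Cc[OF \<theta>]]]
  show "(\<integral>x. (average f x + average g x) * cnj (\<theta> x) \<partial>lam) = (\<integral>x. (f x + g x) * cnj (\<theta> x) \<partial>lam)"
    using average_pairing[OF assms(1) covariant_subset_Linf[OF \<theta>]] average_pairing[OF assms(2) covariant_subset_Linf[OF \<theta>]]
    by (simp add: distrib_right i assms covariant_Cc average_covariant)
qed (intro Cc_add covariant_add average_covariant assms)+

lemma average_cmult:
  assumes "f \<in> Cc"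
  shows "average (\<lambda>x. c * f x) = (\<lambda>x. c * average f x)"
proof (rule average_unique)
  fix \<theta> assume \<theta>: "\<theta> \<in> covariant"
  show "(\<integral>x. c * average f x * cnj (\<theta> x) \<partial>lam) = (\<integral>x. c * f x * cnj (\<theta> x) \<partial>lam)"
    using average_pairing[OF assms(1) covariant_subset_Linf[OF \<theta>]]
    by (simp add: mult.assoc)
qed (intro Cc_cmult covariant_cmult average_covariant assms)+

text \<open>The source of covariance for the representing function in \<open>T_surj\<close>.\<close>

lemma average_twist:
  assumes "f \<in> Cc" "h \<in> H"
  shows "average (twist h f) = average f"
proof (rule average_unique)
  fix \<theta> assume \<theta>: "\<theta> \<in> covariant"
  then have \<theta>': "\<theta> \<in> covariant_Linf" by (rule covariant_subset_Linf)
  then have "(\<integral>x. twist h f x * cnj (\<theta> x) \<partial>lam) = pairing lam f \<theta>"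
    using assms by (intro pairing_twist) (auto simp: covariant_Linf_def Linf_funs_def)
  then show "pairing lam (average f) \<theta> = (\<integral>x. twist h f x * cnj (\<theta> x) \<partial>lam)"
    using average_pairing[OF assms(1) \<theta>'] by simp
qed (intro twist_Cc average_covariant assms)+

lemma average_covariant_id: "\<psi> \<in> covariant \<Longrightarrow> average \<psi> = \<psi>"
  by (intro average_unique covariant_Cc) auto

end

section \<open>The spaces of classes\<close>

lemma quotient_class_eq: "equiv V E \<Longrightarrow> f \<in> V \<Longrightarrow> g \<in> V \<Longrightarrow> E `` {f} = E `` {g} \<longleftrightarrow> (f, g) \<in> E"
  by (rule eq_equiv_class_iff)

text \<open>The union over all pairs of representatives in \<open>quotient_space\<close> collapses
  because every pair contributes the same class.\<close>

lemma quotient_vadd: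
  assumes E: "equiv V E" and f: "f \<in> V" "g \<in> V"
    and compat: "\<And>f f' g g'. (f, f') \<in> E \<Longrightarrow> (g, g') \<in> E \<Longrightarrow> ((\<lambda>x. f x + g x), (\<lambda>x. f' x + g' x)) \<in> E"
  shows "vadd (quotient_space V E p) (E `` {f}) (E `` {g}) = E `` {\<lambda>x. f x + g x}"
proof -
  have "E `` {\<lambda>x. f' x + g' x} = E `` {\<lambda>x. f x + g x}" if "f' \<in> E `` {f}" "g' \<in> E `` {g}" for f' g'
    using equiv_class_eq[OF E compat[of f f' g g']] that by simp
  moreover have "f \<in> E `` {f}" "g \<in> E `` {g}" using equiv_class_self[OF E] f by auto
  ultimately have "(\<Union>f'\<in>E `` {f}. \<Union>g'\<in>E `` {g}. E `` {\<lambda>x. f' x + g' x}) = E `` {\<lambda>x. f x + g x}"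
    by blast
  then show ?thesis by (simp add: quotient_space_def)
qed

lemma quotient_vscale:
  assumes E: "equiv V E" and f: "f \<in> V"
    and compat: "\<And>f f'. (f, f') \<in> E \<Longrightarrow> ((\<lambda>x. c * f x), (\<lambda>x. c * f' x)) \<in> E"
  shows "vscale (quotient_space V E p) c (E `` {f}) = E `` {\<lambda>x. c * f x}"
proof -
  have "E `` {\<lambda>x. c * f' x} = E `` {\<lambda>x. c * f x}" if "f' \<in> E `` {f}" for f'
    using equiv_class_eq[OF E compat[of f f']] that by simp
  moreover have "f \<in> E `` {f}" using equiv_class_self[OF E] f by auto
  ultimately have "(\<Union>f'\<in>E `` {f}. E `` {\<lambda>x. c * f' x}) = E `` {\<lambda>x. c * f x}"
    by blast
  then show ?thesis by (simp add: quotient_space_def)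
qed

lemma quotient_vnorm:
  assumes E: "equiv V E" and f: "f \<in> V" and compat: "\<And>f'. (f, f') \<in> E \<Longrightarrow> p f' = p f"
  shows "vnorm (quotient_space V E p) (E `` {f}) = p f"
proof -
  have "f \<in> E `` {f}" using equiv_class_self[OF E] f by auto
  moreover have "p f' = p f" if "f' \<in> E `` {f}" for f' using compat that by (simp only: Image_singleton_iff)
  then have "p ` (E `` {f}) = (\<lambda>_. p f) ` (E `` {f})" by (rule image_cong[OF refl])
  ultimately have "p ` (E `` {f}) = {p f}" by (auto simp only: image_constant)
  then show ?thesis by (simp add: quotient_space_def)
qed

lemma equiv_L1: "equiv {f. integrable M f} (L1_rel M)"
  by (rule equivI) (auto simp: L1_rel_def refl_on_def sym_def trans_def elim: eventually_mono
      dest: eventually_conj intro: eventually_mono)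

lemma equiv_Linf: "equiv (Linf_funs M) (Linf_rel M)"
proof (rule equivI)
  show "Linf_rel M \<subseteq> Linf_funs M \<times> Linf_funs M" by (auto simp: Linf_rel_def)
  show "refl_on (Linf_funs M) (Linf_rel M)"
    by (rule refl_onI) (simp add: Linf_rel_def loc_AE_I)
  show "sym (Linf_rel M)"
    by (rule symI) (auto simp: Linf_rel_def elim: loc_AE_mono)
  show "trans (Linf_rel M)"
  proof (rule transI)
    fix f g h assume "(f, g) \<in> Linf_rel M" "(g, h) \<in> Linf_rel M"
    then have *: "f \<in> Linf_funs M" "h \<in> Linf_funs M" "loc_AE M (\<lambda>x. f x = g x)" "loc_AE M (\<lambda>x. g x = h x)"
      by (auto simp: Linf_rel_def)
    from loc_AE_conj[OF *(3,4)] have "loc_AE M (\<lambda>x. f x = h x)" by (rule loc_AE_mono) simp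
    with * show "(f, h) \<in> Linf_rel M" by (simp add: Linf_rel_def)
  qed
qed

abbreviation L1_class :: "'a measure \<Rightarrow> ('a \<Rightarrow> complex) \<Rightarrow> ('a \<Rightarrow> complex) set" where
  "L1_class M f \<equiv> L1_rel M `` {f}"

abbreviation Linf_class :: "'a measure \<Rightarrow> ('a \<Rightarrow> complex) \<Rightarrow> ('a \<Rightarrow> complex) set" where
  "Linf_class M f \<equiv> Linf_rel M `` {f}"

lemma L1_vadd:
  assumes "integrable M f" "integrable M g"
  shows "vadd (L1_space M) (L1_class M f) (L1_class M g) = L1_class M (\<lambda>x. f x + g x)"
  unfolding L1_space_def
proof (rule quotient_vadd[OF equiv_L1])
  fix f f' g g' assume "(f, f') \<in> L1_rel M" "(g, g') \<in> L1_rel M"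
  then show "((\<lambda>x. f x + g x), (\<lambda>x. f' x + g' x)) \<in> L1_rel M"
    by (auto simp: L1_rel_def elim: eventually_elim2)
qed (use assms in auto)

lemma L1_vscale:
  assumes "integrable M f"
  shows "vscale (L1_space M) c (L1_class M f) = L1_class M (\<lambda>x. c * f x)"
  unfolding L1_space_def
proof (rule quotient_vscale[OF equiv_L1])
  fix f f' assume "(f, f') \<in> L1_rel M"
  then show "((\<lambda>x. c * f x), (\<lambda>x. c * f' x)) \<in> L1_rel M"
    by (auto simp: L1_rel_def elim: eventually_mono)
qed (use assms in auto)

lemma L1_vnorm:
  assumes "integrable M f"
  shows "vnorm (L1_space M) (L1_class M f) = L1_norm M f"
  unfolding L1_space_def
proof (rule quotient_vnorm[OF equiv_L1])
  fix f' assume "(f, f') \<in> L1_rel M"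
  then show "L1_norm M f' = L1_norm M f"
    by (intro integral_cong_AE) (auto simp: L1_rel_def elim: eventually_mono)
qed (use assms in auto)

lemma L1_carrier: "vcarrier (L1_space M) = L1_class M ` {f. integrable M f}"
  by (auto simp: L1_space_def quotient_space_def quotient_def)

lemma Linf_vadd:
  assumes "f \<in> Linf_funs M" "g \<in> Linf_funs M"
  shows "vadd (Linf_space M) (Linf_class M f) (Linf_class M g) = Linf_class M (\<lambda>x. f x + g x)"
  unfolding Linf_space_def
proof (rule quotient_vadd[OF equiv_Linf assms])
  fix f f' g g' assume *: "(f, f') \<in> Linf_rel M" "(g, g') \<in> Linf_rel M"
  then have "loc_AE M (\<lambda>x. f x = f' x \<and> g x = g' x)"
    by (intro loc_AE_conj) (auto simp: Linf_rel_def)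
  then have "loc_AE M (\<lambda>x. f x + g x = f' x + g' x)" by (rule loc_AE_mono) simp
  with * show "((\<lambda>x. f x + g x), (\<lambda>x. f' x + g' x)) \<in> Linf_rel M"
    by (simp add: Linf_rel_def Linf_funs_add)
qed

lemma Linf_vscale:
  assumes "f \<in> Linf_funs M"
  shows "vscale (Linf_space M) c (Linf_class M f) = Linf_class M (\<lambda>x. c * f x)"
  unfolding Linf_space_def
proof (rule quotient_vscale[OF equiv_Linf assms])
  fix f f' assume *: "(f, f') \<in> Linf_rel M"
  then have "loc_AE M (\<lambda>x. f x = f' x)" by (simp add: Linf_rel_def)
  then have "loc_AE M (\<lambda>x. c * f x = c * f' x)" by (rule loc_AE_mono) simp
  with * show "((\<lambda>x. c * f x), (\<lambda>x. c * f' x)) \<in> Linf_rel M"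
    by (simp add: Linf_rel_def Linf_funs_cmult)
qed

lemma Linf_vnorm:
  assumes "f \<in> Linf_funs M"
  shows "vnorm (Linf_space M) (Linf_class M f) = Inf {t. loc_AE M (\<lambda>x. cmod (f x) \<le> t)}"
  unfolding Linf_space_def
proof (rule quotient_vnorm[OF equiv_Linf assms])
  fix f' assume "(f, f') \<in> Linf_rel M"
  then have eq: "loc_AE M (\<lambda>x. f x = f' x)" by (simp add: Linf_rel_def)
  have "loc_AE M (\<lambda>x. cmod (f' x) \<le> t) \<longleftrightarrow> loc_AE M (\<lambda>x. cmod (f x) \<le> t)" for t
  proof
    assume "loc_AE M (\<lambda>x. cmod (f' x) \<le> t)"
    from loc_AE_conj[OF eq this] show "loc_AE M (\<lambda>x. cmod (f x) \<le> t)" by (rule loc_AE_mono) auto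
  next
    assume "loc_AE M (\<lambda>x. cmod (f x) \<le> t)"
    from loc_AE_conj[OF eq this] show "loc_AE M (\<lambda>x. cmod (f' x) \<le> t)" by (rule loc_AE_mono) auto
  qed
  then show "Inf {t. loc_AE M (\<lambda>x. cmod (f' x) \<le> t)} = Inf {t. loc_AE M (\<lambda>x. cmod (f x) \<le> t)}"
    by simp
qed

text \<open>The set inside \<open>the_elem\<close> is a singleton: changing \<open>f\<close> on a
  null set or \<open>g\<close> on a locally null set leaves the integral alone, since an integrable
  function does not see locally null sets.\<close>

lemma pairing_functional_class:
  assumes f: "integrable M f" "L1_class M f \<in> vcarrier X" and g: "g \<in> Linf_funs M"
  shows "pairing_functional M X (Linf_class M g) (L1_class M f) = pairing M f g"
proof -
  have self: "f \<in> L1_class M f" "g \<in> Linf_class M g"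
    using equiv_class_self[OF equiv_L1] equiv_class_self[OF equiv_Linf] f g by blast+
  have "pairing M f' g' = pairing M f g"
    if "f' \<in> L1_class M f" "g' \<in> Linf_class M g" for f' g'
  proof -
    have f': "integrable M f'" "AE x in M. f x = f' x" using that by (auto simp: L1_rel_def)
    have g': "g' \<in> Linf_funs M" "loc_AE M (\<lambda>x. g x = g' x)" using that by (auto simp: Linf_rel_def)
    have meas: "loc_measurable M g" "loc_measurable M g'" using g g' by (auto simp: Linf_funs_def)
    have "pairing M f g = pairing M f g'"
      by (rule pairing_cong[OF f(1) meas g'(2)])
    also have "\<dots> = pairing M f' g'"
      using f' by (intro integral_cong_AE borel_measurable_pairing f meas) (auto elim: eventually_mono)
    finally show ?thesis ..
  qed
  then have "{(pairing M f' g') |f' g'. f' \<in> L1_class M f \<and> g' \<in> Linf_class M g} = {pairing M f g}"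
    using self by blast
  then show ?thesis using f(2) by (simp add: pairing_functional_def)
qed

section \<open>The covariant spaces and the isometry\<close>

context haar_character
begin

text \<open>The canonical map is open, so finitely many images of relatively compact open sets cover
  the compact image of the support. The support then lies in the sum of a compact set and
  \<open>H\<close>, which is compact because \<open>H\<close> is.\<close>

lemma M_xi_eq_covariant: "M_xi H \<xi> = covariant"
proof -
  have iff: "\<psi> \<in> Cc_rel H \<longleftrightarrow> \<psi> \<in> Cc" if cont: "continuous_on UNIV \<psi>" for \<psi> :: "'a \<Rightarrow> complex"
  proof
    assume "\<psi> \<in> Cc"
    then obtain K where K: "compact K" "\<And>x. x \<notin> K \<Longrightarrow> \<psi> x = 0" by (rule CcE) (rule that)
    have "closure {x. \<psi> x \<noteq> 0} \<subseteq> K"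
      using K by (intro closure_minimal compact_imp_closed) auto
    then have "compact (closure {x. \<psi> x \<noteq> 0})"
      using K(1) by (metis closed_closure compact_Int_closed inf.absorb2)
    then have "compactin (coset_topology H) (left_coset H ` closure {x. \<psi> x \<noteq> 0})"
      by (intro image_compactin[of euclidean] quotient_imp_continuous_map quotient_map_left_coset) simp
    then show "\<psi> \<in> Cc_rel H" using cont by (simp add: Cc_rel_def)
  next
    assume "\<psi> \<in> Cc_rel H"
    define S where "S = closure {x. \<psi> x \<noteq> 0}"
    have S: "compactin (coset_topology H) (left_coset H ` S)" using \<open>\<psi> \<in> Cc_rel H\<close> by (simp add: Cc_rel_def S_def)
    have "\<forall>x::'a. \<exists>U C. open U \<and> compact C \<and> x \<in> U \<and> U \<subseteq> C"
      by (meson locally_compactE[OF lc])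
    then obtain U C where UC: "\<And>x. open (U x) \<and> compact (C x) \<and> x \<in> U x \<and> U x \<subseteq> (C x :: 'a set)" by metis
    have in_coset: "y \<in> (\<lambda>(x, y). x + y) ` (A \<times> H)" if y: "left_coset H y \<in> left_coset H ` A" for y A
    proof -
      obtain a where a: "a \<in> A" "left_coset H y = left_coset H a" using y by blast
      have "y \<in> left_coset H y"
        unfolding left_coset_def by (rule image_eqI[of _ _ 0]) (simp_all add: zero_in_H)
      then have "y \<in> (\<lambda>h. a + h) ` H" using a(2) by (simp only: left_coset_def)
      then obtain h where h: "y = a + h" "h \<in> H" by (rule imageE)
      show ?thesis unfolding h(1) using a(1) h(2) by (intro image_eqI[of _ _ "(a, h)"]) simp_all
    qed
    have coset_plus: "left_coset H (u + h) = left_coset H u" if h: "h \<in> H" for u h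
    proof
      show "left_coset H (u + h) \<subseteq> left_coset H u"
        using h plus_in_H by (auto simp: left_coset_def add.assoc)
      show "left_coset H u \<subseteq> left_coset H (u + h)"
      proof
        fix z assume "z \<in> left_coset H u"
        then obtain k where k: "k \<in> H" "z = u + k" by (auto simp: left_coset_def)
        then show "z \<in> left_coset H (u + h)"
          unfolding left_coset_def using h
          by (intro image_eqI[of _ _ "- h + k"]) (auto simp: add.assoc[symmetric] intro: plus_in_H minus_in_H)
      qed
    qed
    \<comment> \<open>Openness of the canonical map: the saturation of \<open>U x\<close> is a union
      of right translates.\<close>
    have op: "openin (coset_topology H) (left_coset H ` U x)" for x
    proof -
      have "left_coset H -` (left_coset H ` U x) = (\<Union>h\<in>H. (\<lambda>y. y + h) ` U x)"
      proof (intro set_eqI iffI)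
        fix y assume "y \<in> left_coset H -` (left_coset H ` U x)"
        then have "y \<in> (\<lambda>(x, y). x + y) ` (U x \<times> H)" by (intro in_coset) simp
        then show "y \<in> (\<Union>h\<in>H. (\<lambda>y. y + h) ` U x)" by auto
      next
        fix y assume "y \<in> (\<Union>h\<in>H. (\<lambda>y. y + h) ` U x)"
        then obtain h u where "h \<in> H" "u \<in> U x" "y = u + h" by blast
        then show "y \<in> left_coset H -` (left_coset H ` U x)" using coset_plus by simp
      qed
      moreover have "open ((\<lambda>y. y + h) ` U x)" for h
        unfolding image_plus_right using UC by (intro open_vimage continuous_intros) auto
      ultimately show ?thesis by (auto simp: openin_coset_topology)
    qed
    obtain F where F: "finite F" "F \<subseteq> S" "left_coset H ` S \<subseteq> (\<Union>x\<in>F. left_coset H ` U x)"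
    proof -
      have "left_coset H ` S \<subseteq> \<Union> ((\<lambda>x. left_coset H ` U x) ` S)" using UC by blast
      then obtain \<F> where "finite \<F>" "\<F> \<subseteq> (\<lambda>x. left_coset H ` U x) ` S" "left_coset H ` S \<subseteq> \<Union>\<F>"
        using S op unfolding compactin_def by (metis (no_types, lifting) imageE)
      then show thesis using that by (metis finite_subset_image)
    qed
    have "S \<subseteq> (\<lambda>(x, y). x + y) ` ((\<Union>x\<in>F. C x) \<times> H)"
    proof
      fix y assume "y \<in> S"
      then obtain x where "x \<in> F" "left_coset H y \<in> left_coset H ` U x" using F by blast
      then have "left_coset H y \<in> left_coset H ` (\<Union>x\<in>F. C x)" using UC by blast
      then show "y \<in> (\<lambda>(x, y). x + y) ` ((\<Union>x\<in>F. C x) \<times> H)" by (rule in_coset)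
    qed
    moreover have "compact ((\<lambda>(x, y). x + y) ` ((\<Union>x\<in>F. C x) \<times> H))"
      using F UC compact_H by (intro compact_plus compact_UN) auto
    moreover have "\<psi> x = 0" if "x \<notin> S" for x
      using that subsetD[OF closure_subset, of x "{x. \<psi> x \<noteq> 0}"] by (auto simp: S_def)
    ultimately show "\<psi> \<in> Cc" using cont by (intro CcI) auto
  qed
  have "continuous_on UNIV \<psi>" if "\<psi> \<in> Cc_rel H" for \<psi> :: "'a \<Rightarrow> complex"
    using that by (simp add: Cc_rel_def)
  then have "Cc_rel H = (Cc :: ('a \<Rightarrow> complex) set)"
    using iff Cc_continuous by blast
  then show ?thesis
    by (simp only: M_xi_def covariant_def)
qed

text \<open>The representatives of the classes in \<open>L1_xi_space\<close>, see
  \<open>L1_xi_carrier\<close>; the closure is expressed on functions.\<close>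

definition L1_covariant :: "('a \<Rightarrow> complex) set" where
  "L1_covariant = {f. integrable lam f \<and> (\<forall>e>0. \<exists>\<psi>\<in>covariant. (L1_dist lam f \<psi>) < e)}"

lemma L1_covariant_integrable: "f \<in> L1_covariant \<Longrightarrow> integrable lam f"
  by (simp add: L1_covariant_def)

lemma L1_covariant_approx:
  assumes "f \<in> L1_covariant" "e > 0"
  obtains \<psi> where "\<psi> \<in> covariant" "L1_dist lam f \<psi> < e"
  using assms by (auto simp: L1_covariant_def)

lemma covariant_L1_covariant: "\<psi> \<in> covariant \<Longrightarrow> \<psi> \<in> L1_covariant"
  unfolding L1_covariant_def by (auto simp: covariant_integrable intro!: bexI[of _ \<psi>])

lemma L1_covariant_add:
  assumes "f \<in> L1_covariant" "g \<in> L1_covariant"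
  shows "(\<lambda>x. f x + g x) \<in> L1_covariant"
  unfolding L1_covariant_def
proof (intro CollectI conjI allI impI)
  show "integrable lam (\<lambda>x. f x + g x)" using assms by (simp add: L1_covariant_integrable)
  fix e :: real assume e: "e > 0"
  obtain \<psi> where \<psi>: "\<psi> \<in> covariant" "L1_dist lam f \<psi> < e / 2"
    by (rule L1_covariant_approx[OF assms(1) half_gt_zero[OF e]]) (rule that)
  obtain \<theta> where \<theta>: "\<theta> \<in> covariant" "L1_dist lam g \<theta> < e / 2"
    by (rule L1_covariant_approx[OF assms(2) half_gt_zero[OF e]]) (rule that)
  have "(\<integral>x. cmod (f x + g x - (\<psi> x + \<theta> x)) \<partial>lam) < e"
    using L1_norm_triangle[of "\<lambda>x. f x - \<psi> x" "\<lambda>x. g x - \<theta> x"] assms \<psi> \<theta>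
    by (simp add: add_diff_add L1_covariant_integrable covariant_integrable)
  then show "\<exists>\<psi>\<in>covariant. (\<integral>x. cmod (f x + g x - \<psi> x) \<partial>lam) < e"
    using covariant_add[OF \<psi>(1) \<theta>(1)] by (intro bexI)
qed

lemma L1_covariant_cmult:
  assumes "f \<in> L1_covariant"
  shows "(\<lambda>x. c * f x) \<in> L1_covariant"
  unfolding L1_covariant_def
proof (intro CollectI conjI allI impI)
  show "integrable lam (\<lambda>x. c * f x)" using assms by (simp add: L1_covariant_integrable)
  fix e :: real assume e: "e > 0"
  have c: "0 < e / (1 + cmod c)" using e by (simp add: add_pos_nonneg)
  obtain \<psi> where \<psi>: "\<psi> \<in> covariant" "L1_dist lam f \<psi> < e / (1 + cmod c)"
    by (rule L1_covariant_approx[OF assms c]) (rule that)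
  have "(\<integral>x. cmod (c * f x - c * \<psi> x) \<partial>lam) = cmod c * L1_dist lam f \<psi>"
    by (simp flip: right_diff_distrib add: norm_mult)
  also have "\<dots> \<le> cmod c * (e / (1 + cmod c))" using \<psi> by (intro mult_left_mono) auto
  also have "\<dots> < e" using e by (simp add: field_simps add_pos_nonneg)
  finally show "\<exists>\<psi>\<in>covariant. (\<integral>x. cmod (c * f x - \<psi> x) \<partial>lam) < e"
    using covariant_cmult[OF \<psi>(1), of c] by (intro bexI)
qed

abbreviation "L1\<xi> \<equiv> L1_xi_space lam H \<xi>"
abbreviation "Linf\<xi> \<equiv> Linf_xi_space lam H \<xi>"
abbreviation "dual\<xi> \<equiv> dual_space L1\<xi>"

lemma L1_xi_carrier: "vcarrier L1\<xi> = L1_class lam ` L1_covariant"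
proof -
  have "vnorm (L1_space lam) (vadd (L1_space lam) (L1_class lam f) (vscale (L1_space lam) (- 1) (L1_class lam \<psi>)))
      = L1_dist lam f \<psi>" if "integrable lam f" "\<psi> \<in> covariant" for f \<psi>
    using that covariant_integrable[OF that(2)] by (simp add: L1_vscale L1_vadd L1_vnorm)
  then show ?thesis
    unfolding L1_xi_space_def norm_closure_def L1_carrier M_xi_eq_covariant L1_covariant_def
    by auto
qed

lemma L1_xi_ops:
  "vadd L1\<xi> = vadd (L1_space lam)"
  "vscale L1\<xi> = vscale (L1_space lam)"
  "vnorm L1\<xi> = vnorm (L1_space lam)"
  by (simp_all add: L1_xi_space_def)

lemma Linf_xi_ops:
  "vadd Linf\<xi> = vadd (Linf_space lam)"
  "vscale Linf\<xi> = vscale (Linf_space lam)"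
  "vnorm Linf\<xi> = vnorm (Linf_space lam)"
  by (simp_all add: Linf_xi_space_def)

lemma Linf_xi_carrier: "vcarrier Linf\<xi> = Linf_class lam ` covariant_Linf"
proof -
  have "Linf_class lam (\<lambda>y. \<psi> (y + h)) = Linf_class lam (\<lambda>y. \<xi> h * \<psi> y) \<longleftrightarrow> loc_AE lam (\<lambda>x. \<psi> (x + h) = \<xi> h * \<psi> x)"
    if "\<psi> \<in> Linf_funs lam" "h \<in> H" for \<psi> h
    using quotient_class_eq[OF equiv_Linf right_Linf_funs[OF that] Linf_funs_cmult[OF that(1), of "\<xi> h"]]
      right_Linf_funs[OF that] Linf_funs_cmult[OF that(1), of "\<xi> h"]
    by (simp add: Linf_rel_def)
  then show ?thesis
    unfolding Linf_xi_space_def covariant_Linf_def by auto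
qed

lemma covariant_Linf_Linf: "g \<in> covariant_Linf \<Longrightarrow> g \<in> Linf_funs lam"
  by (simp add: covariant_Linf_def)

abbreviation T :: "('a \<Rightarrow> complex) set \<Rightarrow> ('a \<Rightarrow> complex) set \<Rightarrow> complex" where
  "T \<equiv> pairing_functional lam L1\<xi>"

lemma T_class:
  assumes "f \<in> L1_covariant" "g \<in> Linf_funs lam"
  shows "T (Linf_class lam g) (L1_class lam f) = pairing lam f g"
  using assms by (intro pairing_functional_class L1_covariant_integrable) (auto simp: L1_xi_carrier)

lemma T_extensional: "T C \<in> extensional (vcarrier L1\<xi>)"
  by (simp add: pairing_functional_def)

lemma T_in_dual:
  assumes g: "g \<in> Linf_funs lam"
  shows "T (Linf_class lam g) \<in> vcarrier dual\<xi>"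
proof -
  obtain t where t: "loc_measurable lam g" "0 \<le> t" "loc_AE lam (\<lambda>x. cmod (g x) \<le> t)"
    by (rule Linf_funsE[OF g])
  have "T (Linf_class lam g) (L1_class lam (\<lambda>x. f x + f' x)) = T (Linf_class lam g) (L1_class lam f) + T (Linf_class lam g) (L1_class lam f')"
    if "f \<in> L1_covariant" "f' \<in> L1_covariant" for f f'
    using that by (simp add: T_class g L1_covariant_add distrib_right pairing_integrable L1_covariant_integrable)
  moreover have "T (Linf_class lam g) (L1_class lam (\<lambda>x. c * f x)) = c * T (Linf_class lam g) (L1_class lam f)"
    if "f \<in> L1_covariant" for f c
    using that by (simp add: T_class g L1_covariant_cmult mult.assoc)
  moreover have "cmod (T (Linf_class lam g) (L1_class lam f)) \<le> t * L1_norm lam f" if "f \<in> L1_covariant" for f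
    using that by (simp add: T_class g pairing_bound(2)[OF L1_covariant_integrable t(1,3)])
  ultimately show ?thesis
    unfolding dual_space_def
    by (auto simp: T_extensional[unfolded L1_xi_carrier] L1_xi_carrier L1_xi_ops L1_vadd L1_vscale L1_vnorm
        L1_covariant_integrable intro!: exI[of _ t])
qed

text \<open>An element of \<open>covariant_Linf\<close> pairs with \<open>f\<close> as it does with
  \<open>average f\<close>, so its values on covariant functions determine its pairings with all of
  \<open>Cc\<close>.\<close>

lemma T_inj:
  assumes g: "g \<in> covariant_Linf" "g' \<in> covariant_Linf"
    and eq: "T (Linf_class lam g) = T (Linf_class lam g')"
  shows "Linf_class lam g = Linf_class lam g'"
proof -
  have "pairing lam f g = pairing lam f g'" if f: "f \<in> Cc" for f
    using average_pairing[OF f g(1)] average_pairing[OF f g(2)] eq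
      T_class[OF covariant_L1_covariant[OF average_covariant[OF f]] covariant_Linf_Linf[OF g(1)]]
      T_class[OF covariant_L1_covariant[OF average_covariant[OF f]] covariant_Linf_Linf[OF g(2)]]
    by simp
  then have "loc_AE lam (\<lambda>x. g x = g' x)"
    by (intro loc_AE_eq_of_Cc covariant_Linf_Linf g)
  then show ?thesis
    using g by (subst quotient_class_eq[OF equiv_Linf]) (auto simp: Linf_rel_def covariant_Linf_Linf)
qed

lemma T_surj:
  assumes "\<phi> \<in> vcarrier dual\<xi>"
  shows "\<exists>g\<in>covariant_Linf. T (Linf_class lam g) = \<phi>"
proof -
  have ext: "\<phi> \<in> extensional (vcarrier L1\<xi>)"
    and add: "\<And>f f'. f \<in> L1_covariant \<Longrightarrow> f' \<in> L1_covariant \<Longrightarrow>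
      \<phi> (L1_class lam (\<lambda>x. f x + f' x)) = \<phi> (L1_class lam f) + \<phi> (L1_class lam f')"
    and scale: "\<And>f c. f \<in> L1_covariant \<Longrightarrow> \<phi> (L1_class lam (\<lambda>x. c * f x)) = c * \<phi> (L1_class lam f)"
    and "\<exists>B. \<forall>f\<in>L1_covariant. cmod (\<phi> (L1_class lam f)) \<le> B * L1_norm lam f"
    using assms unfolding dual_space_def
    by (auto simp: L1_xi_carrier L1_xi_ops L1_vadd L1_vscale L1_vnorm L1_covariant_integrable)
  then obtain B0 where B0: "\<And>f. f \<in> L1_covariant \<Longrightarrow> cmod (\<phi> (L1_class lam f)) \<le> B0 * L1_norm lam f"
    by blast
  \<comment> \<open>\<open>dual_space\<close> permits a negative constant, whereas
    \<open>Cc_functional_extends\<close> asks for a nonnegative one.\<close>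
  define B where "B = max B0 0"
  have B: "0 \<le> B" by (simp add: B_def)
  have bound: "cmod (\<phi> (L1_class lam f)) \<le> B * L1_norm lam f" if "f \<in> L1_covariant" for f
  proof -
    have "B0 * L1_norm lam f \<le> B * L1_norm lam f"
      by (intro mult_right_mono) (auto simp: B_def)
    then show ?thesis using B0[OF that] by linarith
  qed
  define \<Psi> where "\<Psi> f = \<phi> (L1_class lam (average f))" for f
  note avg = covariant_L1_covariant[OF average_covariant]
  have "\<exists>\<Phi>. L1_functional lam \<Phi> B \<and> (\<forall>f\<in>Cc. \<Phi> f = \<Psi> f)"
  proof (rule Cc_functional_extends)
    fix f :: "'a \<Rightarrow> complex" assume f: "f \<in> Cc"
    show "\<Psi> (\<lambda>x. f x + g x) = \<Psi> f + \<Psi> g" if "g \<in> Cc" for g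
      using f that by (simp add: \<Psi>_def average_add add avg)
    show "\<Psi> (\<lambda>x. c * f x) = c * \<Psi> f" for c
      using f by (simp add: \<Psi>_def average_cmult scale avg)
    show "cmod (\<Psi> f) \<le> B * L1_norm lam f"
      using bound[OF avg[OF f]] mult_left_mono[OF average_norm[OF f] B] unfolding \<Psi>_def by linarith
  qed (rule B)
  then obtain \<Phi> where \<Phi>: "L1_functional lam \<Phi> B" "\<And>f. f \<in> Cc \<Longrightarrow> \<Phi> f = \<Psi> f" by blast
  obtain \<D> where "localizing lam \<D>" using localizing_exists by blast
  then obtain g where g: "g \<in> Linf_funs lam" "\<And>f. integrable lam f \<Longrightarrow> \<Phi> f = pairing lam f g"
    using L1_functional.dual_representation[OF \<Phi>(1)] by blast
  have rep: "\<Psi> f = pairing lam f g" if "f \<in> Cc" for f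
    using \<Phi>(2)[OF that] g(2)[OF integrable_Cc[OF that]] by simp
  \<comment> \<open>Covariance of \<open>g\<close> is tested on \<open>Cc\<close>:
    \<open>\<Psi>\<close> takes equal values on \<open>f\<close> and on its twist by
    \<open>- h\<close>, and right invariance moves the translation from \<open>f\<close> to
    \<open>g\<close>.\<close>
  have "loc_AE lam (\<lambda>x. g (x + h) = \<xi> h * g x)" if h: "h \<in> H" for h
  proof (rule loc_AE_eq_of_Cc)
    show "(\<lambda>x. g (x + h)) \<in> Linf_funs lam" by (rule right_Linf_funs[OF g(1) h])
    show "(\<lambda>x. \<xi> h * g x) \<in> Linf_funs lam" by (rule Linf_funs_cmult[OF g(1)])
    fix f :: "'a \<Rightarrow> complex" assume f: "f \<in> Cc"
    define f' where "f' x = f (x + - h)" for x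
    have f': "f' \<in> Cc" unfolding f'_def by (rule Cc_translate_right[OF f])
    have "twist (- h) f = (\<lambda>x. \<xi> h * f' x)"
      using \<xi>_minus[OF h] by (simp add: twist_def f'_def)
    then have "\<Psi> (\<lambda>x. \<xi> h * f' x) = \<Psi> f"
      using average_twist[OF f minus_in_H[OF h]] by (simp add: \<Psi>_def)
    then have "\<xi> h * (pairing lam f' g) = pairing lam f g"
      using rep[OF Cc_cmult[OF f', of "\<xi> h"]] rep[OF f] by (simp add: mult.assoc)
    then have "cnj (\<xi> h) * (\<xi> h * (pairing lam f' g)) = cnj (\<xi> h) * (pairing lam f g)"
      by simp
    then have 1: "pairing lam f' g = cnj (\<xi> h) * (pairing lam f g)"
      using cnj_\<xi>[OF h] by (simp flip: mult.assoc)
    have "loc_measurable lam g" using g(1) by (simp add: Linf_funs_def)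
    then have "(\<integral>x. f' (x + h) * cnj (g (x + h)) \<partial>lam) = pairing lam f' g"
      using integral_right[of "\<lambda>x. f' x * cnj (g x)" h] borel_measurable_pairing[OF integrable_Cc[OF f']] h
      by (simp add: borel_measurable_lam)
    with 1 show "(\<integral>x. f x * cnj (g (x + h)) \<partial>lam) = (\<integral>x. f x * cnj (\<xi> h * g x) \<partial>lam)"
      by (simp add: f'_def add.assoc mult.left_commute[of _ "cnj (\<xi> h)"])
  qed
  then have g_cov: "g \<in> covariant_Linf" using g(1) by (simp add: covariant_Linf_def)
  obtain t where t: "loc_measurable lam g" "0 \<le> t" "loc_AE lam (\<lambda>x. cmod (g x) \<le> t)"
    by (rule Linf_funsE[OF g(1)])
  \<comment> \<open>On a covariant function \<open>\<Psi>\<close> agrees with \<open>\<phi>\<close>,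
    since \<open>average\<close> fixes it; approximation extends the identity to
    \<open>L1_covariant\<close>.\<close>
  have "T (Linf_class lam g) (L1_class lam f) = \<phi> (L1_class lam f)" if f: "f \<in> L1_covariant" for f
  proof -
    have "cmod ((pairing lam f g) - \<phi> (L1_class lam f)) \<le> 0"
    proof (rule le_epsilon_mult[where C="t + B"])
      fix e :: real assume e: "e > 0"
      obtain \<psi> where \<psi>: "\<psi> \<in> covariant" "L1_dist lam f \<psi> < e"
        by (rule L1_covariant_approx[OF f e]) (rule that)
      note i = L1_covariant_integrable[OF f] covariant_integrable[OF \<psi>(1)]
      have eq: "pairing lam \<psi> g = \<phi> (L1_class lam \<psi>)"
        using rep[OF covariant_Cc[OF \<psi>(1)]] by (simp add: \<Psi>_def average_covariant_id[OF \<psi>(1)])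
      have "(\<lambda>x. f x + (- 1) * \<psi> x) \<in> L1_covariant"
        by (intro L1_covariant_add L1_covariant_cmult covariant_L1_covariant f \<psi>)
      moreover have "\<phi> (L1_class lam (\<lambda>x. f x + (- 1) * \<psi> x)) = \<phi> (L1_class lam f) - \<phi> (L1_class lam \<psi>)"
        using add[OF f L1_covariant_cmult[OF covariant_L1_covariant[OF \<psi>(1)], of "- 1"]]
          scale[OF covariant_L1_covariant[OF \<psi>(1)], of "- 1"] by simp
      ultimately have 1: "cmod (\<phi> (L1_class lam f) - \<phi> (L1_class lam \<psi>)) \<le> B * L1_dist lam f \<psi>"
        using bound[of "\<lambda>x. f x + (- 1) * \<psi> x"] by simp
      have 2: "cmod ((pairing lam f g) - (pairing lam \<psi> g)) \<le> t * L1_dist lam f \<psi>"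
        unfolding pairing_diff_left[OF i g(1), symmetric]
        using i by (intro pairing_bound(2) t) auto
      have "cmod ((pairing lam f g) - \<phi> (L1_class lam f)) \<le>
          cmod ((pairing lam f g) - (pairing lam \<psi> g)) + cmod (\<phi> (L1_class lam f) - \<phi> (L1_class lam \<psi>))"
        unfolding eq using norm_triangle_ineq4[of "(pairing lam f g) - \<phi> (L1_class lam \<psi>)" "\<phi> (L1_class lam f) - \<phi> (L1_class lam \<psi>)"]
        by simp
      also have "\<dots> \<le> t * e + B * e"
        using 1 2 mult_left_mono[OF less_imp_le[OF \<psi>(2)] B] mult_left_mono[OF less_imp_le[OF \<psi>(2)] t(2)] by linarith
      finally show "cmod ((pairing lam f g) - \<phi> (L1_class lam f)) \<le> 0 + (t + B) * e"
        by (simp add: distrib_right)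
    qed
    then show ?thesis by (simp add: T_class[OF f g(1)])
  qed
  then have "T (Linf_class lam g) = \<phi>"
    by (intro extensionalityI[OF T_extensional ext]) (auto simp: L1_xi_carrier)
  with g_cov show ?thesis by blast
qed

text \<open>Hoelder's inequality gives \<open>Sup S \<le> Inf N\<close>. Conversely a test function
  \<open>f\<close> in \<open>Cc\<close> may be replaced by \<open>average f\<close>, which has the
  same pairing with \<open>g\<close> and no larger \<open>L1\<close> norm, so the unit ball of
  \<open>L1_xi_space\<close> already detects the full essential bound of \<open>g\<close>.\<close>

lemma T_norm:
  assumes g: "g \<in> covariant_Linf"
  shows "vnorm dual\<xi> (T (Linf_class lam g)) = Inf {t. loc_AE lam (\<lambda>x. cmod (g x) \<le> t)}"
proof -
  have g': "g \<in> Linf_funs lam" by (rule covariant_Linf_Linf[OF g])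
  define N where "N = {t. loc_AE lam (\<lambda>x. cmod (g x) \<le> t)}"
  define S where "S = {cmod (pairing lam f g) |f. f \<in> L1_covariant \<and> (L1_norm lam f) \<le> 1}"
  have "{cmod (T (Linf_class lam g) x) |x. x \<in> vcarrier L1\<xi> \<and> vnorm L1\<xi> x \<le> 1} = S"
  proof -
    have *: "cmod (T (Linf_class lam g) (L1_class lam f)) = cmod (pairing lam f g)"
      "vnorm L1\<xi> (L1_class lam f) = L1_norm lam f" if "f \<in> L1_covariant" for f
      using that by (simp_all add: T_class g' L1_xi_ops L1_vnorm L1_covariant_integrable)
    show ?thesis
    proof (intro set_eqI iffI)
      fix s assume "s \<in> {cmod (T (Linf_class lam g) x) |x. x \<in> vcarrier L1\<xi> \<and> vnorm L1\<xi> x \<le> 1}"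
      then obtain f where "f \<in> L1_covariant" "vnorm L1\<xi> (L1_class lam f) \<le> 1"
        "s = cmod (T (Linf_class lam g) (L1_class lam f))" unfolding L1_xi_carrier by blast
      then show "s \<in> S" unfolding S_def by (intro CollectI exI[of _ f]) (simp add: *)
    next
      fix s assume "s \<in> S"
      then obtain f where f: "f \<in> L1_covariant" "L1_norm lam f \<le> 1" "s = cmod (pairing lam f g)"
        unfolding S_def by blast
      then show "s \<in> {cmod (T (Linf_class lam g) x) |x. x \<in> vcarrier L1\<xi> \<and> vnorm L1\<xi> x \<le> 1}"
        unfolding L1_xi_carrier by (intro CollectI exI[of _ "L1_class lam f"] conjI imageI) (simp_all add: *)
    qed
  qed
  then have norm_eq: "vnorm dual\<xi> (T (Linf_class lam g)) = Sup S"
    by (simp add: dual_space_def)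
  have N_nonneg: "0 \<le> t" if "t \<in> N" for t
  proof (rule ccontr)
    assume "\<not> 0 \<le> t"
    then have "loc_AE lam (\<lambda>x. False)"
      using that unfolding N_def by (auto elim!: loc_AE_mono) (meson norm_ge_zero order_trans)
    then show False using loc_AE_False by blast
  qed
  have S_le: "s \<le> t" if "s \<in> S" "t \<in> N" for s t
  proof -
    obtain f where f: "s = cmod (pairing lam f g)" "f \<in> L1_covariant" "L1_norm lam f \<le> 1"
      using \<open>s \<in> S\<close> unfolding S_def by blast
    have "s \<le> t * L1_norm lam f"
      unfolding f(1) using g' \<open>t \<in> N\<close>
      by (intro pairing_bound(2) L1_covariant_integrable f) (auto simp: Linf_funs_def N_def)
    also have "\<dots> \<le> t * 1" using f(3) N_nonneg[OF \<open>t \<in> N\<close>] by (intro mult_left_mono)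
    finally show ?thesis by simp
  qed
  have N_ne: "N \<noteq> {}" using g' by (auto simp: Linf_funs_def N_def)
  \<comment> \<open>The zero function keeps \<open>S\<close> nonempty and makes its supremum
    nonnegative.\<close>
  have "(\<lambda>x. 0) \<in> covariant" by (auto simp: covariant_def intro: CcI[of _ "{}"])
  then have S0: "0 \<in> S"
    unfolding S_def by (auto intro!: exI[of _ "\<lambda>x. 0"] covariant_L1_covariant)
  have S_bdd: "bdd_above S" using S_le N_ne by (meson bdd_aboveI ex_in_conv)
  have S_nonneg: "0 \<le> Sup S" using cSup_upper[OF S0 S_bdd] .
  have "Sup S \<le> Inf N"
    using S_le S0 N_ne by (intro cInf_greatest cSup_least) auto
  moreover have "Inf N \<le> Sup S"
  proof (rule cInf_lower)
    show "bdd_below N" using N_nonneg by (rule bdd_belowI)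
    have "loc_AE lam (\<lambda>x. cmod (g x) \<le> Sup S)"
    proof (rule loc_AE_le_of_Cc[OF g' S_nonneg])
      fix f :: "'a \<Rightarrow> complex" assume f: "f \<in> Cc"
      define a where "a = L1_norm lam (average f)"
      have a_nonneg: "0 \<le> a" by (simp add: a_def)
      obtain t where t: "t \<in> N" using N_ne by blast
      have "cmod (pairing lam (average f) g) \<le> Sup S * a"
      proof (cases "a = 0")
        \<comment> \<open>An average of norm 0 cannot be normalised; its pairing with
          \<open>g\<close> is 0 by the essential bound \<open>t\<close>.\<close>
        case True
        have "cmod (pairing lam (average f) g) \<le> t * a"
          unfolding a_def using g' t
          by (intro pairing_bound(2) covariant_integrable average_covariant f) (auto simp: Linf_funs_def N_def)
        then show ?thesis using True by simp
      next
        case False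
        then have a: "a > 0" using a_nonneg by simp
        define u where "u x = of_real (1 / a) * average f x" for x
        have u: "u \<in> L1_covariant"
          unfolding u_def by (intro covariant_L1_covariant covariant_cmult average_covariant f)
        have "L1_norm lam u = 1 / a * a"
          using a unfolding u_def a_def by (simp add: norm_mult norm_divide)
        then have "cmod (pairing lam u g) \<in> S" using u a unfolding S_def by auto
        then have "cmod (pairing lam u g) \<le> Sup S" by (rule cSup_upper[OF _ S_bdd])
        moreover have "pairing lam u g = of_real (1 / a) * (pairing lam (average f) g)"
          unfolding u_def by (simp only: mult.assoc integral_mult_right_zero)
        ultimately show ?thesis using a by (simp add: norm_mult norm_divide field_simps)
      qed
      also have "\<dots> \<le> Sup S * L1_norm lam f"
        unfolding a_def by (intro mult_left_mono average_norm f S_nonneg)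
      finally show "cmod (pairing lam f g) \<le> Sup S * L1_norm lam f"
        by (simp only: average_pairing[OF f g])
    qed
    then show "Sup S \<in> N" by (simp add: N_def)
  qed
  ultimately show ?thesis using norm_eq by (simp add: N_def)
qed

text \<open>Elements of the dual are extensional, so equality of functionals is checked on classes
  of functions in \<open>L1_covariant\<close>; the conjugated scalar comes from
  \<open>cnj (g x)\<close> in the pairing.\<close>

lemma T_conj_isometric_iso:
  "conj_isometric_iso Linf\<xi> dual\<xi> T"
  unfolding conj_isometric_iso_def
proof (intro conjI ballI allI)
  show "bij_betw T (vcarrier Linf\<xi>) (vcarrier dual\<xi>)"
    unfolding bij_betw_def
  proof
    show "inj_on T (vcarrier Linf\<xi>)"
      unfolding Linf_xi_carrier by (rule inj_onI) (use T_inj in blast)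
    show "T ` vcarrier Linf\<xi> = vcarrier dual\<xi>"
      unfolding Linf_xi_carrier using T_in_dual[OF covariant_Linf_Linf] T_surj by blast
  qed
  fix C assume "C \<in> vcarrier Linf\<xi>"
  then obtain g where g: "C = Linf_class lam g" "g \<in> covariant_Linf" unfolding Linf_xi_carrier by blast
  note gL = covariant_Linf_Linf[OF g(2)]
  show "T (vscale Linf\<xi> c C) = vscale dual\<xi> (cnj c) (T C)" for c
  proof (rule extensionalityI[OF T_extensional])
    show "vscale dual\<xi> (cnj c) (T C) \<in> extensional (vcarrier L1\<xi>)"
      by (simp add: dual_space_def)
    fix D assume D: "D \<in> vcarrier L1\<xi>"
    then obtain f where f: "D = L1_class lam f" "f \<in> L1_covariant" unfolding L1_xi_carrier by blast
    show "T (vscale Linf\<xi> c C) D = vscale dual\<xi> (cnj c) (T C) D"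
      using D f g by (simp add: dual_space_def Linf_xi_ops Linf_vscale gL T_class Linf_funs_cmult mult.left_commute[of _ "cnj c"])
  qed
  show "vnorm dual\<xi> (T C) = vnorm Linf\<xi> C"
    using T_norm[OF g(2)] by (simp add: g(1) Linf_xi_ops Linf_vnorm gL)
  fix C' assume "C' \<in> vcarrier Linf\<xi>"
  then obtain g' where g': "C' = Linf_class lam g'" "g' \<in> covariant_Linf" unfolding Linf_xi_carrier by blast
  note gL' = covariant_Linf_Linf[OF g'(2)]
  show "T (vadd Linf\<xi> C C') = vadd dual\<xi> (T C) (T C')"
  proof (rule extensionalityI[OF T_extensional])
    show "vadd dual\<xi> (T C) (T C') \<in> extensional (vcarrier L1\<xi>)"
      by (simp add: dual_space_def)
    fix D assume D: "D \<in> vcarrier L1\<xi>"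
    then obtain f where f: "D = L1_class lam f" "f \<in> L1_covariant" unfolding L1_xi_carrier by blast
    show "T (vadd Linf\<xi> C C') D = vadd dual\<xi> (T C) (T C') D"
      using D f g g' by (simp add: dual_space_def Linf_xi_ops Linf_vadd gL gL' T_class Linf_funs_add
          distrib_left pairing_integrable L1_covariant_integrable)
  qed
qed

end

theorem theorem4p13:
  fixes lam :: "'a::{topological_group_add, t2_space} measure"
    and H :: "'a set" and \<xi> :: "'a \<Rightarrow> complex"
  assumes "locally_compact_space (euclidean :: 'a topology)"
    and "left_haar_measure lam"
    and "compact_subgroup H"
    and "is_character H \<xi>"
  shows "conj_isometric_iso (Linf_xi_space lam H \<xi>) (dual_space (L1_xi_space lam H \<xi>))
           (pairing_functional lam (L1_xi_space lam H \<xi>))"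
proof -
  interpret haar_character lam H \<xi>
    using assms by unfold_locales
  show ?thesis by (rule T_conj_isometric_iso)
qed

end
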